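(* Let $p>5$ be a prime. Then $$\left(\frac{2}{p}\right)\sum_{k=0}^{p-1}\binom{2k}{k}\frac{S_k}{800^k}\equiv \left(\frac{3}{p}\right)\sum_{k=0}^{p-1}\binom{2k}{k}\frac{S_k}{(-768)^k}\equiv\begin{cases}4x^2\pmod p&\text{if } p\equiv 1,3\pmod 8,\\ 0\pmod p&\text{if } p\equiv 5,7\pmod 8,\end{cases}$$ where in the first case $x,y$ are integers with $p=x^2+2y^2$ (such integers exist).
   Context: $\left(\frac{a}{p}\right)$ is the Legendre symbol. For nonnegative integers $n$, $S_n=\sum_{k=0}^n\binom{n}{k}\binom{2k}{k}\binom{2n-2k}{n-k}$. Congruences modulo $p$ are taken in the ring of rational numbers whose denominator is not divisible by $p$. *)

theory Defs
  imports "HOL-Number_Theory.Number_Theory"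
begin

definition S :: "nat \<Rightarrow> nat" where
  "S n = (\<Sum>k\<le>n. (n choose k) * ((2 * k) choose k) * ((2 * n - 2 * k) choose (n - k)))"

text \<open>\<^const>\<open>quotient_of\<close> yields the numerator and the positive denominator in lowest terms,
  so for prime \<open>p\<close> this is the localisation of the integers at \<open>p\<close>.\<close>

definition p_integral :: "nat \<Rightarrow> rat set" where
  "p_integral p = {r. \<not> int p dvd snd (quotient_of r)}"

definition rat_cong :: "rat \<Rightarrow> rat \<Rightarrow> nat \<Rightarrow> bool" where
  "rat_cong a b p \<longleftrightarrow>
     a \<in> p_integral p \<and> b \<in> p_integral p \<and> (\<exists>c \<in> p_integral p. a - b = of_nat p * c)"

end

theory Submission
  imports Defs "HOL-Computational_Algebra.Polynomial_FPS"
begin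

text \<open>
  Put \<open>A\<^sub>k = (4 k choose 2 k) (2 k choose k) ^ 2\<close>, \<open>F(z) = \<Sum>k. A\<^sub>k z ^ k\<close>, and let \<open>T(z)\<close> be the sum of the terms
  with \<open>k \<le> p div 4\<close>; modulo \<open>p\<close> these are all terms with \<open>k < p\<close> that do not vanish.

  \<^item> Reduction to \<open>T\<close>.  The exponential generating function of \<open>S\<close> is \<open>exp (4 x) I\<^sub>0(2 x) ^ 2\<close>, which expresses
  \<open>S n\<close> as a binomial transform (\<open>S_expansion\<close>).  Modulo \<open>p\<close> the coefficient \<open>2 k choose k\<close> is
  \<open>(- 4) ^ k\<close> times \<open>(p - 1) / 2 choose k\<close>, and the binomial theorem evaluates the sum over \<open>k\<close>: the
  sum with denominators \<open>M ^ k\<close> becomes, up to a Legendre symbol, \<open>T(1 / (M - 16) ^ 2)\<close>.  For \<open>M = 800\<close>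
  and \<open>M = -768\<close> the number \<open>M - 16\<close> is \<open>784\<close> and \<open>-784\<close>, so both sums lead to \<open>T(1 / 784 ^ 2)\<close>
  (\<open>S_sum_cong\<close>, \<open>legendre_S_sum_cong\<close>).

  \<^item> Change of the argument.  The points \<open>1 / 784 ^ 2\<close> and \<open>1 / 256\<close> belong to elliptic curves with complex
  multiplication by orders of conductor 3 and 1 in the field of the square root of -2, related by a
  3-isogeny.  Correspondingly there is the transformation
  \<open>F(u (1 - 27 u) ^ 3) = F(u ^ 3 (1 - 27 u) / (1 - 24 u) ^ 4) / (1 - 24 u)\<close>, proved by showing that both sides
  satisfy the same differential equation (\<open>cubic_transformation\<close>).  It survives truncation modulo \<open>p\<close>
  (\<open>quartic_sum_cubic_transformation\<close>), and at \<open>u = 1/108\<close> it gives \<open>T(1 / 784 ^ 2) \<equiv> T(1 / 256)\<close>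
  for \<open>p > 7\<close>.  For \<open>p = 7\<close> the sums vanish modulo \<open>p\<close> because 7 divides 784 and \<open>(p - 1) / 2\<close> is odd.

  \<^item> The value at \<open>1 / 256\<close>.  Modulo \<open>p\<close> the sum \<open>T(1 / 256)\<close> is the square of the Legendre polynomial of degree
  \<open>n = p div 4\<close> at the origin (\<open>quartic_sum_at_256\<close>).  It vanishes for odd \<open>n\<close>, that is for \<open>p \<equiv> 5, 7\<close> modulo 8,
  and equals \<open>(n choose (n / 2)) ^ 2 / 4 ^ n\<close> for even \<open>n\<close>.

  \<^item> Central binomial coefficients.  For \<open>p = 8 m + 1\<close> and \<open>p = 8 m + 3\<close> it remains to relate
  \<open>2 m choose m\<close> to \<open>p = x ^ 2 + 2 y ^ 2\<close>.  The theta series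
  \<open>\<Sum>(-1) ^ k (2 k + 1) q ^ ((2 k + 1) ^ 2 + 8 z ^ 2)\<close> over \<open>k \<ge> 0\<close> and all integers \<open>z\<close> has coefficient
  \<open>\<plusminus> 2 x\<close> at \<open>p = 8 m + 1\<close>.  It equals \<open>q (1 - 16 t ^ 8) ^ (- 1/2) dt/dq\<close> for a series \<open>t = q + \<dots>\<close> with
  integral coefficients.  A change of variable does not alter the coefficient of index \<open>p - 1\<close> of a
  differential modulo \<open>p\<close>, so \<open>\<plusminus> 2 x\<close> is congruent to the coefficient \<open>4 ^ m (2 m choose m)\<close> of the binomial
  series (\<open>coefficient_congruence\<close>).  A similar series with exponent \<open>- 3/4\<close> yields \<open>\<plusminus> y\<close> for
  \<open>p = 8 m + 3\<close>.  The existence of a representation is a by-product, since the binomial coefficient is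
  not divisible by \<open>p\<close>.  The theta identities needed here reduce to rearrangements of double sums
  and to the principle that a series invariant under \<open>q \<mapsto> q ^ 2\<close> is constant (\<open>bracket_eq\<close>).
\<close>

section \<open>The quartic hypergeometric series\<close>

text \<open>
  Equal to \<open>(4 * k)! / k! ^ 4\<close>, the coefficients of the hypergeometric series
  \<open>\<^sub>3F\<^sub>2(1/4, 1/2, 3/4; 1, 1; 256 z)\<close>.
\<close>

definition quartic_coeff :: "nat \<Rightarrow> nat" where
  "quartic_coeff k = ((4 * k) choose (2 * k)) * ((2 * k) choose k) ^ 2"

lemma central_binomial_Suc: "Suc n * ((2 * Suc n) choose Suc n) = 2 * (2 * n + 1) * ((2 * n) choose n)"
proof -
  have a: "(2 * Suc n) choose Suc n = 2 * (Suc (2 * n) choose n)"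
    using binomial_symmetric[of "Suc n" "Suc (2*n)"] by (simp)
  have "Suc n * (Suc (2 * n) choose Suc n) = Suc (2*n) * (2*n choose n)"
    using Suc_times_binomial by blast
  moreover have "(Suc (2 * n) choose Suc n) = (Suc (2 * n) choose n)"
    using binomial_symmetric[of "Suc n" "Suc (2*n)"] by simp
  ultimately have "Suc n * (Suc (2 * n) choose n) = Suc (2*n) * (2*n choose n)" by simp
  hence "2 * (Suc n * (Suc (2 * n) choose n)) = 2 * (Suc (2*n) * (2*n choose n))" by (simp only:)
  thus ?thesis unfolding a by (simp add: mult.left_commute mult.assoc)
qed

lemma quartic_coeff_Suc:
  "Suc k ^ 3 * quartic_coeff (Suc k) = 8 * (2 * k + 1) * (4 * k + 1) * (4 * k + 3) * quartic_coeff k"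
proof -
  have 1: "Suc k * ((2 * Suc k) choose Suc k) = 2 * (2 * k + 1) * ((2 * k) choose k)"
    by (rule central_binomial_Suc)
  have 2: "(2*k+1) * ((2 * (2*k+1)) choose (2*k+1)) = 2 * (2 * (2*k) + 1) * ((2 * (2*k)) choose (2*k))"
    using central_binomial_Suc[of "2*k"] by simp
  have 3: "(2*k+2) * ((2 * (2*k+2)) choose (2*k+2)) = 2 * (2 * (2*k+1) + 1) * ((2 * (2*k+1)) choose (2*k+1))"
    using central_binomial_Suc[of "2*k+1"] by simp
  define A where "A = (2 * Suc k) choose Suc k"
  define a where "a = (2 * k) choose k"
  define B where "B = (2 * (2*k+2)) choose (2*k+2)"
  define b where "b = (2 * (2*k+1)) choose (2*k+1)"
  define c where "c = (2 * (2*k)) choose (2*k)"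
  have B: "(4 * Suc k) choose (2 * Suc k) = B"
    unfolding B_def by (rule arg_cong2[where f = binomial]) simp_all
  have c: "(4 * k) choose (2 * k) = c" by (simp add: c_def)
  have "(2*k+1) * (Suc k ^ 3 * (B * A^2)) = (2*k+1) * (Suc k * B) * (Suc k * A)^2"
    by (simp add: power2_eq_square power3_eq_cube algebra_simps)
  also have "Suc k * A = 2 * (2 * k + 1) * a" using 1 unfolding A_def a_def .
  also have "Suc k * B = (2 * (2*k+1) + 1) * b"
    using 3 unfolding B_def[symmetric] b_def[symmetric] by simp
  also have "(2*k+1) * ((2 * (2*k+1) + 1) * b) = (2 * (2*k+1) + 1) * ((2*k+1) * b)"
    by (rule mult.left_commute)
  also have "(2*k+1) * b = 2 * (4 * k + 1) * c"
    using 2 unfolding b_def[symmetric] c_def[symmetric] by simp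
  also have "(2 * (2*k+1) + 1) * (2 * (4 * k + 1) * c) * (2 * (2 * k + 1) * a)^2 = (2*k+1) * (8 * (2 * k + 1) * (4 * k + 1) * (4 * k + 3) * (c * a^2))"
    by (simp add: power2_eq_square algebra_simps)
  finally have "Suc k ^ 3 * (B * A^2) = 8 * (2 * k + 1) * (4 * k + 1) * (4 * k + 3) * (c * a^2)"
    by (subst (asm) mult_cancel1) simp
  thus ?thesis unfolding quartic_coeff_def B c A_def a_def by simp
qed

definition quartic_series :: "int fps" where
  "quartic_series = Abs_fps (\<lambda>k. int (quartic_coeff k))"

lemma fps_coeff_simps:
  fixes f :: "'a::comm_ring_1 fps"
  shows "fps_nth (numeral w * f) k = numeral w * fps_nth f k"
    and "fps_nth (of_nat m * f) k = of_nat m * fps_nth f k"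
    and "fps_nth (fps_XD f) k = of_nat k * fps_nth f k"
  by (simp_all add: fps_XD_def numeral_fps_const flip: fps_of_nat)

lemma fps_XD_mult: "fps_XD (f * g) = fps_XD f * g + f * fps_XD (g :: 'a::comm_ring_1 fps)"
  by (simp add: fps_XD_def algebra_simps)
lemma fps_XD_add: "fps_XD (f + g) = fps_XD f + fps_XD (g :: 'a::comm_ring_1 fps)"
  by (simp add: fps_XD_def algebra_simps)
lemma fps_XD_diff: "fps_XD (f - g) = fps_XD f - fps_XD (g :: 'a::comm_ring_1 fps)"
  by (simp add: fps_XD_def algebra_simps)
lemma fps_XD_minus: "fps_XD (- f) = - fps_XD (f :: 'a::comm_ring_1 fps)"
  by (simp add: fps_XD_def)
lemma fps_XD_X: "fps_XD fps_X = (fps_X :: 'a::comm_ring_1 fps)"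
  by (simp add: fps_XD_def)
lemma fps_XD_numeral: "fps_XD (numeral n) = (0 :: 'a::comm_ring_1 fps)"
  by (simp add: fps_XD_def numeral_fps_const)
lemma fps_XD_one: "fps_XD 1 = (0 :: 'a::comm_ring_1 fps)"
  by (simp add: fps_XD_def)
lemma fps_XD_power: "fps_XD (f ^ n) = of_nat n * fps_XD f * (f::'a::comm_ring_1 fps) ^ (n - 1)"
  by (simp add: fps_XD_def fps_deriv_power' algebra_simps)
lemma fps_XD_compose:
  fixes f z :: "'a::idom fps"
  assumes "fps_nth z 0 = 0"
  shows "z * fps_XD (f oo z) = fps_XD z * (fps_XD f oo z)"
  using assms by (simp add: fps_XD_def fps_compose_deriv fps_compose_mult_distrib mult_ac)

lemmas fps_XD_simps = fps_XD_minus fps_XD_mult fps_XD_add fps_XD_diff fps_XD_X fps_XD_numeral fps_XD_one fps_XD_power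

lemma quartic_series_ODE:
  defines "F \<equiv> quartic_series"
  shows "(1 - 256 * fps_X) * fps_XD (fps_XD (fps_XD F)) =
    fps_X * (384 * fps_XD (fps_XD F) + 176 * fps_XD F + 24 * F)"
proof (rule fps_ext)
  fix n
  show "fps_nth ((1 - 256 * fps_X) * fps_XD (fps_XD (fps_XD F))) n =
    fps_nth (fps_X * (384 * fps_XD (fps_XD F) + 176 * fps_XD F + 24 * F)) n"
  proof (cases n)
    case (Suc k)
    have "int (Suc k ^ 3 * quartic_coeff (Suc k)) = int (8 * (2 * k + 1) * (4 * k + 1) * (4 * k + 3) * quartic_coeff k)"
      by (simp only: quartic_coeff_Suc)
    then show ?thesis unfolding Suc
      by (simp add: ring_distribs mult.assoc fps_coeff_simps F_def quartic_series_def power3_eq_cube)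
  qed (simp add: ring_distribs mult.assoc fps_coeff_simps)
qed

section \<open>A cubic transformation\<close>

text \<open>
  If \<open>g\<^sub>i\<close> is the \<open>i\<close>-th Euler derivative of a series \<open>F\<close>, pulled back along \<open>z\<close>, then each
  Euler derivative of \<open>g\<^sub>i\<close> is \<open>g\<^sub>i\<^sub>+\<^sub>1\<close> times the logarithmic derivative \<open>e / s\<close> of \<open>z\<close>.  Iterating the
  product rule with all denominators cleared expresses the Euler derivatives of the pullback \<open>g\<^sub>0\<close>
  through \<open>g\<^sub>1, g\<^sub>2, g\<^sub>3\<close>, to which the differential equation of \<open>F\<close> applies.
\<close>

lemma chain_derivatives:
  fixes s e g0 g1 g2 g3 :: "'a::idom fps"
  assumes 1: "s * fps_XD g0 = e * g1" and 2: "s * fps_XD g1 = e * g2" and 3: "s * fps_XD g2 = e * g3"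
  defines "q \<equiv> s * fps_XD e - e * fps_XD s"
  shows "s ^ 2 * fps_XD (fps_XD g0) = e ^ 2 * g2 + q * g1"
    and "s ^ 3 * fps_XD (fps_XD (fps_XD g0)) =
      e ^ 3 * g3 + (2 * e * s * fps_XD e + q * e - 2 * fps_XD s * e ^ 2) * g2 +
      (s * fps_XD q - 2 * fps_XD s * q) * g1"
proof -
  have "fps_XD (s * fps_XD g0) = fps_XD (e * g1)" by (simp only: 1)
  hence "s * fps_XD (fps_XD g0) + fps_XD s * fps_XD g0 = fps_XD e * g1 + e * fps_XD g1"
    by (simp add: fps_XD_mult add_ac)
  with 1 2 show *: "s ^ 2 * fps_XD (fps_XD g0) = e ^ 2 * g2 + q * g1"
    unfolding q_def by Groebner_Basis.algebra
  have "fps_XD (s ^ 2 * fps_XD (fps_XD g0)) = fps_XD (e ^ 2 * g2 + q * g1)" by (simp only: *)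
  hence "2 * s * fps_XD s * fps_XD (fps_XD g0) + s ^ 2 * fps_XD (fps_XD (fps_XD g0)) =
     2 * e * fps_XD e * g2 + e ^ 2 * fps_XD g2 + fps_XD q * g1 + q * fps_XD g1"
    by (simp add: fps_XD_mult fps_XD_add fps_XD_power algebra_simps)
  with * 2 3 show "s ^ 3 * fps_XD (fps_XD (fps_XD g0)) =
      e ^ 3 * g3 + (2 * e * s * fps_XD e + q * e - 2 * fps_XD s * e ^ 2) * g2 +
      (s * fps_XD q - 2 * fps_XD s * q) * g1"
    by Groebner_Basis.algebra
qed

text \<open>
  A third-order operator in the Euler derivation, with a regular singular point at the origin.
  It annihilates both sides of the cubic transformation; its coefficients come from solving the
  linear equations that a five-term recurrence imposes on the coefficients of
  \<open>F(u (1 - 27 u) ^ 3) = 1 + 24 u + 576 u ^ 2 + \<dots>\<close>.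
\<close>

definition level6_op :: "int fps \<Rightarrow> int fps" where
  "level6_op f = fps_XD (fps_XD (fps_XD f))
     - fps_X * (94 * fps_XD (fps_XD (fps_XD f)) + 141 * fps_XD (fps_XD f) + 95 * fps_XD f + 24 * f)
     + fps_X ^ 2 * (3321 * fps_XD (fps_XD (fps_XD f)) + 9963 * fps_XD (fps_XD f) + 10530 * fps_XD f + 3888 * f)
     - fps_X ^ 3 * (52488 * fps_XD (fps_XD (fps_XD f)) + 236196 * fps_XD (fps_XD f) + 341172 * fps_XD f + 157464 * f)
     + fps_X ^ 4 * (314928 * fps_XD (fps_XD (fps_XD f)) + 1889568 * fps_XD (fps_XD f) + 3464208 * fps_XD f + 1889568 * f)"

text \<open>
  The indicial polynomial at the origin is \<open>n ^ 3\<close>, so the operator determines every coefficient of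
  positive index from the earlier ones.
\<close>

lemma level6_op_unique:
  assumes "level6_op f = 0" "level6_op g = 0" "fps_nth f 0 = fps_nth g 0"
  shows "f = g"
proof -
  define d where "d = f - g"
  have "level6_op d = level6_op f - level6_op g"
    unfolding level6_op_def d_def by (simp add: fps_XD_diff algebra_simps)
  hence op: "level6_op d = 0" using assms by simp
  have "fps_nth d n = 0" for n
  proof (induction n rule: less_induct)
    case (less n)
    show ?case
    proof (cases "n = 0")
      case True thus ?thesis using assms by (simp add: d_def)
    next
      case False
      have "fps_nth (level6_op d) n = int n * (int n * (int n * fps_nth d n))"
        unfolding level6_op_def using less False
        by (simp add: fps_X_power_mult_nth fps_coeff_simps)
      thus ?thesis using False op by simp
    qed
  qed
  hence "d = 0" by (intro fps_ext) simp
  thus ?thesis by (simp add: d_def)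
qed

text \<open>
  The argument \<open>z = u (1 - 27 u) ^ 3\<close> has logarithmic derivative \<open>(1 - 108 u) / (1 - 27 u)\<close>.  After
  multiplication by \<open>(1 - 27 u) ^ 3\<close> the operator applied to the pullback is a multiple of the
  pulled-back equation of the quartic series, because
  \<open>1 - 256 z = (1 - 108 u) ^ 2 (1 - 40 u + 432 u ^ 2)\<close>.
\<close>

lemma level6_op_quartic_pullback:
  "level6_op (quartic_series oo (fps_X * (1 - 27 * fps_X) ^ 3)) = 0"
proof -
  define X where "X = (fps_X :: int fps)"
  define z where "z = X * (1 - 27 * X) ^ 3"
  have z0: "fps_nth z 0 = 0" by (simp add: z_def X_def)
  define F where "F = quartic_series"
  define g0 where "g0 = F oo z"
  define g1 where "g1 = fps_XD F oo z"
  define g2 where "g2 = fps_XD (fps_XD F) oo z"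
  define g3 where "g3 = fps_XD (fps_XD (fps_XD F)) oo z"
  define s where "s = 1 - 27 * X"
  define e where "e = 1 - 108 * X"
  have XDX: "fps_XD X = X" by (simp add: X_def fps_XD_X)
  have XDz: "fps_XD z = X * s ^ 2 * e"
    by (simp add: z_def s_def e_def fps_XD_simps XDX) Groebner_Basis.algebra
  have step: "s * fps_XD (f oo z) = e * (fps_XD f oo z)" for f
  proof -
    have nz: "X * s ^ 2 \<noteq> 0"
    proof -
      have "fps_nth s 0 \<noteq> 0" by (simp add: s_def X_def)
      hence "s \<noteq> 0" by auto
      thus ?thesis by (simp add: X_def)
    qed
    have "z * fps_XD (f oo z) = fps_XD z * (fps_XD f oo z)" by (rule fps_XD_compose[OF z0])
    hence "(X * s ^ 2) * (s * fps_XD (f oo z)) = (X * s ^ 2) * (e * (fps_XD f oo z))"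
      unfolding XDz by (simp add: z_def s_def power2_eq_square power3_eq_cube mult_ac)
    with nz show ?thesis by (simp only: mult_left_cancel[OF nz])
  qed
  note ch = chain_derivatives[OF step[of F, folded g0_def g1_def] step[of "fps_XD F", folded g1_def g2_def]
     step[of "fps_XD (fps_XD F)", folded g2_def g3_def]]
  have "((1 - 256 * fps_X) * fps_XD (fps_XD (fps_XD F))) oo z =
    (fps_X * (384 * fps_XD (fps_XD F) + 176 * fps_XD F + 24 * F)) oo z"
    using quartic_series_ODE unfolding F_def by simp
  hence ode: "(1 - 256 * z) * g3 = z * (384 * g2 + 176 * g1 + 24 * g0)"
    by (simp add: fps_compose_mult_distrib[OF z0] fps_compose_add_distrib fps_compose_sub_distrib z0
        g0_def g1_def g2_def g3_def)
  have d1: "s * fps_XD g0 = e * g1" using step[of F] by (simp add: g0_def g1_def)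
  have Ds: "fps_XD s = - 27 * X" and De: "fps_XD e = - 108 * X"
    by (simp_all add: s_def e_def fps_XD_simps XDX)
  have q: "s * fps_XD e - e * fps_XD s = - 81 * X"
    unfolding Ds De unfolding s_def e_def by Groebner_Basis.algebra
  have d2: "s ^ 2 * fps_XD (fps_XD g0) = e ^ 2 * g2 - 81 * X * g1"
    using ch(1) unfolding q by simp
  have Dq: "fps_XD (- 81 * X) = - 81 * X" by (simp add: fps_XD_simps XDX)
  have d3: "s ^ 3 * fps_XD (fps_XD (fps_XD g0)) =
      e ^ 3 * g3 + (2 * e * s * (- 108 * X) - 81 * X * e + 54 * X * e ^ 2) * g2 +
      (s * (- 81 * X) - 54 * X * 81 * X) * g1"
    using ch(2)[unfolded q, unfolded Dq Ds De] by simp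
  define h1 h2 h3 where "h1 = fps_XD g0" and "h2 = fps_XD (fps_XD g0)" and "h3 = fps_XD (fps_XD (fps_XD g0))"
  have nz: "s ^ 3 \<noteq> 0"
  proof -
    have "fps_nth s 0 \<noteq> 0" by (simp add: s_def X_def)
    thus ?thesis by auto
  qed
  have "s ^ 3 * level6_op g0 =
      (1 - 94 * X + 3321 * X ^ 2 - 52488 * X ^ 3 + 314928 * X ^ 4) * (s ^ 3 * h3)
    + (- 141 * X + 9963 * X ^ 2 - 236196 * X ^ 3 + 1889568 * X ^ 4) * s * (s ^ 2 * h2)
    + (- 95 * X + 10530 * X ^ 2 - 341172 * X ^ 3 + 3464208 * X ^ 4) * s ^ 2 * (s * h1)
    + (- 24 * X + 3888 * X ^ 2 - 157464 * X ^ 3 + 1889568 * X ^ 4) * s ^ 3 * g0"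
    unfolding level6_op_def X_def[symmetric] h1_def h2_def h3_def by Groebner_Basis.algebra
  also have "\<dots> = e * s ^ 2 * ((1 - 256 * z) * g3 - z * (384 * g2 + 176 * g1 + 24 * g0))"
    unfolding h1_def h2_def h3_def d1 d2 d3 unfolding z_def s_def e_def by Groebner_Basis.algebra
  also have "\<dots> = 0" by (simp only: ode) simp
  finally show ?thesis using nz by (simp add: g0_def z_def X_def F_def)
qed

text \<open>
  Here \<open>I\<close> is the inverse of \<open>1 - 24 u\<close>.  The logarithmic derivative of the argument is
  \<open>3 (1 - 28 u) / ((1 - 27 u) (1 - 24 u))\<close>, and the factor \<open>I\<close> in front of the composition is
  moved to the other side, as \<open>g\<^sub>0 = (1 - 24 u) H\<close>, before the derivatives are compared.
\<close>

lemma level6_op_cubic_pullback: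
  fixes I :: "int fps"
  assumes I: "(1 - 24 * fps_X) * I = 1"
  shows "level6_op (I * (quartic_series oo (fps_X ^ 3 * (1 - 27 * fps_X) * I ^ 4))) = 0"
proof -
  define X where "X = (fps_X :: int fps)"
  define a where "a = 1 - 27 * X"
  define c where "c = 1 - 24 * X"
  define z where "z = X ^ 3 * a * I ^ 4"
  have cI: "c * I = 1" using I by (simp add: c_def X_def)
  have z0: "fps_nth z 0 = 0" by (simp add: z_def X_def)
  define F where "F = quartic_series"
  define g0 where "g0 = F oo z"
  define g1 where "g1 = fps_XD F oo z"
  define g2 where "g2 = fps_XD (fps_XD F) oo z"
  define g3 where "g3 = fps_XD (fps_XD (fps_XD F)) oo z"
  define s where "s = a * c"
  define e where "e = 3 * (1 - 28 * X)"
  have XDX: "fps_XD X = X" by (simp add: X_def fps_XD_X)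
  have Da: "fps_XD a = - 27 * X" and Dc: "fps_XD c = - 24 * X" and De: "fps_XD e = - 84 * X"
    by (simp_all add: a_def c_def e_def fps_XD_simps XDX)
  have "fps_XD (c * I) = 0" by (simp add: cI fps_XD_one)
  hence DI: "c * fps_XD I = 24 * X * I" by (simp add: fps_XD_mult Dc)
  have anz: "a \<noteq> 0" and cnz: "c \<noteq> 0" and Inz: "I \<noteq> 0"
  proof -
    have "fps_nth a 0 \<noteq> 0" by (simp add: a_def X_def)
    thus "a \<noteq> 0" by auto
    show "c \<noteq> 0" "I \<noteq> 0" using cI by auto
  qed
  have "c * fps_XD z = X ^ 3 * I ^ 4 * (3 * a * c - 27 * X * c) + 4 * X ^ 3 * a * I ^ 3 * (c * fps_XD I)"
    unfolding z_def by (simp add: fps_XD_simps XDX Da) Groebner_Basis.algebra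
  also have "\<dots> = X ^ 3 * I ^ 4 * e"
    unfolding DI unfolding a_def c_def e_def by Groebner_Basis.algebra
  finally have XDz: "c * fps_XD z = X ^ 3 * I ^ 4 * e" .
  have step: "s * fps_XD (f oo z) = e * (fps_XD f oo z)" for f
  proof -
    have nz: "X ^ 3 * I ^ 4 \<noteq> 0" using Inz by (simp add: X_def)
    have "z * fps_XD (f oo z) = fps_XD z * (fps_XD f oo z)" by (rule fps_XD_compose[OF z0])
    hence "c * (z * fps_XD (f oo z)) = c * fps_XD z * (fps_XD f oo z)" by (simp only: mult.assoc)
    hence "(X ^ 3 * I ^ 4) * (s * fps_XD (f oo z)) = (X ^ 3 * I ^ 4) * (e * (fps_XD f oo z))"
      unfolding XDz by (simp add: z_def s_def mult_ac)
    with nz show ?thesis by (simp only: mult_left_cancel[OF nz])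
  qed
  note ch = chain_derivatives[OF step[of F, folded g0_def g1_def] step[of "fps_XD F", folded g1_def g2_def]
     step[of "fps_XD (fps_XD F)", folded g2_def g3_def]]
  have "((1 - 256 * fps_X) * fps_XD (fps_XD (fps_XD F))) oo z =
    (fps_X * (384 * fps_XD (fps_XD F) + 176 * fps_XD F + 24 * F)) oo z"
    using quartic_series_ODE unfolding F_def by simp
  hence "(1 - 256 * z) * g3 = z * (384 * g2 + 176 * g1 + 24 * g0)"
    by (simp add: fps_compose_mult_distrib[OF z0] fps_compose_add_distrib fps_compose_sub_distrib z0
        g0_def g1_def g2_def g3_def)
  hence "c ^ 4 * ((1 - 256 * z) * g3) = c ^ 4 * (z * (384 * g2 + 176 * g1 + 24 * g0))" by (simp only:)
  moreover have "c ^ 4 * z = X ^ 3 * a"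
  proof -
    have "c ^ 4 * z = X ^ 3 * a * (c * I) ^ 4" by (simp add: z_def power_mult_distrib mult_ac)
    thus ?thesis by (simp add: cI)
  qed
  ultimately have ode: "(c ^ 4 - 256 * X ^ 3 * a) * g3 = X ^ 3 * a * (384 * g2 + 176 * g1 + 24 * g0)"
    by Groebner_Basis.algebra
  have d1: "s * fps_XD g0 = e * g1" using step[of F] by (simp add: g0_def g1_def)
  define r where "r = - 51 * X + 1296 * X ^ 2"
  have Ds: "fps_XD s = r"
    unfolding s_def fps_XD_mult Da Dc unfolding a_def c_def r_def by Groebner_Basis.algebra
  define q where "q = 69 * X - 3888 * X ^ 2 + 54432 * X ^ 3"
  have q: "s * fps_XD e - e * fps_XD s = q"
    unfolding Ds De unfolding s_def e_def a_def c_def q_def r_def by Groebner_Basis.algebra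
  have d2: "s ^ 2 * fps_XD (fps_XD g0) = e ^ 2 * g2 + q * g1"
    using ch(1) unfolding q by simp
  define q' where "q' = 69 * X - 7776 * X ^ 2 + 163296 * X ^ 3"
  have Dq: "fps_XD q = q'" unfolding q_def q'_def
    by (simp add: fps_XD_simps XDX power2_eq_square power3_eq_cube)
  have d3: "s ^ 3 * fps_XD (fps_XD (fps_XD g0)) =
      e ^ 3 * g3 + (2 * e * s * (- 84 * X) + q * e - 2 * r * e ^ 2) * g2 + (s * q' - 2 * r * q) * g1"
    using ch(2)[unfolded q, unfolded Dq Ds De] by simp
  define H where "H = I * g0"
  have g0H: "g0 = c * H" using cI unfolding H_def by (simp flip: mult.assoc)
  define h1 h2 h3 where "h1 = fps_XD H" and "h2 = fps_XD (fps_XD H)" and "h3 = fps_XD (fps_XD (fps_XD H))"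
  have k1: "fps_XD g0 = c * h1 - 24 * X * H"
    unfolding g0H h1_def by (simp add: fps_XD_simps Dc)
  have k2: "fps_XD (fps_XD g0) = c * h2 - 48 * X * h1 - 24 * X * H"
    unfolding k1 h2_def h1_def by (simp add: fps_XD_simps Dc XDX)
  have k3: "fps_XD (fps_XD (fps_XD g0)) = c * h3 - 72 * X * h2 - 72 * X * h1 - 24 * X * H"
    unfolding k2 h3_def h2_def h1_def by (simp add: fps_XD_simps Dc XDX)
  define k where "k = g0"
  define K1 K2 K3 where "K1 = fps_XD g0" and "K2 = fps_XD (fps_XD g0)" and "K3 = fps_XD (fps_XD (fps_XD g0))"
  \<comment> \<open>The product rule for g0 = c * H, solved for the derivatives of H.\<close>
  have e1: "c ^ 2 * h1 = c * K1 + 24 * X * k"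
    using k1 g0H unfolding K1_def[symmetric] unfolding k_def[symmetric] by Groebner_Basis.algebra
  have e2: "c ^ 3 * h2 = c ^ 2 * K2 + 48 * X * (c * K1 + 24 * X * k) + 24 * X * c * k"
    using k2 g0H e1 unfolding K2_def[symmetric] unfolding k_def[symmetric] by Groebner_Basis.algebra
  have e3: "c ^ 4 * h3 = c ^ 3 * K3 + 72 * X * (c ^ 2 * K2 + 48 * X * (c * K1 + 24 * X * k) + 24 * X * c * k)
      + 72 * X * c * (c * K1 + 24 * X * k) + 24 * X * c ^ 2 * k"
    using k3 g0H e1 e2 unfolding K3_def[symmetric] unfolding k_def[symmetric] by Groebner_Basis.algebra
  have "c ^ 4 * level6_op H =
      (1 - 94 * X + 3321 * X ^ 2 - 52488 * X ^ 3 + 314928 * X ^ 4) * (c ^ 4 * h3)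
    + (- 141 * X + 9963 * X ^ 2 - 236196 * X ^ 3 + 1889568 * X ^ 4) * c * (c ^ 3 * h2)
    + (- 95 * X + 10530 * X ^ 2 - 341172 * X ^ 3 + 3464208 * X ^ 4) * c ^ 2 * (c ^ 2 * h1)
    + (- 24 * X + 3888 * X ^ 2 - 157464 * X ^ 3 + 1889568 * X ^ 4) * c ^ 3 * (c * H)"
    unfolding level6_op_def X_def[symmetric] h1_def h2_def h3_def by Groebner_Basis.algebra
  also have "\<dots> =
      (1 - 94 * X + 3321 * X ^ 2 - 52488 * X ^ 3 + 314928 * X ^ 4) * (c ^ 3 * K3 + 72 * X * (c ^ 2 * K2 + 48 * X * (c * K1 + 24 * X * k) + 24 * X * c * k)
      + 72 * X * c * (c * K1 + 24 * X * k) + 24 * X * c ^ 2 * k)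
    + (- 141 * X + 9963 * X ^ 2 - 236196 * X ^ 3 + 1889568 * X ^ 4) * c * (c ^ 2 * K2 + 48 * X * (c * K1 + 24 * X * k) + 24 * X * c * k)
    + (- 95 * X + 10530 * X ^ 2 - 341172 * X ^ 3 + 3464208 * X ^ 4) * c ^ 2 * (c * K1 + 24 * X * k)
    + (- 24 * X + 3888 * X ^ 2 - 157464 * X ^ 3 + 1889568 * X ^ 4) * c ^ 3 * k"
    unfolding e1 e2 e3 by (simp only: g0H[symmetric] k_def)
  finally have M: "c ^ 4 * level6_op H = \<dots>" .
  have "a ^ 3 * (c ^ 4 * level6_op H) =
      (1 - 94 * X + 3321 * X ^ 2 - 52488 * X ^ 3 + 314928 * X ^ 4) * (s ^ 3 * K3
       + 72 * X * a * (s ^ 2 * K2) + 72 * 48 * X ^ 2 * a ^ 2 * (s * K1) + 72 * 48 * 24 * X ^ 3 * a ^ 3 * k + 72 * 24 * X ^ 2 * a ^ 3 * c * k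
      + 72 * X * c * a ^ 2 * (s * K1) + 72 * 24 * X ^ 2 * c * a ^ 3 * k + 24 * X * c ^ 2 * a ^ 3 * k)
    + (- 141 * X + 9963 * X ^ 2 - 236196 * X ^ 3 + 1889568 * X ^ 4) * c *
       (a * (s ^ 2 * K2) + 48 * X * a ^ 2 * (s * K1) + 48 * 24 * X ^ 2 * a ^ 3 * k + 24 * X * a ^ 3 * c * k)
    + (- 95 * X + 10530 * X ^ 2 - 341172 * X ^ 3 + 3464208 * X ^ 4) * c ^ 2 * (a ^ 2 * (s * K1) + 24 * X * a ^ 3 * k)
    + (- 24 * X + 3888 * X ^ 2 - 157464 * X ^ 3 + 1889568 * X ^ 4) * c ^ 3 * a ^ 3 * k"
    unfolding M s_def by Groebner_Basis.algebra
  also have "\<dots> = 9 * a ^ 2 * e * ((c ^ 4 - 256 * X ^ 3 * a) * g3 - X ^ 3 * a * (384 * g2 + 176 * g1 + 24 * k))"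
    unfolding K1_def K2_def K3_def d1 d2 d3
    unfolding s_def a_def c_def e_def r_def q_def q'_def by Groebner_Basis.algebra
  also have "\<dots> = 0" by (simp only: ode k_def) simp
  finally show ?thesis using anz cnz
    by (simp add: H_def g0_def z_def X_def F_def a_def)
qed

text \<open>
  The modular equation of degree three for the level-two series: \<open>u\<close> parametrises the level-six
  curve, and its two arguments are the values of the level-two parameter at \<open>\<tau>\<close> and \<open>3 \<tau>\<close>.
\<close>

lemma cubic_transformation:
  fixes I :: "int fps"
  assumes I: "(1 - 24 * fps_X) * I = 1"
  shows "quartic_series oo (fps_X * (1 - 27 * fps_X) ^ 3) =
    I * (quartic_series oo (fps_X ^ 3 * (1 - 27 * fps_X) * I ^ 4))"
proof (rule level6_op_unique[OF level6_op_quartic_pullback level6_op_cubic_pullback[OF I]])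
  have "fps_nth ((1 - 24 * fps_X) * I) 0 = 1" by (simp add: I)
  hence "fps_nth I 0 = 1" by simp
  thus "fps_nth (quartic_series oo fps_X * (1 - 27 * fps_X) ^ 3) 0 =
    fps_nth (I * (quartic_series oo fps_X ^ 3 * (1 - 27 * fps_X) * I ^ 4)) 0" by simp
qed

section \<open>The cubic transformation modulo a prime\<close>

lemma quartic_coeff_fact: "quartic_coeff k * fact k ^ 4 = fact (4 * k)"
proof -
  have 1: "fact (2*k) * fact (2*k) * ((4*k) choose (2*k)) = fact (4*k)"
    using binomial_fact_lemma[of "2*k" "4*k"] by simp
  have 2: "fact k * fact k * ((2*k) choose k) = fact (2*k)"
    using binomial_fact_lemma[of k "2*k"] by simp
  have "quartic_coeff k * fact k ^ 4 =
    (fact k * fact k * ((2*k) choose k)) * (fact k * fact k * ((2*k) choose k)) * ((4*k) choose (2*k))"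
    by (simp add: quartic_coeff_def power2_eq_square power4_eq_xxxx mult_ac)
  also have "\<dots> = fact (4*k)" unfolding 2 by (rule 1)
  finally show ?thesis .
qed

text \<open>
  The numerator of \<open>(4 * k)! / k! ^ 4\<close> contains the factor \<open>p\<close> and the denominator does not.  Modulo
  \<open>p\<close> the series truncated below \<open>p\<close> therefore stops at \<open>p div 4\<close>.
\<close>

lemma prime_dvd_quartic_coeff:
  assumes "prime p" "p div 4 < k" "k < p"
  shows "p dvd quartic_coeff k"
proof -
  have "p dvd fact (4 * k)" using assms by (simp add: prime_dvd_fact_iff)
  hence "p dvd quartic_coeff k * fact k ^ 4" by (simp only: quartic_coeff_fact)
  moreover have "\<not> p dvd fact k ^ 4"
    using assms prime_dvd_fact_iff[of p k] by (auto simp: prime_dvd_power_iff)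
  ultimately show ?thesis using assms by (simp add: prime_dvd_mult_iff)
qed

lemma fps_power_nth_eq_0:
  fixes z :: "'a::comm_ring_1 fps"
  assumes "fps_nth z 0 = 0" "N < k"
  shows "fps_nth (z ^ k) N = 0"
  using assms startsby_zero_power_prefix by blast

lemma quartic_series_compose_cong:
  assumes p: "prime p" and z: "fps_nth z 0 = 0" and N: "N < p"
  shows "[fps_nth (quartic_series oo z) N =
    fps_nth (\<Sum>k\<le>p div 4. of_nat (quartic_coeff k) * z ^ k) N] (mod int p)"
proof -
  have "fps_nth (quartic_series oo z) N = (\<Sum>k\<le>N. int (quartic_coeff k) * fps_nth (z ^ k) N)"
    by (simp add: fps_compose_nth quartic_series_def atLeast0AtMost)
  also have "\<dots> = (\<Sum>k<p. int (quartic_coeff k) * fps_nth (z ^ k) N)"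
    using N by (intro sum.mono_neutral_left) (auto simp: fps_power_nth_eq_0[OF z])
  also have "[\<dots> = (\<Sum>k<p. if k \<le> p div 4 then int (quartic_coeff k) * fps_nth (z ^ k) N else 0)] (mod int p)"
    using prime_dvd_quartic_coeff[OF p]
    by (intro cong_sum) (auto simp: cong_0_iff intro!: dvd_mult2)
  also have "(\<Sum>k<p. if k \<le> p div 4 then int (quartic_coeff k) * fps_nth (z ^ k) N else 0)
     = (\<Sum>k\<le>p div 4. int (quartic_coeff k) * fps_nth (z ^ k) N)"
  proof -
    have "{k\<in>{..<p}. k \<le> p div 4} = {..p div 4}" using prime_gt_1_nat[OF p] by auto
    thus ?thesis by (simp add: sum.inter_filter[symmetric])
  qed
  finally show ?thesis by (simp add: fps_sum_nth fps_coeff_simps)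
qed

lemma prime_dvd_binomial:
  assumes "prime (p::nat)" "0 < i" "i < p"
  shows "p dvd (p choose i)"
proof -
  have "p dvd fact i * fact (p - i) * (p choose i)"
    using assms binomial_fact_lemma[of i p] by (simp add: prime_dvd_fact_iff)
  moreover have "\<not> p dvd fact i" "\<not> p dvd fact (p - i)"
    using assms by (simp_all add: prime_dvd_fact_iff)
  ultimately show ?thesis using assms(1) by (simp add: prime_dvd_mult_iff)
qed

lemma fps_linear_power_prime_cong:
  fixes f :: "int fps"
  assumes p: "prime p" and N: "N < p"
  shows "[fps_nth ((1 - numeral w * fps_X) ^ p * f) N = fps_nth f N] (mod int p)"
proof -
  have coeff: "fps_nth ((1 - numeral w * fps_X :: int fps) ^ p) i = int (p choose i) * (- numeral w) ^ i" for i
  proof -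
    have "(1 - numeral w * fps_X :: int fps) = fps_const (- numeral w) * fps_X + 1"
      by (simp add: numeral_fps_const flip: fps_const_neg)
    also have "\<dots> ^ p = (\<Sum>k\<le>p. of_nat (p choose k) * (fps_const (- numeral w) * fps_X) ^ k)"
      by (simp add: binomial_ring)
    finally show ?thesis
      by (simp add: fps_sum_nth power_mult_distrib fps_const_power mult.assoc if_distrib
          flip: fps_of_nat cong: if_cong)
  qed
  have "fps_nth ((1 - numeral w * fps_X) ^ p * f) N =
     (\<Sum>i\<le>N. int (p choose i) * (- numeral w) ^ i * fps_nth f (N - i))"
    by (simp add: fps_mult_nth coeff atLeast0AtMost)
  also have "[\<dots> = (\<Sum>i\<le>N. if i = 0 then fps_nth f N else 0)] (mod int p)"
  proof (intro cong_sum)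
    fix i assume "i \<in> {..N}"
    have "int p dvd int (p choose i)" if "i \<noteq> 0"
      using that \<open>i \<in> {..N}\<close> N p prime_dvd_binomial[of p i] by auto
    thus "[int (p choose i) * (- numeral w) ^ i * fps_nth f (N - i) = (if i = 0 then fps_nth f N else 0)] (mod int p)"
      by (auto simp: cong_0_iff intro!: dvd_mult2)
  qed
  finally show ?thesis by simp
qed

lemma fps_of_poly_of_nat: "fps_of_poly (of_nat n :: 'a::comm_ring_1 poly) = of_nat n"
  by (induction n) (simp_all add: fps_of_poly_add)

lemma four_mult_neq_prime: "prime (p :: nat) \<Longrightarrow> 4 * k \<noteq> p"
proof
  assume "prime p" "4 * k = p"
  hence "2 dvd p" "p \<noteq> 2" by auto
  thus False using \<open>prime p\<close> primes_dvd_imp_eq[of 2 p] by auto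
qed

text \<open>
  Modulo \<open>p\<close> the factor \<open>(1 - 24 u) ^ (- 4 k - 1)\<close> may be replaced by \<open>(1 - 24 u) ^ (p - 1 - 4 k)\<close>
  as far as coefficients of index below \<open>p\<close> are concerned, since \<open>(1 - 24 u) ^ p\<close> has only the
  constant coefficient in that range.  Both sides then are polynomials of degree at most \<open>p - 1\<close>,
  so that agreement of these coefficients is agreement of the polynomials.
\<close>

lemma quartic_sum_cubic_transformation:
  fixes u :: int
  assumes p: "prime p"
  shows "[(\<Sum>k\<le>p div 4. int (quartic_coeff k) * (u * (1 - 27 * u) ^ 3) ^ k) =
    (\<Sum>k\<le>p div 4. int (quartic_coeff k) * (u ^ 3 * (1 - 27 * u)) ^ k * (1 - 24 * u) ^ (p - 1 - 4 * k))] (mod int p)"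
proof -
  note four_mult_neq = four_mult_neq_prime[OF p]
  define X :: "int poly" where "X = [:0, 1:]"
  define L where "L = (\<Sum>k\<le>p div 4. of_nat (quartic_coeff k) * (X * (1 - 27 * X) ^ 3) ^ k)"
  define R where "R = (\<Sum>k\<le>p div 4. of_nat (quartic_coeff k) * (X ^ 3 * (1 - 27 * X)) ^ k * (1 - 24 * X) ^ (p - 1 - 4 * k))"
  define I :: "int fps" where "I = Abs_fps (\<lambda>n. 24 ^ n)"
  define c :: "int fps" where "c = 1 - 24 * fps_X"
  have I: "c * I = 1"
  proof (rule fps_ext)
    fix n show "fps_nth (c * I) n = fps_nth 1 n"
      by (cases n) (simp_all add: c_def ring_distribs fps_coeff_simps mult.assoc I_def)
  qed
  have fpsX: "fps_of_poly X = fps_X" by (simp add: X_def)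
  define z where "z = fps_X * (1 - 27 * fps_X :: int fps) ^ 3"
  define w where "w = fps_X ^ 3 * (1 - 27 * fps_X) * I ^ 4"
  have Lfps: "fps_of_poly L = (\<Sum>k\<le>p div 4. of_nat (quartic_coeff k) * z ^ k)"
    by (simp add: L_def z_def fps_of_poly_sum fps_of_poly_mult fps_of_poly_power fps_of_poly_diff fpsX
        fps_of_poly_of_nat)
  have key: "[coeff L N = coeff R N] (mod int p)" if N: "N < p" for N
  proof -
    have "coeff L N = fps_nth (\<Sum>k\<le>p div 4. of_nat (quartic_coeff k) * z ^ k) N"
      by (simp flip: Lfps)
    also have "[\<dots> = fps_nth (quartic_series oo z) N] (mod int p)"
      by (rule cong_sym, rule quartic_series_compose_cong[OF p _ N]) (simp add: z_def)
    also have "fps_nth (quartic_series oo z) N = fps_nth (I * (quartic_series oo w)) N"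
      using cubic_transformation[OF I[unfolded c_def]] by (simp add: z_def w_def)
    also have "\<dots> = (\<Sum>i=0..N. fps_nth I i * fps_nth (quartic_series oo w) (N - i))"
      by (simp add: fps_mult_nth)
    also have "[\<dots> = (\<Sum>i=0..N. fps_nth I i * fps_nth (\<Sum>k\<le>p div 4. of_nat (quartic_coeff k) * w ^ k) (N - i))] (mod int p)"
    proof (rule cong_sum)
      fix i
      have "[fps_nth (quartic_series oo w) (N - i) =
        fps_nth (\<Sum>k\<le>p div 4. of_nat (quartic_coeff k) * w ^ k) (N - i)] (mod int p)"
        by (rule quartic_series_compose_cong[OF p]) (use N in \<open>simp_all add: w_def\<close>)
      thus "[fps_nth I i * fps_nth (quartic_series oo w) (N - i) =
        fps_nth I i * fps_nth (\<Sum>k\<le>p div 4. of_nat (quartic_coeff k) * w ^ k) (N - i)] (mod int p)"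
        by (rule cong_scalar_left)
    qed
    also have "(\<Sum>i=0..N. fps_nth I i * fps_nth (\<Sum>k\<le>p div 4. of_nat (quartic_coeff k) * w ^ k) (N - i))
      = fps_nth (I * (\<Sum>k\<le>p div 4. of_nat (quartic_coeff k) * w ^ k)) N"
      by (simp add: fps_mult_nth)
    also have "[\<dots> = fps_nth (c ^ p * (I * (\<Sum>k\<le>p div 4. of_nat (quartic_coeff k) * w ^ k))) N] (mod int p)"
      unfolding c_def by (rule cong_sym, rule fps_linear_power_prime_cong[OF p N])
    also have "c ^ p * (I * (\<Sum>k\<le>p div 4. of_nat (quartic_coeff k) * w ^ k)) = fps_of_poly R"
    proof -
      have summand: "c ^ p * (I * (of_nat (quartic_coeff k) * w ^ k)) =
        of_nat (quartic_coeff k) * (fps_X ^ 3 * (1 - 27 * fps_X)) ^ k * c ^ (p - 1 - 4 * k)" if "k \<le> p div 4" for k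
      proof -
        have pe: "p = (p - 1 - 4 * k) + (4 * k + 1)"
        proof -
          have "4 * k < p" using four_mult_neq[of k] that by linarith
          thus ?thesis using that by linarith
        qed
        have "c ^ p * I ^ (4 * k + 1) = c ^ (p - 1 - 4 * k) * (c * I) ^ (4 * k + 1)"
          by (subst pe) (simp only: power_add[of c "p - 1 - 4 * k" "4 * k + 1"] power_mult_distrib mult.assoc)
        hence "c ^ p * I ^ (4 * k + 1) = c ^ (p - 1 - 4 * k)" by (simp add: I)
        moreover have "I * (I ^ 4) ^ k = I ^ (4 * k + 1)" by (simp add: power_mult)
        moreover have "c ^ p * (I * (of_nat (quartic_coeff k) * w ^ k)) =
            of_nat (quartic_coeff k) * (fps_X ^ 3 * (1 - 27 * fps_X)) ^ k * (c ^ p * (I * (I ^ 4) ^ k))"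
          unfolding w_def power_mult_distrib by (simp only: mult_ac)
        ultimately show ?thesis by (simp only:)
      qed
      have "c ^ p * (I * (\<Sum>k\<le>p div 4. of_nat (quartic_coeff k) * w ^ k)) =
          (\<Sum>k\<le>p div 4. of_nat (quartic_coeff k) * (fps_X ^ 3 * (1 - 27 * fps_X)) ^ k * c ^ (p - 1 - 4 * k))"
        unfolding sum_distrib_left by (intro sum.cong refl summand) simp
      thus ?thesis
        by (simp add: R_def c_def fps_of_poly_sum fps_of_poly_mult fps_of_poly_power
          fps_of_poly_diff fpsX fps_of_poly_of_nat)
    qed
    finally show ?thesis by simp
  qed
  have dmult: "degree (f * g) \<le> a + b" if "degree f \<le> a" "degree g \<le> b" for f g :: "int poly" and a b
    using degree_mult_le[of f g] that by linarith
  have dpow: "degree (f ^ k) \<le> a * k" if "degree f \<le> a" for f :: "int poly" and a k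
    using degree_power_le[of f k] mult_right_mono[OF that, of k] by linarith
  have dX: "degree X \<le> 1" by (simp add: X_def)
  have dlin: "degree (1 - numeral w * X) \<le> 1" for w
    by (intro degree_diff_le) (simp_all add: X_def numeral_poly)
  have dnat: "degree (of_nat m :: int poly) \<le> 0" for m
    by simp
  have degL: "degree L \<le> p - 1"
    unfolding L_def
  proof (intro degree_sum_le)
    fix k assume k: "k \<in> {..p div 4}"
    have "degree (of_nat (quartic_coeff k) * (X * (1 - 27 * X) ^ 3) ^ k) \<le> 0 + (1 + 1 * 3) * k"
      by (intro dmult dpow dX dlin dnat)
    also have "\<dots> \<le> p - 1" using four_mult_neq[of k] k by auto
    finally show "degree (of_nat (quartic_coeff k) * (X * (1 - 27 * X) ^ 3) ^ k) \<le> p - 1" .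
  qed simp
  have degR: "degree R \<le> p - 1"
    unfolding R_def
  proof (intro degree_sum_le)
    fix k assume k: "k \<in> {..p div 4}"
    have "degree (of_nat (quartic_coeff k) * (X ^ 3 * (1 - 27 * X)) ^ k * (1 - 24 * X) ^ (p - 1 - 4 * k))
       \<le> (0 + (1 * 3 + 1) * k) + 1 * (p - 1 - 4 * k)"
      by (intro dmult dpow dX dlin dnat)
    also have "\<dots> \<le> p - 1" using four_mult_neq[of k] k by auto
    finally show "degree (of_nat (quartic_coeff k) * (X ^ 3 * (1 - 27 * X)) ^ k * (1 - 24 * X) ^ (p - 1 - 4 * k)) \<le> p - 1" .
  qed simp
  have "int p dvd poly (L - R) u"
  proof -
    have "degree (L - R) \<le> p - 1" by (rule degree_diff_le[OF degL degR])
    have "int p dvd coeff (L - R) i" for i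
    proof (cases "i < p")
      case True thus ?thesis using key by (simp add: cong_iff_dvd_diff)
    next
      case False
      hence "degree (L - R) < i" using \<open>degree (L - R) \<le> p - 1\<close> prime_gt_0_nat[OF p] by linarith
      hence "coeff (L - R) i = 0" by (rule coeff_eq_0)
      thus ?thesis by (simp only: dvd_0_right)
    qed
    thus ?thesis unfolding poly_altdef by (intro dvd_sum dvd_mult2)
  qed
  thus ?thesis
    by (simp add: cong_iff_dvd_diff L_def R_def poly_sum X_def mult_ac)
qed

section \<open>The quartic sum at 1/256\<close>

text \<open>
  By the classical formula \<open>P\<^sub>n(t) ^ 2 = (\<Sum>k\<le>n. ((n + k) choose 2 k) (2 k choose k) ^ 2 ((t ^ 2 - 1) / 4) ^ k)\<close>
  for Legendre polynomials, these are the terms of \<open>P\<^sub>n(0) ^ 2\<close>.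
\<close>

definition legendre_term :: "nat \<Rightarrow> nat \<Rightarrow> rat" where
  "legendre_term n k = of_nat ((n + k) choose (2 * k)) * of_nat ((2 * k) choose k) ^ 2 * (- 1 / 4) ^ k"

text \<open>
  A common factor of the terms for \<open>n\<close> and \<open>n + 2\<close> that makes both of them polynomial multiples
  for all \<open>k \<le> n + 2\<close>, including \<open>k = n + 1\<close> and \<open>k = n + 2\<close>, where the term for \<open>n\<close> vanishes.
\<close>

definition legendre_base :: "nat \<Rightarrow> nat \<Rightarrow> rat" where
  "legendre_base n k = fact (n + k) * fact (2 * k) / (fact (n + 2 - k) * fact k ^ 4) * (- 1 / 4) ^ k"

lemma legendre_term_shift0:
  assumes "k \<le> n + 2"
  shows "legendre_term n k = (of_nat n + 2 - of_nat k) * (of_nat n + 1 - of_nat k) * legendre_base n k"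
proof (cases "k \<le> n")
  case True
  have a: "of_nat ((n + k) choose (2 * k)) = (fact (n + k) / (fact (2 * k) * fact (n - k)) :: rat)"
    using binomial_fact[of "2*k" "n+k", where 'a = rat] True by simp
  have b: "of_nat ((2 * k) choose k) = (fact (2 * k) / fact k ^ 2 :: rat)"
    using binomial_fact[of k "2*k", where 'a = rat] by (simp add: power2_eq_square)
  have c: "fact (n + 2 - k) = ((of_nat n + 2 - of_nat k) * (of_nat n + 1 - of_nat k) * fact (n - k) :: rat)"
  proof -
    have "n + 2 - k = Suc (Suc (n - k))" using True by simp
    thus ?thesis using True by (simp add: of_nat_diff algebra_simps)
  qed
  have "(of_nat n + 2 - of_nat k :: rat) > 0" "(of_nat n + 1 - of_nat k :: rat) > 0"
    using True by (simp_all flip: of_nat_diff add: of_nat_diff[symmetric])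
  hence nz: "(of_nat n + 2 - of_nat k :: rat) \<noteq> 0" "(of_nat n + 1 - of_nat k :: rat) \<noteq> 0" by auto
  show ?thesis unfolding legendre_term_def legendre_base_def a b c
    using nz by (simp add: power2_eq_square power4_eq_xxxx)
next
  case False
  hence "k = n + 1 \<or> k = n + 2" using assms by linarith
  thus ?thesis by (auto simp: legendre_term_def binomial_eq_0)
qed

lemma legendre_term_shift2:
  assumes "k \<le> n + 2"
  shows "legendre_term (n + 2) k = (of_nat n + 2 + of_nat k) * (of_nat n + 1 + of_nat k) * legendre_base n k"
proof -
  have a: "of_nat ((n + 2 + k) choose (2 * k)) = (fact (n + 2 + k) / (fact (2 * k) * fact (n + 2 - k)) :: rat)"
    using binomial_fact[of "2*k" "n+2+k", where 'a = rat] assms by simp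
  have b: "of_nat ((2 * k) choose k) = (fact (2 * k) / fact k ^ 2 :: rat)"
    using binomial_fact[of k "2*k", where 'a = rat] by (simp add: power2_eq_square)
  have c: "fact (n + 2 + k) = ((of_nat n + 2 + of_nat k) * (of_nat n + 1 + of_nat k) * fact (n + k) :: rat)"
    by (simp add: algebra_simps)
  show ?thesis unfolding legendre_term_def legendre_base_def a b c
    by (simp add: power2_eq_square power4_eq_xxxx mult_ac)
qed

lemma legendre_base_Suc:
  assumes "k < n + 2"
  shows "2 * (of_nat k + 1) ^ 3 * legendre_base n (Suc k) =
    - (of_nat n + 1 + of_nat k) * (of_nat n + 2 - of_nat k) * (2 * of_nat k + 1) * legendre_base n k"
proof -
  have c: "fact (n + 2 - k) = ((of_nat n + 2 - of_nat k) * fact (n + 2 - Suc k) :: rat)"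
  proof -
    have "n + 2 - k = Suc (n + 2 - Suc k)" using assms by simp
    thus ?thesis using assms by (simp add: of_nat_diff algebra_simps)
  qed
  have "(of_nat k :: rat) < of_nat (n + 2)" using assms by (simp only: of_nat_less_iff)
  hence nz: "(of_nat n + 2 - of_nat k :: rat) \<noteq> 0" by simp
  have nz2: "1 + (of_nat k :: rat) \<noteq> 0" using of_nat_Suc[of k, where 'a = rat] by (metis of_nat_neq_0)
  have d: "fact (2 * Suc k) = (2 * (1 + of_nat k) * (2 * of_nat k + 1) * fact (2 * k) :: rat)"
    by (simp add: algebra_simps)
  have e: "fact (Suc k) = ((1 + of_nat k) * fact k :: rat)" by simp
  have f: "fact (n + Suc k) = ((of_nat n + 1 + of_nat k) * fact (n + k) :: rat)" by (simp add: algebra_simps)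
  show ?thesis unfolding legendre_base_def c d e f
    using nz nz2 by (simp add: divide_simps power3_eq_cube power4_eq_xxxx add_ac) (simp add: algebra_simps)
qed

text \<open>
  Zeilberger's method: the combination of terms telescopes, with certificate
  \<open>- 2 (2 n + 3) k ^ 3\<close> relative to \<^const>\<open>legendre_base\<close>.
\<close>

lemma legendre_sum_recurrence:
  "(of_nat n + 2) ^ 2 * (\<Sum>k\<le>n + 2. legendre_term (n + 2) k) = (of_nat n + 1) ^ 2 * (\<Sum>k\<le>n. legendre_term n k)"
proof -
  define G where "G k = (if k \<le> n + 2 then - 2 * (2 * of_nat n + 3) * of_nat k ^ 3 * legendre_base n k else 0)" for k
  have ext: "(\<Sum>k\<le>n. legendre_term n k) = (\<Sum>k<n+3. legendre_term n k)"
    by (intro sum.mono_neutral_left) (auto simp: legendre_term_def binomial_eq_0)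
  \<comment> \<open>The value 0 of G at n + 3 is consistent with the recurrence for the base, which has a factor n + 2 - k.\<close>
  have tele: "(of_nat n + 2) ^ 2 * legendre_term (n + 2) k - (of_nat n + 1) ^ 2 * legendre_term n k = G (Suc k) - G k"
    if k: "k < n + 3" for k
  proof -
    have "G (Suc k) = (2 * of_nat n + 3) * (of_nat n + 1 + of_nat k) * (of_nat n + 2 - of_nat k) * (2 * of_nat k + 1) * legendre_base n k"
    proof (cases "k < n + 2")
      case True
      have "G (Suc k) = - (2 * of_nat n + 3) * (2 * (of_nat k + 1) ^ 3 * legendre_base n (Suc k))"
        using True by (simp add: G_def add_ac)
      also have "\<dots> = (2 * of_nat n + 3) * (of_nat n + 1 + of_nat k) * (of_nat n + 2 - of_nat k) * (2 * of_nat k + 1) * legendre_base n k"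
        unfolding legendre_base_Suc[OF True] by Groebner_Basis.algebra
      finally show ?thesis .
    next
      case False
      hence "k = n + 2" using k by simp
      thus ?thesis by (simp add: G_def)
    qed
    moreover have "G k = - 2 * (2 * of_nat n + 3) * of_nat k ^ 3 * legendre_base n k"
      using k by (simp add: G_def)
    moreover have "k \<le> n + 2" using k by simp
    ultimately show ?thesis
      unfolding legendre_term_shift0[OF \<open>k \<le> n + 2\<close>] legendre_term_shift2[OF \<open>k \<le> n + 2\<close>]
      by Groebner_Basis.algebra
  qed
  have "{..n + 2} = {..<n + 3}" by auto
  have "(of_nat n + 2) ^ 2 * (\<Sum>k\<le>n + 2. legendre_term (n + 2) k) - (of_nat n + 1) ^ 2 * (\<Sum>k\<le>n. legendre_term n k)
     = (\<Sum>k<n + 3. G (Suc k) - G k)"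
    unfolding ext \<open>{..n + 2} = {..<n + 3}\<close> sum_distrib_left sum_subtractf[symmetric]
    by (intro sum.cong refl tele) simp
  also have "\<dots> = G (n + 3) - G 0" by (rule sum_lessThan_telescope)
  also have "\<dots> = 0" by (simp add: G_def)
  finally show ?thesis by simp
qed

lemma legendre_sum_closed_form:
  "(\<Sum>k\<le>2 * f. legendre_term (2 * f) k) = of_nat ((2 * f) choose f) ^ 2 / 16 ^ f"
  "(\<Sum>k\<le>2 * f + 1. legendre_term (2 * f + 1) k) = 0"
proof (induction f)
  case 0
  show "(\<Sum>k\<le>2 * 0. legendre_term (2 * 0) k) = of_nat ((2 * 0) choose 0) ^ 2 / 16 ^ 0"
    by (simp add: legendre_term_def)
  show "(\<Sum>k\<le>2 * 0 + 1. legendre_term (2 * 0 + 1) k) = 0"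
    by (simp add: legendre_term_def numeral_2_eq_2)
next
  case (Suc f)
  have rec: "(2 * of_nat f + 2) ^ 2 * (\<Sum>k\<le>2 * Suc f. legendre_term (2 * Suc f) k) =
      (2 * of_nat f + 1) ^ 2 * (of_nat ((2 * f) choose f) ^ 2 / 16 ^ f)"
    using legendre_sum_recurrence[of "2 * f"] Suc by simp
  define a b :: rat where "a = of_nat ((2 * f) choose f)" and "b = of_nat ((2 * Suc f) choose Suc f)"
  have "of_nat (Suc f * ((2 * Suc f) choose Suc f)) = (of_nat (2 * (2 * f + 1) * ((2 * f) choose f)) :: rat)"
    by (simp only: central_binomial_Suc)
  hence ab: "(of_nat f + 1) * b = 2 * (2 * of_nat f + 1) * a"
    by (simp only: a_def b_def of_nat_mult of_nat_Suc of_nat_add of_nat_numeral of_nat_1 add_ac)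
  have "(2 * of_nat f + 2) ^ 2 * (b ^ 2 / 16 ^ Suc f) = ((of_nat f + 1) * b) ^ 2 * 4 / 16 ^ Suc f"
    by (simp add: power2_eq_square algebra_simps add_divide_distrib)
  also have "\<dots> = (2 * of_nat f + 1) ^ 2 * (a ^ 2 / 16 ^ f)"
  proof -
    have "(2 * (2 * of_nat f + 1) * a) ^ 2 = 4 * ((2 * of_nat f + 1) ^ 2 * a ^ 2)"
      by (simp only: power_mult_distrib) simp
    thus ?thesis unfolding ab by simp
  qed
  finally have "(2 * of_nat f + 2) ^ 2 * (\<Sum>k\<le>2 * Suc f. legendre_term (2 * Suc f) k) =
      (2 * of_nat f + 2) ^ 2 * (b ^ 2 / 16 ^ Suc f)" using rec by (simp only: a_def)
  note eq = this
  have nz: "(2 * of_nat f + 2 :: rat) ^ 2 \<noteq> 0"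
    using of_nat_eq_0_iff[of "2 * f + 2", where 'a = rat] by simp
  show "(\<Sum>k\<le>2 * Suc f. legendre_term (2 * Suc f) k) = of_nat ((2 * Suc f) choose Suc f) ^ 2 / 16 ^ Suc f"
    using iffD1[OF mult_left_cancel[OF nz] eq] by (simp only: b_def)
  have "(of_nat (2 * f + 1) + 2) ^ 2 * (\<Sum>k\<le>2 * Suc f + 1. legendre_term (2 * Suc f + 1) k) = 0"
    using legendre_sum_recurrence[of "2 * f + 1"] Suc by simp
  moreover have "(of_nat (2 * f + 1) + 2 :: rat) ^ 2 \<noteq> 0"
    by (metis of_nat_add of_nat_numeral of_nat_eq_0_iff power_eq_0_iff add_is_0 zero_neq_numeral)
  ultimately show "(\<Sum>k\<le>2 * Suc f + 1. legendre_term (2 * Suc f + 1) k) = 0" by simp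
qed


lemma legendre_sum_at_zero_int:
  fixes n :: nat
  defines "W \<equiv> (\<Sum>k\<le>n. int ((n + k) choose (2 * k)) * int ((2 * k) choose k) ^ 2 * (- 1) ^ k * 4 ^ (n - k))"
  shows "W = (if even n then int (n choose (n div 2)) ^ 2 else 0)"
proof -
  have W: "of_int W = 4 ^ n * (\<Sum>k\<le>n. legendre_term n k)"
    unfolding W_def legendre_term_def sum_distrib_left of_int_sum
  proof (rule sum.cong[OF refl])
    fix k assume "k \<in> {..n}"
    hence a: "(4 :: rat) ^ (n - k) = 4 ^ n / 4 ^ k" by (simp add: power_diff)
    have b: "(- 1 / 4 :: rat) ^ k = (- 1) ^ k / 4 ^ k" by (rule power_divide)
    show "of_int (int ((n + k) choose (2 * k)) * int ((2 * k) choose k) ^ 2 * (- 1) ^ k * 4 ^ (n - k)) =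
       4 ^ n * (of_nat ((n + k) choose (2 * k)) * of_nat ((2 * k) choose k) ^ 2 * (- 1 / 4 :: rat) ^ k)"
      unfolding b by (simp add: a)
  qed
  show ?thesis
  proof (cases "even n")
    case True
    then obtain f where n: "n = 2 * f" by blast
    have "of_int W = (of_int (int (n choose (n div 2)) ^ 2) :: rat)"
      unfolding W by (simp add: n legendre_sum_closed_form power_mult)
    thus ?thesis using True by (simp only: of_int_eq_iff if_True)
  next
    case False
    then obtain f where n: "n = 2 * f + 1" using oddE by blast
    have "of_int W = (0 :: rat)" unfolding W n legendre_sum_closed_form by simp
    thus ?thesis using False by simp
  qed
qed

text \<open>
  With \<open>n = p div 4\<close> one has \<open>p = 4 n + 1\<close> or \<open>p = 4 n + 3\<close>, hence \<open>16 n (n + 1) \<equiv> - 3\<close>, and the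
  quotients of consecutive terms on both sides agree modulo \<open>p\<close>.
\<close>

lemma binomial_quartic_cong:
  assumes p: "prime p" "p > 2" and k: "k \<le> p div 4"
  shows "[int ((4 * k) choose (2 * k)) = (- 64) ^ k * int ((p div 4 + k) choose (2 * k))] (mod int p)"
  using k
proof (induction k)
  case (Suc k)
  define n where "n = p div 4"
  have kn: "k < n" using Suc.prems by (simp add: n_def)
  define B b D d where "B = int ((4 * Suc k) choose (2 * Suc k))" and "b = int ((4 * k) choose (2 * k))"
    and "D = int ((n + Suc k) choose (2 * Suc k))" and "d = int ((n + k) choose (2 * k))"
  define K where "K = int k"
  define M where "M = int n"
  have B: "(2 * K + 1) * (2 * K + 2) * B = 4 * (4 * K + 1) * (4 * K + 3) * b"
  proof -
    define m where "m = int ((2 * (2 * k + 1)) choose (2 * k + 1))"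
    have eq: "(4 * Suc k) choose (2 * Suc k) = (2 * Suc (2 * k + 1)) choose Suc (2 * k + 1)"
      "(4 * k) choose (2 * k) = (2 * (2 * k)) choose (2 * k)" "Suc (2 * k) = 2 * k + 1"
      by (rule arg_cong2[where f = binomial], simp_all)
    have "int (Suc (2 * k + 1)) * B = int (2 * (2 * (2 * k + 1) + 1)) * m"
      unfolding B_def m_def eq of_nat_mult[symmetric] by (simp only: central_binomial_Suc)
    hence 1: "(2 * K + 2) * B = 2 * (2 * (2 * K + 1) + 1) * m" by (simp add: K_def add_ac)
    have "int (Suc (2 * k)) * m = int (2 * (2 * (2 * k) + 1)) * b"
      unfolding b_def m_def eq(2) eq(3)[symmetric] of_nat_mult[symmetric] by (simp only: central_binomial_Suc)
    hence 2: "(2 * K + 1) * m = 2 * (2 * (2 * K) + 1) * b" by (simp add: K_def add_ac)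
    have "(2 * K + 1) * (2 * K + 2) * B = 2 * (2 * (2 * K + 1) + 1) * ((2 * K + 1) * m)"
      using 1 by (simp only: mult.assoc mult.left_commute)
    thus ?thesis unfolding 2 by (simp add: algebra_simps)
  qed
  have D: "(2 * K + 1) * (2 * K + 2) * D = (M + K + 1) * (M - K) * d"
  proof -
    define m where "m = int ((n + k) choose (2 * k + 1))"
    have eq: "(n + Suc k) choose (2 * Suc k) = Suc (n + k) choose Suc (2 * k + 1)"
      by (rule arg_cong2[where f = binomial]) simp_all
    have "int (Suc (2 * k + 1)) * D = int (Suc (n + k)) * m"
      unfolding D_def m_def eq of_nat_mult[symmetric] by (simp only: Suc_times_binomial)
    hence 1: "(2 * K + 2) * D = (M + K + 1) * m" by (simp add: K_def M_def add_ac)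
    have "int (Suc (2 * k) * ((n + k) choose Suc (2 * k))) = int ((n + k - 2 * k) * ((n + k) choose (2 * k)))"
      by (simp only: binomial_absorption binomial_absorb_comp)
    hence 2: "(2 * K + 1) * m = (M - K) * d"
      using kn by (simp add: m_def d_def K_def M_def of_nat_diff algebra_simps)
    have "(2 * K + 1) * (2 * K + 2) * D = (M + K + 1) * ((2 * K + 1) * m)"
      using 1 by (simp only: mult.assoc mult.left_commute)
    thus ?thesis unfolding 2 by (simp only: mult.assoc)
  qed
  have IH: "[b = (- 64) ^ k * d] (mod int p)" using Suc by (simp add: b_def d_def n_def)
  have pn: "int p dvd (4 * M + 1) * (4 * M + 3)"
  proof -
    have "odd p" using p prime_odd_nat by blast
    hence "p mod 4 = 1 \<or> p mod 4 = 3" by presburger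
    moreover have "p = 4 * n + p mod 4" by (simp add: n_def)
    ultimately have "int p = 4 * M + 1 \<or> int p = 4 * M + 3" unfolding M_def by linarith
    thus ?thesis by auto
  qed
  have "[(2 * K + 1) * (2 * K + 2) * B = 4 * (4 * K + 1) * (4 * K + 3) * ((- 64) ^ k * d)] (mod int p)"
    unfolding B by (intro cong_scalar_left IH)
  moreover have "[4 * (4 * K + 1) * (4 * K + 3) * ((- 64) ^ k * d) = - 64 * ((M + K + 1) * (M - K) * ((- 64) ^ k * d))] (mod int p)"
  proof -
    have "4 * (4 * K + 1) * (4 * K + 3) * ((- 64) ^ k * d) - - 64 * ((M + K + 1) * (M - K) * ((- 64) ^ k * d))
      = (4 * M + 1) * (4 * M + 3) * (4 * ((- 64) ^ k * d))" by (simp add: algebra_simps)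
    thus ?thesis using pn by (simp add: cong_iff_dvd_diff)
  qed
  moreover have "- 64 * ((M + K + 1) * (M - K) * ((- 64) ^ k * d)) = (2 * K + 1) * (2 * K + 2) * ((- 64) ^ Suc k * D)"
  proof -
    have "(2 * K + 1) * (2 * K + 2) * ((- 64) ^ Suc k * D) = - 64 * (- 64) ^ k * ((2 * K + 1) * (2 * K + 2) * D)"
      by simp
    thus ?thesis unfolding D by simp
  qed
  ultimately have "[(2 * K + 1) * (2 * K + 2) * B = (2 * K + 1) * (2 * K + 2) * ((- 64) ^ Suc k * D)] (mod int p)"
    using cong_trans by (simp only:) blast
  moreover have "coprime ((2 * K + 1) * (2 * K + 2)) (int p)"
  proof -
    have "coprime p (2 * k + 1)" "coprime p (2 * k + 2)"
    proof -
      have "2 * k + 2 < p" using kn p(2) unfolding n_def by linarith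
      hence "\<not> p dvd (2 * k + 1)" "\<not> p dvd (2 * k + 2)" by (simp_all add: nat_dvd_not_less)
      thus "coprime p (2 * k + 1)" "coprime p (2 * k + 2)" using p(1) prime_imp_coprime by blast+
    qed
    hence "coprime (int (2 * k + 1)) (int p)" "coprime (int (2 * k + 2)) (int p)"
      unfolding coprime_int_iff by (simp_all only: coprime_commute)
    moreover have "int (2 * k + 1) = 2 * K + 1" "int (2 * k + 2) = 2 * K + 2" by (simp_all add: K_def)
    ultimately show ?thesis by (simp only: coprime_mult_left_iff)
  qed
  ultimately have "[B = (- 64) ^ Suc k * D] (mod int p)" using cong_mult_lcancel by blast
  thus ?case by (simp only: B_def D_def n_def)
qed simp


text \<open>
  The terms of the quartic sum turn into those of \<open>4 ^ n P\<^sub>n(0) ^ 2\<close> with \<open>n = p div 4\<close>.  This is where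
  the residue of \<open>p\<close> modulo 8 enters, as the parity of \<open>n\<close>.
\<close>

lemma quartic_sum_at_256:
  fixes v :: int
  assumes p: "prime p" "p > 2" and v: "[256 * v = 1] (mod int p)"
  shows "[4 ^ (p div 4) * (\<Sum>k\<le>p div 4. int (quartic_coeff k) * v ^ k) =
    (if even (p div 4) then int ((p div 4) choose (p div 8)) ^ 2 else 0)] (mod int p)"
proof -
  define n where "n = p div 4"
  have "[(\<Sum>k\<le>n. 4 ^ n * (int (quartic_coeff k) * v ^ k)) =
    (\<Sum>k\<le>n. int ((n + k) choose (2 * k)) * int ((2 * k) choose k) ^ 2 * (- 1) ^ k * 4 ^ (n - k))] (mod int p)"
  proof (rule cong_sum)
    fix k assume "k \<in> {..n}"
    hence k: "k \<le> n" by simp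
    define d where "d = int ((n + k) choose (2 * k))"
    define e where "e = int ((2 * k) choose k) ^ 2"
    have "int (quartic_coeff k) = int ((4 * k) choose (2 * k)) * e"
      by (simp add: quartic_coeff_def e_def)
    also have "[\<dots> = (- 64) ^ k * d * e] (mod int p)"
      unfolding d_def n_def by (intro cong_scalar_right binomial_quartic_cong p) (use k in \<open>simp add: n_def\<close>)
    finally have 1: "[4 ^ n * (int (quartic_coeff k) * v ^ k) = 4 ^ n * ((- 64) ^ k * d * e * v ^ k)] (mod int p)"
      by (intro cong_scalar_left cong_scalar_right)
    have 2: "4 ^ n * ((- 64) ^ k * d * e * v ^ k) = d * e * (- 1) ^ k * 4 ^ (n - k) * (256 * v) ^ k"
    proof -
      have "(4 :: int) ^ n = 4 ^ (n - k) * 4 ^ k" using k by (simp flip: power_add)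
      moreover have "(- 64 :: int) ^ k * v ^ k * 4 ^ k = (- 1) ^ k * (256 * v) ^ k"
        unfolding power_mult_distrib[symmetric] by (rule arg_cong[where f = "\<lambda>x. x ^ k"]) simp
      ultimately show ?thesis
      proof -
        assume 1: "(4 :: int) ^ n = 4 ^ (n - k) * 4 ^ k"
          and 2: "(- 64 :: int) ^ k * v ^ k * 4 ^ k = (- 1) ^ k * (256 * v) ^ k"
        have "4 ^ n * ((- 64) ^ k * d * e * v ^ k) = d * e * 4 ^ (n - k) * ((- 64) ^ k * v ^ k * 4 ^ k)"
          unfolding 1 by (simp only: mult_ac)
        thus ?thesis unfolding 2 by (simp only: mult_ac)
      qed
    qed
    have 3: "[d * e * (- 1) ^ k * 4 ^ (n - k) * (256 * v) ^ k = d * e * (- 1) ^ k * 4 ^ (n - k) * 1 ^ k] (mod int p)"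
      by (intro cong_scalar_left cong_pow v)
    show "[4 ^ n * (int (quartic_coeff k) * v ^ k) =
      int ((n + k) choose (2 * k)) * int ((2 * k) choose k) ^ 2 * (- 1) ^ k * 4 ^ (n - k)] (mod int p)"
      using cong_trans[OF 1[unfolded 2] 3] by (simp only: d_def e_def power_one mult_1_right)
  qed
  also have "(\<Sum>k\<le>n. int ((n + k) choose (2 * k)) * int ((2 * k) choose k) ^ 2 * (- 1) ^ k * 4 ^ (n - k)) =
    (if even n then int (n choose (n div 2)) ^ 2 else 0)" by (rule legendre_sum_at_zero_int)
  finally have *: "[(\<Sum>k\<le>n. 4 ^ n * (int (quartic_coeff k) * v ^ k)) =
     (if even n then int (n choose (n div 2)) ^ 2 else 0)] (mod int p)" .
  have "n div 2 = p div 8" unfolding n_def by linarith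
  thus ?thesis using * by (simp only: n_def sum_distrib_left)
qed

section \<open>Formal theta series\<close>

text \<open>
  The generating function \<open>\<Sum>i\<in>I. w i * q ^ e i\<close>.  An infinite fibre of \<open>e\<close> would silently contribute
  the coefficient 0, so the multiplicative rules ask for \<open>finite_fibers\<close>.
\<close>

definition theta :: "'i set \<Rightarrow> ('i \<Rightarrow> rat) \<Rightarrow> ('i \<Rightarrow> nat) \<Rightarrow> rat fps" where
  "theta I w e = Abs_fps (\<lambda>n. \<Sum>i | i \<in> I \<and> e i = n. w i)"

definition finite_fibers :: "'i set \<Rightarrow> ('i \<Rightarrow> nat) \<Rightarrow> bool" where
  "finite_fibers I e \<longleftrightarrow> (\<forall>n. finite {i \<in> I. e i \<le> n})"

lemma finite_fibersD: "finite_fibers I e \<Longrightarrow> finite {i. i \<in> I \<and> e i = n}"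
  unfolding finite_fibers_def by (rule finite_subset[of _ "{i \<in> I. e i \<le> n}"]) auto

lemma theta_mult:
  assumes "finite_fibers I e" "finite_fibers J d"
  shows "theta I w e * theta J v d = theta (I \<times> J) (\<lambda>(i, j). w i * v j) (\<lambda>(i, j). e i + d j)"
proof (rule fps_ext)
  fix n
  have "fps_nth (theta I w e * theta J v d) n =
    (\<Sum>k=0..n. \<Sum>x\<in>{i. i \<in> I \<and> e i = k} \<times> {j. j \<in> J \<and> d j = n - k}. (\<lambda>(i, j). w i * v j) x)"
    by (simp add: fps_mult_nth theta_def sum_product sum.cartesian_product)
  also have "\<dots> = (\<Sum>x\<in>(\<Union>k\<in>{0..n}. {i. i \<in> I \<and> e i = k} \<times> {j. j \<in> J \<and> d j = n - k}). (\<lambda>(i, j). w i * v j) x)"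
    by (intro sum.UNION_disjoint[symmetric])
      (auto intro!: finite_cartesian_product finite_fibersD[OF assms(1)] finite_fibersD[OF assms(2)])
  also have "(\<Union>k\<in>{0..n}. {i. i \<in> I \<and> e i = k} \<times> {j. j \<in> J \<and> d j = n - k}) =
      {x. x \<in> I \<times> J \<and> (\<lambda>(i, j). e i + d j) x = n}" by auto
  finally show "fps_nth (theta I w e * theta J v d) n =
      fps_nth (theta (I \<times> J) (\<lambda>(i, j). w i * v j) (\<lambda>(i, j). e i + d j)) n"
    by (simp add: theta_def)
qed

lemma theta_reindex:
  assumes "bij_betw h I J" and "\<And>i. i \<in> I \<Longrightarrow> w i = v (h i)" and "\<And>i. i \<in> I \<Longrightarrow> e i = d (h i)"
  shows "theta I w e = theta J v d"
proof (rule fps_ext)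
  fix n
  have bij: "bij_betw h {i. i \<in> I \<and> e i = n} {j. j \<in> J \<and> d j = n}"
    using assms(1) unfolding bij_betw_def
    by (auto simp: assms(3) inj_on_def image_iff)
  have "(\<Sum>i | i \<in> I \<and> e i = n. w i) = (\<Sum>i | i \<in> I \<and> e i = n. v (h i))"
    by (intro sum.cong refl) (auto simp: assms(2))
  also have "\<dots> = (\<Sum>j | j \<in> J \<and> d j = n. v j)"
    by (rule sum.reindex_bij_betw[OF bij])
  finally show "fps_nth (theta I w e) n = fps_nth (theta J v d) n"
    by (simp add: theta_def)
qed

lemma theta_union:
  assumes "finite_fibers I e" "finite_fibers J e" "I \<inter> J = {}"
  shows "theta (I \<union> J) w e = theta I w e + theta J w e"
proof (rule fps_ext)
  fix n
  have "{i. i \<in> I \<union> J \<and> e i = n} = {i. i \<in> I \<and> e i = n} \<union> {i. i \<in> J \<and> e i = n}" by auto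
  thus "fps_nth (theta (I \<union> J) w e) n = fps_nth (theta I w e + theta J w e) n"
    using assms by (simp add: theta_def) (intro sum.union_disjoint finite_fibersD; auto)
qed

lemma theta_uminus: "theta I (\<lambda>i. - w i) e = - theta I w e"
  by (rule fps_ext) (simp add: theta_def sum_negf)

lemma theta_add: "theta I (\<lambda>i. v i + w i) e = theta I v e + theta I w e"
  by (rule fps_ext) (simp add: theta_def sum.distrib)

lemma theta_diff: "theta I (\<lambda>i. v i - w i) e = theta I v e - theta I w e"
  by (rule fps_ext) (simp add: theta_def sum_subtractf)

lemma theta_scale: "theta I (\<lambda>i. c * w i) e = fps_const c * theta I w e"
  by (rule fps_ext) (simp add: theta_def sum_distrib_left)

lemma theta_X_mult: "fps_X * theta I w e = theta I w (\<lambda>i. Suc (e i))"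
proof (rule fps_ext)
  fix n show "fps_nth (fps_X * theta I w e) n = fps_nth (theta I w (\<lambda>i. Suc (e i))) n"
    by (cases n) (simp_all add: theta_def)
qed

lemma theta_XD: "fps_XD (theta I w e) = theta I (\<lambda>i. of_nat (e i) * w i) e"
proof (rule fps_ext)
  fix n show "fps_nth (fps_XD (theta I w e)) n = fps_nth (theta I (\<lambda>i. of_nat (e i) * w i) e) n"
    by (simp add: fps_mult_fps_X_deriv_shift fps_XD_def theta_def sum_distrib_left)
qed

lemma fps_compose_X_power_nth:
  fixes f :: "'a::comm_ring_1 fps"
  assumes "m > 0"
  shows "fps_nth (f oo fps_X ^ m) n = (if m dvd n then fps_nth f (n div m) else 0)"
proof -
  have "fps_nth (f oo fps_X ^ m) n = (\<Sum>k=0..n. if n = m * k then fps_nth f k else 0)"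
    unfolding fps_compose_nth power_mult[symmetric] by (intro sum.cong) simp_all
  also have "\<dots> = (if m dvd n then fps_nth f (n div m) else 0)"
  proof (cases "m dvd n")
    case True
    then obtain k where k: "n = m * k" by blast
    have "(\<Sum>j=0..n. if n = m * j then fps_nth f j else 0) = (\<Sum>j=0..n. if j = k then fps_nth f j else 0)"
      using assms k by (intro sum.cong) auto
    also have "\<dots> = fps_nth f k" using assms k by simp
    finally show ?thesis using assms k by simp
  qed (auto intro!: sum.neutral)
  finally show ?thesis .
qed

lemma theta_compose_power:
  assumes "m > 0"
  shows "theta I w e oo fps_X ^ m = theta I w (\<lambda>i. m * e i)"
proof (rule fps_ext)
  fix n
  show "fps_nth (theta I w e oo fps_X ^ m) n = fps_nth (theta I w (\<lambda>i. m * e i)) n"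
  proof (cases "m dvd n")
    case True
    thus ?thesis using assms by (auto simp: fps_compose_X_power_nth theta_def intro!: sum.cong)
  next
    case False
    hence "{i. i \<in> I \<and> m * e i = n} = {}" by auto
    thus ?thesis using False assms
      by (simp only: fps_compose_X_power_nth theta_def fps_nth_Abs_fps sum.empty if_False)
  qed
qed

definition sq :: "int \<Rightarrow> nat" where "sq k = nat (k ^ 2)"
definition tri :: "int \<Rightarrow> nat" where "tri k = nat (k * (k + 1) div 2)"

lemma of_int_sq: "int (sq k) = k ^ 2"
  by (simp add: sq_def)

lemma of_int_tri: "2 * int (tri k) = k * (k + 1)"
proof -
  have "even (k * (k + 1))" by simp
  moreover have "k * (k + 1) \<ge> 0" by (cases "k \<ge> 0") (auto simp: mult_nonpos_nonpos)
  ultimately show ?thesis unfolding tri_def by (simp add: pos_imp_zdiv_nonneg_iff)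
qed

lemma finite_fibers_sq: "m > 0 \<Longrightarrow> finite_fibers UNIV (\<lambda>k. m * sq k)"
  unfolding finite_fibers_def
proof
  fix n assume m: "m > 0"
  have "\<bar>k\<bar> \<le> int n" if "m * sq k \<le> n" for k
  proof -
    have "\<bar>k\<bar> \<le> k ^ 2" using self_le_power[of "\<bar>k\<bar>" 2] by (cases "k = 0") auto
    also have "\<dots> = int (sq k)" by (simp add: of_int_sq)
    also have "sq k \<le> m * sq k" using m by simp
    finally show ?thesis using that by linarith
  qed
  hence "{i \<in> UNIV. m * sq i \<le> n} \<subseteq> {- int n..int n}" by (force simp: abs_le_iff)
  thus "finite {i \<in> UNIV. m * sq i \<le> n}" by (rule finite_subset) simp
qed

lemma finite_fibers_tri: "m > 0 \<Longrightarrow> finite_fibers UNIV (\<lambda>k. m * tri k)"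
  unfolding finite_fibers_def
proof
  fix n assume m: "m > 0"
  have "\<bar>k\<bar> \<le> 2 * int n + 1" if "m * tri k \<le> n" for k
  proof -
    have "\<bar>k\<bar> - 1 \<le> k * (k + 1)"
    proof (cases "k \<ge> 0")
      case True thus ?thesis by (simp add: algebra_simps)
    next
      case False
      hence "(- k - 1) * 1 \<le> (- k - 1) * (- k)" by (intro mult_left_mono) auto
      thus ?thesis using False by (simp add: algebra_simps)
    qed
    also have "\<dots> = 2 * int (tri k)" by (simp add: of_int_tri)
    finally have "\<bar>k\<bar> - 1 \<le> 2 * int (tri k)" .
    moreover have "tri k \<le> m * tri k" using m by simp
    ultimately show ?thesis using that by linarith
  qed
  hence "{i \<in> UNIV. m * tri i \<le> n} \<subseteq> {- (2 * int n + 1)..2 * int n + 1}" by (force simp: abs_le_iff)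
  thus "finite {i \<in> UNIV. m * tri i \<le> n}" by (rule finite_subset) simp
qed

definition alt_sign :: "int \<Rightarrow> rat" where "alt_sign k = (if even k then 1 else - 1)"

text \<open>
  Ramanujan's \<open>\<phi>(q)\<close> and \<open>\<phi>(-q)\<close>, twice his \<open>\<psi>(q)\<close>, and twice Jacobi's
  \<open>\<Sum>k\<ge>0. (-1) ^ k (2 k + 1) q ^ (k (k + 1) / 2)\<close>.  The doubled series are sums over all integers,
  which makes changes of summation variables uniform.
\<close>

definition phi :: "rat fps" where "phi = theta UNIV (\<lambda>_. 1) sq"
definition phi_alt :: "rat fps" where "phi_alt = theta UNIV alt_sign sq"
definition psi_doubled :: "rat fps" where "psi_doubled = theta UNIV (\<lambda>_. 1) tri"
definition jacobi_doubled :: "rat fps" where "jacobi_doubled = theta UNIV (\<lambda>k. alt_sign k * of_int (2 * k + 1)) tri"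

lemma mult_eq_theta:
  fixes e d :: "int \<Rightarrow> nat"
  assumes "finite_fibers UNIV e" "finite_fibers UNIV d"
  shows "theta UNIV w e * theta UNIV v d = theta UNIV (\<lambda>(i, j). w i * v j) (\<lambda>(i, j). e i + d j)"
  using theta_mult[OF assms] by simp

lemma even_lattice:
  "bij_betw (\<lambda>(c, d). (c + d, c - d)) (UNIV :: (int \<times> int) set) {(a, b). even (a + b)}"
  by (rule bij_betwI[where g = "\<lambda>(a, b). ((a + b) div 2, (a - b) div 2)"]) (auto; presburger)+

lemma odd_lattice:
  "bij_betw (\<lambda>(c, d). (c + d + 1, c - d)) (UNIV :: (int \<times> int) set) {(a, b). odd (a + b)}"
  by (rule bij_betwI[where g = "\<lambda>(a, b). ((a + b) div 2, (a - b) div 2)"]) (auto; presburger)+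


abbreviation at_power :: "rat fps \<Rightarrow> nat \<Rightarrow> rat fps" where
  "at_power f m \<equiv> f oo fps_X ^ m"

lemma finite_fibers_add:
  assumes "finite_fibers I e" "finite_fibers J d"
  shows "finite_fibers (I \<times> J) (\<lambda>(i, j). e i + d j)"
  unfolding finite_fibers_def
proof
  fix n
  have "{x \<in> I \<times> J. (\<lambda>(i, j). e i + d j) x \<le> n} \<subseteq> {i \<in> I. e i \<le> n} \<times> {j \<in> J. d j \<le> n}" by auto
  thus "finite {x \<in> I \<times> J. (\<lambda>(i, j). e i + d j) x \<le> n}"
    by (rule finite_subset) (use assms in \<open>auto simp: finite_fibers_def\<close>)
qed

lemma finite_fibers_mono: "finite_fibers J e \<Longrightarrow> I \<subseteq> J \<Longrightarrow> finite_fibers I e"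
  unfolding finite_fibers_def by (blast intro: finite_subset[rotated])

lemmas fin_sq = finite_fibers_sq[of 1, simplified]
lemmas fin_tri = finite_fibers_tri[of 1, simplified]

lemma theta_parity_split:
  assumes "finite_fibers (UNIV :: (int \<times> int) set) e"
  shows "theta UNIV w e = theta {(a, b). even (a + b)} w e + theta {(a, b). odd (a + b)} w e"
proof -
  have "UNIV = {(a, b). even (a + b)} \<union> {(a, b). odd (a + b :: int)}" by auto
  moreover have "theta ({(a, b). even (a + b)} \<union> {(a, b). odd (a + b)}) w e =
     theta {(a, b). even (a + b)} w e + theta {(a, b). odd (a + b)} w e"
    by (intro theta_union finite_fibers_mono[OF assms]) auto
  ultimately show ?thesis by simp
qed

lemma fin_sq_sq: "finite_fibers UNIV (\<lambda>(a, b). sq a + sq b)"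
  using finite_fibers_add[OF fin_sq fin_sq] by simp

lemma sum_sq_even: "sq (c + d) + sq (c - d) = 2 * sq c + 2 * sq d"
proof -
  have "int (sq (c + d) + sq (c - d)) = int (2 * sq c + 2 * sq d)"
    by (simp add: of_int_sq power2_eq_square algebra_simps)
  thus ?thesis by (simp only: of_nat_eq_iff)
qed

lemma sum_sq_odd: "sq (c + d + 1) + sq (c - d) = Suc (4 * tri c + 4 * tri d)"
proof -
  have "int (sq (c + d + 1) + sq (c - d)) = 1 + 2 * (2 * int (tri c)) + 2 * (2 * int (tri d))"
    unfolding of_int_tri by (simp add: of_int_sq power2_eq_square algebra_simps)
  also have "\<dots> = int (Suc (4 * tri c + 4 * tri d))" by simp
  finally show ?thesis by (simp only: of_nat_eq_iff)
qed

text \<open>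
  In a sum over \<open>a ^ 2 + b ^ 2\<close>, pairs of equal parity are \<open>(c + d, c - d)\<close> and the others are
  \<open>(c + d + 1, c - d)\<close>.
\<close>

lemma phi_square_dissection:
  "phi ^ 2 = at_power phi 2 ^ 2 + fps_X * at_power psi_doubled 4 ^ 2"
  "phi_alt ^ 2 = at_power phi 2 ^ 2 - fps_X * at_power psi_doubled 4 ^ 2"
proof -
  have e: "at_power phi 2 ^ 2 = theta UNIV (\<lambda>_. 1) (\<lambda>(a, b). 2 * sq a + 2 * sq b)"
  proof -
    have "at_power phi 2 = theta UNIV (\<lambda>_. 1) (\<lambda>k. 2 * sq k)"
      unfolding phi_def by (rule theta_compose_power) simp
    thus ?thesis unfolding power2_eq_square by (simp add: mult_eq_theta finite_fibers_sq case_prod_unfold)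
  qed
  have o: "fps_X * at_power psi_doubled 4 ^ 2 = theta UNIV (\<lambda>_. 1) (\<lambda>(a, b). Suc (4 * tri a + 4 * tri b))"
  proof -
    have "at_power psi_doubled 4 = theta UNIV (\<lambda>_. 1) (\<lambda>k. 4 * tri k)"
      unfolding psi_doubled_def by (rule theta_compose_power) simp
    thus ?thesis unfolding power2_eq_square
      by (simp add: mult_eq_theta finite_fibers_tri theta_X_mult case_prod_unfold)
  qed
  have o': "- (fps_X * at_power psi_doubled 4 ^ 2) = theta UNIV (\<lambda>_. - 1) (\<lambda>(a, b). Suc (4 * tri a + 4 * tri b))"
    unfolding o by (rule theta_uminus[symmetric])
  have "phi ^ 2 = theta UNIV (\<lambda>_. 1) (\<lambda>(a, b). sq a + sq b)"
    unfolding phi_def power2_eq_square by (simp add: mult_eq_theta fin_sq case_prod_unfold)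
  also have "\<dots> = theta {(a, b). even (a + b)} (\<lambda>_. 1) (\<lambda>(a, b). sq a + sq b)
      + theta {(a, b). odd (a + b)} (\<lambda>_. 1) (\<lambda>(a, b). sq a + sq b)"
    by (rule theta_parity_split[OF fin_sq_sq])
  also have "theta {(a, b). even (a + b)} (\<lambda>_. 1) (\<lambda>(a, b). sq a + sq b) = at_power phi 2 ^ 2"
    unfolding e by (rule theta_reindex[OF even_lattice, symmetric]) (auto simp: sum_sq_even)
  also have "theta {(a, b). odd (a + b)} (\<lambda>_. 1) (\<lambda>(a, b). sq a + sq b) = fps_X * at_power psi_doubled 4 ^ 2"
    unfolding o by (rule theta_reindex[OF odd_lattice, symmetric]) (auto simp: sum_sq_odd)
  finally show "phi ^ 2 = at_power phi 2 ^ 2 + fps_X * at_power psi_doubled 4 ^ 2" .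
  have "phi_alt ^ 2 = theta UNIV (\<lambda>(a, b). alt_sign a * alt_sign b) (\<lambda>(a, b). sq a + sq b)"
    unfolding phi_alt_def power2_eq_square by (rule mult_eq_theta[OF fin_sq fin_sq])
  also have "\<dots> = theta {(a, b). even (a + b)} (\<lambda>(a, b). alt_sign a * alt_sign b) (\<lambda>(a, b). sq a + sq b)
      + theta {(a, b). odd (a + b)} (\<lambda>(a, b). alt_sign a * alt_sign b) (\<lambda>(a, b). sq a + sq b)"
    by (rule theta_parity_split[OF fin_sq_sq])
  also have "theta {(a, b). even (a + b)} (\<lambda>(a, b). alt_sign a * alt_sign b) (\<lambda>(a, b). sq a + sq b) = at_power phi 2 ^ 2"
    unfolding e by (rule theta_reindex[OF even_lattice, symmetric]) (auto simp: sum_sq_even alt_sign_def)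
  also have "theta {(a, b). odd (a + b)} (\<lambda>(a, b). alt_sign a * alt_sign b) (\<lambda>(a, b). sq a + sq b) = - (fps_X * at_power psi_doubled 4 ^ 2)"
    unfolding o' by (rule theta_reindex[OF odd_lattice, symmetric]) (auto simp: sum_sq_odd alt_sign_def)
  finally show "phi_alt ^ 2 = at_power phi 2 ^ 2 - fps_X * at_power psi_doubled 4 ^ 2" by simp
qed

lemma parity_bij_even: "bij_betw (\<lambda>k :: int. 2 * k) UNIV {k. even k}"
  by (rule bij_betwI[where g = "\<lambda>k. k div 2"]) auto

lemma parity_bij_odd: "bij_betw (\<lambda>k :: int. 2 * k + 1) UNIV {k. odd k}"
  by (rule bij_betwI[where g = "\<lambda>k. k div 2"]) auto

lemma sq_double: "sq (2 * k) = 4 * sq k"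
proof -
  have "int (sq (2 * k)) = int (4 * sq k)" by (simp add: of_int_sq power2_eq_square)
  thus ?thesis by (simp only: of_nat_eq_iff)
qed

lemma sq_odd: "sq (2 * k + 1) = Suc (8 * tri k)"
proof -
  have "int (sq (2 * k + 1)) = 1 + 4 * (2 * int (tri k))"
    unfolding of_int_tri by (simp add: of_int_sq power2_eq_square algebra_simps)
  also have "\<dots> = int (Suc (8 * tri k))" by simp
  finally show ?thesis by (simp only: of_nat_eq_iff)
qed

lemma phi_dissection:
  "phi = at_power phi 4 + fps_X * at_power psi_doubled 8"
  "phi_alt = at_power phi 4 - fps_X * at_power psi_doubled 8"
proof -
  have U: "UNIV = {k. even k} \<union> {k. odd (k :: int)}" by auto
  have split: "theta UNIV w sq = theta {k. even k} w sq + theta {k. odd k} w sq" for w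
    unfolding U by (intro theta_union finite_fibers_mono[OF fin_sq]) auto
  have e: "at_power phi 4 = theta UNIV (\<lambda>_. 1) (\<lambda>k. 4 * sq k)"
    unfolding phi_def by (rule theta_compose_power) simp
  have o: "fps_X * at_power psi_doubled 8 = theta UNIV (\<lambda>_. 1) (\<lambda>k. Suc (8 * tri k))"
    unfolding psi_doubled_def by (simp add: theta_compose_power theta_X_mult)
  have o': "- (fps_X * at_power psi_doubled 8) = theta UNIV (\<lambda>_. - 1) (\<lambda>k. Suc (8 * tri k))"
    unfolding o by (rule theta_uminus[symmetric])
  have "theta {k. even k} (\<lambda>_. 1) sq = at_power phi 4" "theta {k. even k} alt_sign sq = at_power phi 4"
    unfolding e by (rule theta_reindex[OF parity_bij_even, symmetric]; simp add: sq_double alt_sign_def)+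
  moreover have "theta {k. odd k} (\<lambda>_. 1) sq = fps_X * at_power psi_doubled 8"
    unfolding o by (rule theta_reindex[OF parity_bij_odd, symmetric]) (simp_all add: sq_odd)
  moreover have "theta {k. odd k} alt_sign sq = - (fps_X * at_power psi_doubled 8)"
    unfolding o' by (rule theta_reindex[OF parity_bij_odd, symmetric]) (simp_all add: sq_odd alt_sign_def)
  ultimately show "phi = at_power phi 4 + fps_X * at_power psi_doubled 8"
    "phi_alt = at_power phi 4 - fps_X * at_power psi_doubled 8"
    unfolding phi_def[of] phi_alt_def by (simp_all only: split) simp_all
qed

section \<open>Theta identities from doubling the nome\<close>

lemma at_power_mult: "m > 0 \<Longrightarrow> at_power (f * g) m = at_power f m * at_power g m"
  by (simp add: fps_compose_mult_distrib)

lemma at_power_power: "m > 0 \<Longrightarrow> at_power (f ^ k) m = at_power f m ^ k"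
  by (simp add: fps_compose_power)

lemma at_power_add: "at_power (f + g) m = at_power f m + at_power g m"
  by (rule fps_compose_add_distrib)

lemma at_power_diff: "at_power (f - g) m = at_power f m - at_power g m"
  by (rule fps_compose_sub_distrib)

lemma at_power_at_power:
  assumes "a > 0" "b > 0" "c = a * b"
  shows "at_power (at_power f a) b = at_power f c"
proof (rule fps_ext)
  fix n
  show "fps_nth (at_power (at_power f a) b) n = fps_nth (at_power f c) n"
    using assms by (auto simp: fps_compose_X_power_nth div_mult2_eq mult.commute elim!: dvdE)
qed

lemma at_power_cancel:
  assumes "m > 0" "at_power f m = at_power g m"
  shows "f = g"
proof (rule fps_ext)
  fix n
  have "fps_nth (at_power f m) (m * n) = fps_nth (at_power g m) (m * n)" using assms by simp
  thus "fps_nth f n = fps_nth g n" using assms(1) by (simp add: fps_compose_X_power_nth)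
qed

lemma at_power_XD:
  assumes "m > 0"
  shows "fps_XD (at_power f m) = of_nat m * at_power (fps_XD f) m"
proof (rule fps_ext)
  fix n
  show "fps_nth (fps_XD (at_power f m)) n = fps_nth (of_nat m * at_power (fps_XD f) m) n"
    using assms by (auto simp: fps_compose_X_power_nth fps_XD_def fps_mult_fps_X_deriv_shift
      simp flip: fps_of_nat)
qed

lemma fps_square_unique:
  fixes f g :: "rat fps"
  assumes "f ^ 2 = g ^ 2" "fps_nth f 0 = fps_nth g 0" "fps_nth f 0 \<noteq> 0"
  shows "f = g"
proof -
  have "f = g \<or> f = - g" using assms(1) by (simp add: power2_eq_iff)
  moreover have "f \<noteq> - g"
  proof
    assume "f = - g"
    hence "fps_nth f 0 = - fps_nth g 0" by simp
    thus False using assms by simp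
  qed
  ultimately show ?thesis by blast
qed

lemma sq_eq_0: "{k. sq k = 0} = {0}"
proof -
  have "sq k = 0 \<longleftrightarrow> k = 0" for k using of_int_sq[of k] by (auto simp: sq_def)
  thus ?thesis by auto
qed

lemma tri_eq_0: "{k. tri k = 0} = {0, - 1}"
proof -
  have "tri k = 0 \<longleftrightarrow> k = 0 \<or> k = - 1" for k
  proof
    assume "tri k = 0"
    hence "k * (k + 1) = 0" using of_int_tri[of k] by simp
    thus "k = 0 \<or> k = - 1" by auto
  qed (auto simp: tri_def)
  thus ?thesis by auto
qed

lemma theta_constants: "fps_nth phi 0 = 1" "fps_nth phi_alt 0 = 1" "fps_nth psi_doubled 0 = 2" "fps_nth jacobi_doubled 0 = 2"
  by (simp_all add: phi_def phi_alt_def psi_doubled_def jacobi_doubled_def theta_def sq_eq_0 tri_eq_0 alt_sign_def)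

text \<open>
  Compute \<open>\<phi>(q) ^ 2 - \<phi>(-q) ^ 2\<close> from the dissection of the squares and, as a product, from the
  dissection of \<open>\<phi>\<close> itself; both expressions are series in \<open>q ^ 4\<close> up to a factor \<open>q\<close>.
\<close>

lemma psi_doubled_square: "psi_doubled ^ 2 = 2 * phi * at_power psi_doubled 2"
proof -
  have "2 * fps_X * at_power psi_doubled 4 ^ 2 = phi ^ 2 - phi_alt ^ 2"
    unfolding phi_square_dissection by simp
  also have "\<dots> = (phi - phi_alt) * (phi + phi_alt)" by (simp add: power2_eq_square algebra_simps)
  also have "phi - phi_alt = 2 * fps_X * at_power psi_doubled 8"
    by (subst phi_dissection(1), subst phi_dissection(2)) simp
  also have "phi + phi_alt = 2 * at_power phi 4"
    by (subst phi_dissection(1), subst phi_dissection(2)) simp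
  finally have "(2 * fps_X) * at_power psi_doubled 4 ^ 2 = (2 * fps_X) * (2 * at_power phi 4 * at_power psi_doubled 8)"
    by (simp only: mult_ac)
  hence "at_power psi_doubled 4 ^ 2 = 2 * at_power phi 4 * at_power psi_doubled 8"
    by (subst (asm) mult_left_cancel) auto
  moreover have "at_power (at_power psi_doubled 2) 4 = at_power psi_doubled 8"
    by (rule at_power_at_power) simp_all
  ultimately have "at_power (psi_doubled ^ 2) 4 = at_power (2 * phi * at_power psi_doubled 2) 4"
    by (simp add: at_power_power at_power_mult)
  thus ?thesis by (rule at_power_cancel[rotated]) simp
qed

lemma psi_doubled_square_at_2: "at_power psi_doubled 2 ^ 2 = 2 * at_power phi 2 * at_power psi_doubled 4"
proof -
  have "at_power (at_power psi_doubled 2) 2 = at_power psi_doubled 4"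
    by (rule at_power_at_power) simp_all
  thus ?thesis using arg_cong[OF psi_doubled_square, of "\<lambda>f. at_power f 2"]
    by (simp add: at_power_power at_power_mult)
qed

lemma phi_fourth_powers: "phi ^ 4 - phi_alt ^ 4 = fps_X * at_power psi_doubled 2 ^ 4"
proof -
  have "phi ^ 4 - phi_alt ^ 4 = (phi ^ 2 - phi_alt ^ 2) * (phi ^ 2 + phi_alt ^ 2)"
    by Groebner_Basis.algebra
  also have "\<dots> = fps_X * (2 * at_power phi 2 * at_power psi_doubled 4) ^ 2"
    unfolding phi_square_dissection by Groebner_Basis.algebra
  also have "\<dots> = fps_X * (at_power psi_doubled 2 ^ 2) ^ 2"
    by (simp only: psi_doubled_square_at_2)
  finally show ?thesis by simp
qed

text \<open>
  The squares of both sides agree by the previous identity with \<open>q ^ 2\<close> in place of \<open>q\<close>.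
\<close>

lemma phi_alt_at_2: "at_power phi_alt 2 ^ 2 = phi * phi_alt"
proof (rule fps_square_unique)
  have a: "at_power (at_power psi_doubled 2) 2 = at_power psi_doubled 4"
    by (rule at_power_at_power) simp_all
  have "at_power phi 2 ^ 4 - at_power phi_alt 2 ^ 4 = fps_X ^ 2 * at_power psi_doubled 4 ^ 4"
    using arg_cong[OF phi_fourth_powers, of "\<lambda>f. at_power f 2"]
    by (simp add: at_power_power at_power_mult at_power_diff a del: power2_eq_square)
  hence "at_power phi_alt 2 ^ 4 = (at_power phi 2 ^ 2 + fps_X * at_power psi_doubled 4 ^ 2) * (at_power phi 2 ^ 2 - fps_X * at_power psi_doubled 4 ^ 2)"
    by Groebner_Basis.algebra
  thus "(at_power phi_alt 2 ^ 2) ^ 2 = (phi * phi_alt) ^ 2"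
    unfolding power_mult_distrib phi_square_dissection[symmetric] by (simp flip: power_mult)
qed (simp_all add: theta_constants fps_power_zeroth)

text \<open>
  Up to normalisation the Wronskian of the theta functions \<open>\<theta>\<^sub>2 = q ^ (1/4) \<Sum>n. q ^ (n (n + 1))\<close> and
  \<open>\<theta>\<^sub>3 = \<phi>(q)\<close>; the summand without derivatives comes from the factor \<open>q ^ (1/4)\<close>.
\<close>

definition bracket :: "rat fps" where
  "bracket = at_power psi_doubled 2 * phi + 4 * (fps_XD (at_power psi_doubled 2) * phi - at_power psi_doubled 2 * fps_XD phi)"

lemma tri_lattice: "tri (n + m) + tri (n - m) = 2 * tri n + sq m"
proof -
  have "2 * int (tri (n + m)) + 2 * int (tri (n - m)) = 2 * (2 * int (tri n)) + 2 * int (sq m)"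
    unfolding of_int_tri of_int_sq by (simp add: power2_eq_square algebra_simps)
  thus ?thesis by linarith
qed

lemma tri_reflect: "tri (- 1 - k) = tri k"
proof -
  have "2 * int (tri (- 1 - k)) = 2 * int (tri k)" unfolding of_int_tri by (simp add: algebra_simps)
  thus ?thesis by simp
qed

lemma fin_tri_tri: "finite_fibers UNIV (\<lambda>(a, b). tri a + tri b)"
  using finite_fibers_add[OF fin_tri fin_tri] by simp

text \<open>
  The bracket is a double sum with weight \<open>(2 n + 1) ^ 2 - 4 m ^ 2\<close>, which factors as
  \<open>(2 a + 1) (2 b + 1)\<close> with \<open>a = n + m\<close>, \<open>b = n - m\<close>.  This gives one half of the square of the Jacobi
  series, the pairs with \<open>a + b\<close> even; reflecting \<open>b\<close> to \<open>- 1 - b\<close> shows that the other half is the same.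
\<close>

lemma jacobi_doubled_square: "jacobi_doubled ^ 2 = 2 * bracket"
proof -
  define w :: "int \<times> int \<Rightarrow> rat" where "w = (\<lambda>(a, b). of_int (2 * a + 1) * of_int (2 * b + 1))"
  define e where "e = (\<lambda>(a, b). tri a + tri b)"
  have fin: "finite_fibers UNIV e" unfolding e_def by (rule fin_tri_tri)
  have psi: "at_power psi_doubled 2 = theta UNIV (\<lambda>_. 1) (\<lambda>k. 2 * tri k)"
    unfolding psi_doubled_def by (rule theta_compose_power) simp
  have f2: "finite_fibers UNIV (\<lambda>k. 2 * tri k)" by (rule finite_fibers_tri) simp
  have "bracket = theta UNIV (\<lambda>(i, j). 1 + 4 * (of_nat (2 * tri i) - of_nat (sq j))) (\<lambda>(i, j). 2 * tri i + sq j)"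
  proof -
    have "bracket = theta UNIV (\<lambda>x. 1 + 4 * ((case x of (i, j) \<Rightarrow> of_nat (2 * tri i) * 1 * 1) - (case x of (i, j) \<Rightarrow> 1 * (of_nat (sq j) * 1))))
       (\<lambda>(i, j). 2 * tri i + sq j)"
      unfolding bracket_def psi phi_def theta_XD mult_eq_theta[OF f2 fin_sq] theta_add theta_diff theta_scale
      by (simp add: case_prod_unfold numeral_fps_const)
    thus ?thesis by (simp add: case_prod_unfold)
  qed
  also have "\<dots> = theta {(a, b). even (a + b)} w e"
  proof (rule theta_reindex[OF even_lattice])
    fix x :: "int \<times> int"
    obtain i j where x: "x = (i, j)" by (cases x)
    show "(case x of (i, j) \<Rightarrow> 1 + 4 * (of_nat (2 * tri i) - of_nat (sq j))) = w (case x of (c, d) \<Rightarrow> (c + d, c - d))"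
    proof -
      have "(1 + 4 * (of_nat (2 * tri i) - of_nat (sq j)) :: rat) = of_int (1 + 4 * (2 * int (tri i) - int (sq j)))" by simp
      also have "1 + 4 * (2 * int (tri i) - int (sq j)) = (2 * (i + j) + 1) * (2 * (i - j) + 1)"
        unfolding of_int_tri of_int_sq by (simp add: power2_eq_square algebra_simps)
      finally show ?thesis by (simp add: x w_def)
    qed
    show "(case x of (i, j) \<Rightarrow> 2 * tri i + sq j) = e (case x of (c, d) \<Rightarrow> (c + d, c - d))"
      by (simp add: x e_def tri_lattice)
  qed
  finally have br: "bracket = theta {(a, b). even (a + b)} w e" .
  have "jacobi_doubled ^ 2 = theta UNIV (\<lambda>x. (case x of (a, b) \<Rightarrow> alt_sign a * alt_sign b) * w x) e"
    unfolding jacobi_doubled_def power2_eq_square mult_eq_theta[OF fin_tri fin_tri] w_def e_def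
    by (simp add: case_prod_unfold mult_ac)
  also have "\<dots> = theta {(a, b). even (a + b)} (\<lambda>x. (case x of (a, b) \<Rightarrow> alt_sign a * alt_sign b) * w x) e +
      theta {(a, b). odd (a + b)} (\<lambda>x. (case x of (a, b) \<Rightarrow> alt_sign a * alt_sign b) * w x) e"
    by (rule theta_parity_split[OF fin])
  also have "theta {(a, b). even (a + b)} (\<lambda>x. (case x of (a, b) \<Rightarrow> alt_sign a * alt_sign b) * w x) e = bracket"
    unfolding br by (rule theta_reindex[of id]) (auto simp: alt_sign_def)
  also have "theta {(a, b). odd (a + b)} (\<lambda>x. (case x of (a, b) \<Rightarrow> alt_sign a * alt_sign b) * w x) e = bracket"
    unfolding br
  proof (rule theta_reindex[where h = "\<lambda>(a, b). (a, - 1 - b)"])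
    show "bij_betw (\<lambda>(a, b). (a, - 1 - b)) {(a, b). odd (a + b)} {(a, b). even (a + b :: int)}"
      by (rule bij_betwI[where g = "\<lambda>(a, b). (a, - 1 - b)"]) auto
  next
    fix x :: "int \<times> int" assume "x \<in> {(a, b). odd (a + b)}"
    thus "(case x of (a, b) \<Rightarrow> alt_sign a * alt_sign b) * w x = w (case x of (a, b) \<Rightarrow> (a, - 1 - b))"
      "e x = e (case x of (a, b) \<Rightarrow> (a, - 1 - b))"
      by (auto simp: w_def e_def alt_sign_def tri_reflect algebra_simps)
  qed
  finally show ?thesis by simp
qed

text \<open>
  Landen's transformation for the Wronskian.  Write \<open>A = \<phi>(q) ^ 2 = Q + P\<close> and
  \<open>B = \<phi>(-q) ^ 2 = Q - P\<close>.  Up to monomials in the theta series the bracket at \<open>q\<close> is the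
  Wronskian of \<open>A ^ 2\<close> and \<open>A ^ 2 - B ^ 2\<close>, and the one at \<open>q ^ 2\<close> is that of \<open>Q ^ 2\<close> and \<open>P ^ 2\<close>; both are
  multiples of \<open>B dA - A dB\<close>.
\<close>

lemma bracket_at_2: "at_power psi_doubled 2 * phi * bracket = 2 * phi_alt ^ 2 * at_power bracket 2"
proof -
  define P Q where "P = fps_X * at_power psi_doubled 4 ^ 2" and "Q = at_power phi 2 ^ 2"
  define A B where "A = phi ^ 2" and "B = phi_alt ^ 2"
  define s f where "s = at_power psi_doubled 2" and "f = phi"
  define S F where "S = at_power psi_doubled 4" and "F = at_power phi 2"
  have A: "A = Q + P" and B: "B = Q - P"
    unfolding A_def B_def P_def Q_def by (rule phi_square_dissection)+
  have ss: "s ^ 2 = 2 * F * S" unfolding s_def F_def S_def by (rule psi_doubled_square_at_2)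
  have SS: "at_power s 2 = S" unfolding s_def S_def by (rule at_power_at_power) simp_all
  have AB: "A ^ 2 - B ^ 2 = fps_X * s ^ 4"
    unfolding A_def B_def s_def using phi_fourth_powers by (simp flip: power_mult)
  have br: "bracket = s * f + 4 * (fps_XD s * f - s * fps_XD f)"
    unfolding bracket_def s_def f_def ..
  have br2: "2 * at_power bracket 2 = 2 * S * F + 4 * (fps_XD S * F - S * fps_XD F)"
  proof -
    have "fps_XD S = 2 * at_power (fps_XD s) 2" "fps_XD F = 2 * at_power (fps_XD f) 2"
      unfolding SS[symmetric] F_def f_def by (simp_all add: at_power_XD del: power2_eq_square)
    thus ?thesis unfolding br
      by (simp add: at_power_add at_power_diff at_power_mult SS F_def f_def algebra_simps)
  qed
  have D1: "fps_X * s ^ 3 * f ^ 3 * bracket = 2 * A * B * (B * fps_XD A - A * fps_XD B)"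
  proof -
    have DA: "fps_XD (A ^ 2) = 2 * A * fps_XD A" and DB: "fps_XD (B ^ 2) = 2 * B * fps_XD B"
      by (simp_all add: fps_XD_power)
    have DAf: "fps_XD (A ^ 2) = 4 * f ^ 3 * fps_XD f"
      unfolding A_def f_def by (simp add: fps_XD_power flip: power_mult)
    have "fps_XD (A ^ 2 - B ^ 2) = fps_X * s ^ 4 + fps_X * (4 * s ^ 3 * fps_XD s)"
      unfolding AB by (simp add: fps_XD_mult fps_XD_X fps_XD_power algebra_simps)
    hence D: "2 * A * fps_XD A - 2 * B * fps_XD B = fps_X * s ^ 4 + fps_X * (4 * s ^ 3 * fps_XD s)"
      by (simp only: fps_XD_diff DA DB)
    have Af: "A ^ 2 = f ^ 4" unfolding A_def f_def by (simp flip: power_mult)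
    have "fps_X * s ^ 3 * f ^ 3 * bracket =
       (fps_X * s ^ 4 + fps_X * (4 * s ^ 3 * fps_XD s)) * f ^ 4 - fps_X * s ^ 4 * (4 * f ^ 3 * fps_XD f)"
      unfolding br by Groebner_Basis.algebra
    also have "\<dots> = (2 * A * fps_XD A - 2 * B * fps_XD B) * A ^ 2 - (A ^ 2 - B ^ 2) * (2 * A * fps_XD A)"
      unfolding D[symmetric] unfolding AB[symmetric] Af[symmetric] DAf[symmetric] DA ..
    also have "\<dots> = 2 * A * B * (B * fps_XD A - A * fps_XD B)" by Groebner_Basis.algebra
    finally show ?thesis .
  qed
  have D2: "2 * fps_X ^ 2 * S ^ 3 * F ^ 3 * at_power bracket 2 = P * Q * (B * fps_XD A - A * fps_XD B)"
  proof -
    have DP: "fps_XD P = fps_X * S ^ 2 + 2 * fps_X * S * fps_XD S"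
      unfolding P_def S_def[symmetric] by (simp add: fps_XD_mult fps_XD_X fps_XD_power algebra_simps)
    have DQ: "fps_XD Q = 2 * F * fps_XD F"
      unfolding Q_def F_def[symmetric] by (simp add: fps_XD_power)
    have "B * fps_XD A - A * fps_XD B = 2 * (Q * fps_XD P - P * fps_XD Q)"
      unfolding A B by (simp add: fps_XD_add fps_XD_diff algebra_simps)
    also have "\<dots> = fps_X * S * F * (2 * S * F + 4 * (fps_XD S * F - S * fps_XD F))"
      unfolding DP DQ unfolding P_def Q_def S_def[symmetric] F_def[symmetric] by Groebner_Basis.algebra
    also have "\<dots> = fps_X * S * F * (2 * at_power bracket 2)" by (simp only: br2)
    finally show ?thesis unfolding P_def Q_def S_def[symmetric] F_def[symmetric] by Groebner_Basis.algebra
  qed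
  define E E2 where "E = bracket" and "E2 = at_power bracket 2"
  have nz: "S \<noteq> 0" "F \<noteq> 0" "f \<noteq> 0" "s \<noteq> 0"
  proof -
    have "fps_nth S 0 \<noteq> 0" "fps_nth F 0 \<noteq> 0" "fps_nth f 0 \<noteq> 0" "fps_nth s 0 \<noteq> 0"
      by (simp_all add: S_def F_def f_def s_def theta_constants)
    thus "S \<noteq> 0" "F \<noteq> 0" "f \<noteq> 0" "s \<noteq> 0" by auto
  qed
  \<comment> \<open>Both sides are 2 A B P Q times the Wronskian of A and B.\<close>
  have "P * Q * (fps_X * s ^ 3 * f ^ 3 * E) = 2 * A * B * (2 * fps_X ^ 2 * S ^ 3 * F ^ 3 * E2)"
    unfolding E_def E2_def D1 D2 by Groebner_Basis.algebra
  hence "(fps_X ^ 2 * S ^ 2 * F ^ 2 * f ^ 2 * s ^ 2) * (s * f * E) = (fps_X ^ 2 * S ^ 2 * F ^ 2 * f ^ 2 * (2 * F * S)) * (2 * B * E2)"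
    unfolding P_def Q_def A_def S_def[symmetric] F_def[symmetric] unfolding f_def[symmetric] by Groebner_Basis.algebra
  hence "(fps_X ^ 2 * S ^ 2 * F ^ 2 * f ^ 2 * s ^ 2) * (s * f * E) = (fps_X ^ 2 * S ^ 2 * F ^ 2 * f ^ 2 * s ^ 2) * (2 * B * E2)"
    by (simp only: ss)
  moreover have "fps_X ^ 2 * S ^ 2 * F ^ 2 * f ^ 2 * s ^ 2 \<noteq> 0" using nz by simp
  ultimately have "s * f * E = 2 * B * E2" using mult_left_cancel by blast
  thus ?thesis by (simp only: s_def f_def E_def B_def E2_def)
qed

lemma at_power_2_fixed_point:
  assumes "at_power u 2 = u"
  shows "u = fps_const (fps_nth u 0)"
proof (rule fps_ext)
  fix n
  have "fps_nth u n = 0" if "n > 0" for n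
    using that
  proof (induction n rule: less_induct)
    case (less n)
    have "fps_nth u n = (if even n then fps_nth u (n div 2) else 0)"
      using fps_compose_X_power_nth[of 2 u n] assms by simp
    thus ?case using less by auto
  qed
  thus "fps_nth u n = fps_nth (fps_const (fps_nth u 0)) n" by simp
qed

text \<open>
  The quotient of the two sides is unchanged when \<open>q\<close> is replaced by \<open>q ^ 2\<close>, hence constant.
\<close>

lemma bracket_eq: "bracket = at_power psi_doubled 2 * phi * phi_alt ^ 4"
proof -
  define d where "d = at_power psi_doubled 2 * phi * phi_alt ^ 4"
  have d0: "fps_nth d 0 = 2" by (simp add: d_def theta_constants fps_power_zeroth)
  have dnz: "d \<noteq> 0" using d0 by auto
  define u where "u = bracket * inverse d"
  have ud: "u * d = bracket" unfolding u_def using d0 by (simp add: mult.assoc inverse_mult_eq_1)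
  have SS: "at_power (at_power psi_doubled 2) 2 = at_power psi_doubled 4" by (rule at_power_at_power) simp_all
  define s f a E E2 S F a2 where "s = at_power psi_doubled 2" and "f = phi" and "a = phi_alt" and "E = bracket"
    and "E2 = at_power bracket 2" and "S = at_power psi_doubled 4" and "F = at_power phi 2" and "a2 = at_power phi_alt 2"
  have 1: "s * f * E = 2 * a ^ 2 * E2" using bracket_at_2 by (simp only: s_def f_def E_def a_def E2_def)
  have 2: "s ^ 2 = 2 * F * S" using psi_doubled_square_at_2 by (simp only: s_def F_def S_def)
  have 3: "a2 ^ 2 = f * a" using phi_alt_at_2 by (simp only: a2_def f_def a_def)
  have d2: "at_power d 2 = S * F * a2 ^ 4"
    unfolding d_def by (simp add: at_power_mult at_power_power SS S_def F_def a2_def del: power2_eq_square)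
  have "2 * (E * at_power d 2) = E * (2 * F * S) * (a2 ^ 2) ^ 2"
    unfolding d2 by Groebner_Basis.algebra
  also have "\<dots> = s * f * E * (s * f * a ^ 2)" unfolding 3 2[symmetric] by Groebner_Basis.algebra
  also have "\<dots> = 2 * (E2 * d)" unfolding 1 by (simp add: d_def s_def f_def a_def)
  finally have "E * at_power d 2 = E2 * d" by simp
  moreover have "E2 = at_power u 2 * at_power d 2" unfolding E2_def ud[symmetric] by (rule at_power_mult) simp
  ultimately have "(d * at_power d 2) * at_power u 2 = (d * at_power d 2) * u"
    unfolding E_def ud[symmetric] by (simp only: mult_ac)
  moreover have "d * at_power d 2 \<noteq> 0"
  proof -
    have "fps_nth (at_power d 2) 0 \<noteq> 0" by (simp add: d0)
    hence "at_power d 2 \<noteq> 0" by (metis fps_zero_nth)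
    thus ?thesis using dnz by simp
  qed
  ultimately have "at_power u 2 = u" using mult_left_cancel by blast
  hence "u = fps_const (fps_nth u 0)" by (rule at_power_2_fixed_point)
  moreover have "fps_nth u 0 = 1"
  proof -
    have "fps_nth u 0 * 2 = fps_nth bracket 0" using d0 by (simp flip: ud)
    also have "\<dots> = 2" by (simp add: bracket_def fps_XD_def theta_constants)
    finally show ?thesis by simp
  qed
  ultimately have "u = 1" by simp
  thus ?thesis using ud by (simp add: d_def)
qed

text \<open>
  Jacobi's derivative formula \<open>\<theta>\<^sub>1' = \<theta>\<^sub>2 \<theta>\<^sub>3 \<theta>\<^sub>4\<close> at the square root of \<open>q\<close>, where \<open>\<theta>\<^sub>3 \<theta>\<^sub>4\<close> is
  \<open>\<phi>(-q) ^ 2\<close>.  The formula for the bracket is its square.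
\<close>

lemma jacobi_doubled_eq: "jacobi_doubled = psi_doubled * phi_alt ^ 2"
proof (rule fps_square_unique)
  have "jacobi_doubled ^ 2 = 2 * phi * at_power psi_doubled 2 * phi_alt ^ 4"
    unfolding jacobi_doubled_square bracket_eq by (simp only: mult_ac)
  also have "\<dots> = (psi_doubled * phi_alt ^ 2) ^ 2"
    unfolding power_mult_distrib psi_doubled_square by (simp flip: power_mult)
  finally show "jacobi_doubled ^ 2 = (psi_doubled * phi_alt ^ 2) ^ 2" .
qed (simp_all add: theta_constants fps_power_zeroth)

definition psi :: "rat fps" where "psi = theta {0..} (\<lambda>_. 1) tri"
definition jacobi :: "rat fps" where "jacobi = theta {0..} (\<lambda>k. alt_sign k * of_int (2 * k + 1)) tri"

lemma theta_tri_fold: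
  assumes "\<And>k. w (- 1 - k) = w k"
  shows "theta UNIV w tri = 2 * theta {0..} w tri"
proof -
  have U: "UNIV = {0..} \<union> {..<(0::int)}" by auto
  have "theta UNIV w tri = theta {0..} w tri + theta {..<0} w tri"
    unfolding U by (intro theta_union finite_fibers_mono[OF fin_tri]) auto
  also have "theta {..<0} w tri = theta {0..} w tri"
  proof (rule theta_reindex[where h = "\<lambda>k. - 1 - k"])
    show "bij_betw (\<lambda>k. - 1 - k) {..<0} {0 :: int..}"
      by (rule bij_betwI[where g = "\<lambda>k. - 1 - k"]) auto
  qed (simp_all add: assms tri_reflect)
  finally show ?thesis by simp
qed

lemma psi_doubled_psi: "psi_doubled = 2 * psi"
  unfolding psi_doubled_def psi_def by (rule theta_tri_fold) simp

lemma jacobi_doubled_jacobi: "jacobi_doubled = 2 * jacobi"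
  unfolding jacobi_doubled_def jacobi_def by (rule theta_tri_fold) (simp add: alt_sign_def algebra_simps)

lemma jacobi_eq: "jacobi = psi * phi_alt ^ 2"
  using jacobi_doubled_eq unfolding jacobi_doubled_jacobi psi_doubled_psi by (simp add: mult.assoc)

lemma psi_square: "psi ^ 2 = phi * at_power psi 2"
  using psi_doubled_square unfolding psi_doubled_psi by (simp add: at_power_mult power_mult_distrib)

text \<open>
  With \<open>t = q * h(q ^ 8)\<close>, where \<open>h\<close> is this quotient, two products of the Jacobi series with \<open>\<phi>\<close> and
  \<open>\<psi>\<close> become algebraic differentials \<open>t ^ s (1 - 16 t ^ 8) ^ a dt\<close>.  Everything is written in the variable \<open>q ^ 8\<close>, in
  which \<open>t ^ 8\<close> is \<open>fps_X * h ^ 8\<close>.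
\<close>

definition theta_quot :: "rat fps" where "theta_quot = psi * inverse phi"

lemma theta_quot_phi: "theta_quot * phi = psi"
  unfolding theta_quot_def by (simp add: mult.assoc inverse_mult_eq_1 theta_constants)

lemma psi_0: "fps_nth psi 0 = 1"
  using theta_constants(3) by (simp add: psi_doubled_psi)

lemma theta_quot_0: "fps_nth theta_quot 0 = 1"
proof -
  have "fps_nth (theta_quot * phi) 0 = 1" by (simp add: theta_quot_phi psi_0)
  thus ?thesis by (simp add: theta_constants)
qed

text \<open>
  The Wronskian of \<open>\<psi>(q ^ 2)\<close> and \<open>\<phi>\<close> is a logarithmic derivative of their quotient, and that
  quotient is \<open>h ^ 2\<close>.
\<close>

lemma theta_quot_derivative: "theta_quot + 8 * fps_XD theta_quot = theta_quot * phi_alt ^ 4"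
proof -
  define s where "s = at_power psi_doubled 2"
  have "psi_doubled ^ 2 = 4 * psi ^ 2" by (simp add: psi_doubled_psi power_mult_distrib)
  hence "phi * (2 * s) = phi * (4 * (phi * theta_quot ^ 2))"
    using psi_doubled_square unfolding s_def theta_quot_phi[symmetric] by Groebner_Basis.algebra
  moreover have pnz: "phi \<noteq> 0" using theta_constants(1) by auto
  ultimately have "2 * s = 4 * (phi * theta_quot ^ 2)" using mult_left_cancel by blast
  hence "2 * s = 2 * (2 * phi * theta_quot ^ 2)" by Groebner_Basis.algebra
  hence s: "s = 2 * phi * theta_quot ^ 2" by (metis mult_left_cancel zero_neq_numeral)
  have "bracket = 2 * phi ^ 2 * theta_quot * (theta_quot + 8 * fps_XD theta_quot)"
    unfolding bracket_def s_def[symmetric] s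
    by (simp add: fps_XD_mult fps_XD_power fps_XD_numeral) Groebner_Basis.algebra
  moreover have "bracket = 2 * phi ^ 2 * theta_quot * (theta_quot * phi_alt ^ 4)"
    unfolding bracket_eq s_def[symmetric] s by (simp add: power2_eq_square)
  moreover have "2 * phi ^ 2 * theta_quot \<noteq> 0"
  proof -
    have "fps_nth (2 * phi ^ 2 * theta_quot) 0 \<noteq> 0" by (simp add: theta_constants theta_quot_0 fps_power_zeroth)
    thus ?thesis by auto
  qed
  ultimately show ?thesis by (metis mult_left_cancel)
qed

lemma discriminant_at_theta_quot: "phi ^ 4 * (1 - 16 * (fps_X * theta_quot ^ 8)) = phi_alt ^ 4"
proof -
  have "phi ^ 4 * (phi ^ 4 * (1 - 16 * (fps_X * theta_quot ^ 8))) = phi ^ 8 - 16 * fps_X * (theta_quot * phi) ^ 8"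
    by Groebner_Basis.algebra
  also have "\<dots> = phi ^ 8 - 16 * fps_X * (psi ^ 2) ^ 4" by (simp add: theta_quot_phi flip: power_mult)
  also have "\<dots> = phi ^ 8 - phi ^ 4 * (fps_X * at_power psi_doubled 2 ^ 4)"
    unfolding psi_square psi_doubled_psi by (simp add: at_power_mult power_mult_distrib)
  also have "\<dots> = phi ^ 4 * phi_alt ^ 4"
    unfolding phi_fourth_powers[symmetric] by Groebner_Basis.algebra
  finally have "phi ^ 4 * (phi ^ 4 * (1 - 16 * (fps_X * theta_quot ^ 8))) = phi ^ 4 * phi_alt ^ 4" .
  moreover have "phi ^ 4 \<noteq> 0" using theta_constants(1) by auto
  ultimately show ?thesis using mult_left_cancel by blast
qed

section \<open>Expansions in the theta quotient\<close>

text \<open>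
  The coefficients of \<open>(1 - 16 x) ^ (- b / 16)\<close>.
\<close>

definition inv_power_coeff :: "nat \<Rightarrow> nat \<Rightarrow> rat" where
  "inv_power_coeff b k = (\<Prod>i<k. of_nat (16 * i + b)) / fact k"

definition inv_power_series :: "nat \<Rightarrow> rat fps" where
  "inv_power_series b = Abs_fps (inv_power_coeff b)"

lemma inv_power_series_ODE: "(1 - 16 * fps_X) * fps_XD (inv_power_series b) = of_nat b * (fps_X * inv_power_series b)"
proof (rule fps_ext)
  fix n
  show "fps_nth ((1 - 16 * fps_X) * fps_XD (inv_power_series b)) n = fps_nth (of_nat b * (fps_X * inv_power_series b)) n"
  proof (cases n)
    case (Suc k)
    have "of_nat (Suc k) * inv_power_coeff b (Suc k) = of_nat (16 * k + b) * inv_power_coeff b k"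
      unfolding inv_power_coeff_def by (simp add: field_simps del: of_nat_Suc)
    thus ?thesis unfolding Suc
      by (simp add: ring_distribs mult.assoc fps_coeff_simps inv_power_series_def)
  qed (simp add: ring_distribs mult.assoc fps_coeff_simps)
qed

lemma fps_XD_eq_0:
  fixes f :: "rat fps"
  assumes "fps_XD f = 0" shows "f = fps_const (fps_nth f 0)"
proof (rule fps_ext)
  fix n
  have "of_nat n * fps_nth f n = 0" using arg_cong[OF assms, of "\<lambda>f. fps_nth f n"]
    by (simp add: fps_XD_def fps_mult_fps_X_deriv_shift)
  thus "fps_nth f n = fps_nth (fps_const (fps_nth f 0)) n" by auto
qed

lemma inv_power_coeff_0: "inv_power_coeff b 0 = 1"
  by (simp add: inv_power_coeff_def)

lemma inverse_sqrt_series: "inv_power_series 8 ^ 2 * (1 - 16 * fps_X) ^ 1 = 1"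
proof -
  define W c where "W = inv_power_series 8" and "c = (1 - 16 * fps_X :: rat fps)"
  have ode: "c * fps_XD W = 8 * (fps_X * W)"
    using inv_power_series_ODE[of 8] by (simp add: W_def c_def)
  have Dc: "fps_XD c = - 16 * fps_X" by (simp add: c_def fps_XD_simps)
  have "fps_XD (W ^ 2 * c ^ 1) = 2 * W * (c * fps_XD W) - 16 * fps_X * W ^ 2"
    by (simp add: fps_XD_mult fps_XD_power Dc)
  also have "\<dots> = 0" unfolding ode by Groebner_Basis.algebra
  finally have "W ^ 2 * c ^ 1 = fps_const (fps_nth (W ^ 2 * c ^ 1) 0)"
    by (rule fps_XD_eq_0)
  also have "fps_nth (W ^ 2 * c ^ 1) 0 = 1"
    by (simp add: W_def c_def inv_power_series_def fps_power_zeroth inv_power_coeff_0)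
  finally show ?thesis by (simp add: W_def c_def)
qed

lemma inverse_three_quarter_power_series: "inv_power_series 12 ^ 4 * (1 - 16 * fps_X) ^ 3 = 1"
proof -
  define W c where "W = inv_power_series 12" and "c = (1 - 16 * fps_X :: rat fps)"
  have ode: "c * fps_XD W = 12 * (fps_X * W)"
    using inv_power_series_ODE[of 12] by (simp add: W_def c_def)
  have Dc: "fps_XD c = - 16 * fps_X" by (simp add: c_def fps_XD_simps)
  have "fps_XD (W ^ 4 * c ^ 3) = 4 * W ^ 3 * c ^ 2 * (c * fps_XD W) - 48 * fps_X * c ^ 2 * W ^ 4"
    by (simp add: fps_XD_mult fps_XD_power Dc) Groebner_Basis.algebra
  also have "\<dots> = 0" unfolding ode by Groebner_Basis.algebra
  finally have "W ^ 4 * c ^ 3 = fps_const (fps_nth (W ^ 4 * c ^ 3) 0)"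
    by (rule fps_XD_eq_0)
  also have "fps_nth (W ^ 4 * c ^ 3) 0 = 1"
    by (simp add: W_def c_def inv_power_series_def fps_power_zeroth inv_power_coeff_0)
  finally show ?thesis by (simp add: W_def c_def)
qed

text \<open>
  At \<open>x = fps_X * theta_quot ^ 8\<close> the discriminant formula gives
  \<open>(1 - 16 x) ^ (- 1/2) = phi ^ 2 / phi_alt ^ 2\<close>; what remains is a product identity, by the derivative
  formula and Jacobi's formula.
\<close>

lemma jacobi_phi_expansion: "(inv_power_series 8 oo fps_X * theta_quot ^ 8) * (theta_quot + 8 * fps_XD theta_quot) = jacobi * phi"
proof -
  define x where "x = fps_X * theta_quot ^ 8"
  define W where "W = inv_power_series 8 oo x"
  have x0: "fps_nth x 0 = 0" by (simp add: x_def)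
  have "W ^ 2 * (1 - 16 * x) = 1"
    using arg_cong[OF inverse_sqrt_series, of "\<lambda>f. f oo x"]
    by (simp add: W_def fps_compose_mult_distrib fps_compose_sub_distrib x0 flip: fps_compose_power[OF x0])
  hence "phi ^ 4 * (W ^ 2 * (1 - 16 * x)) = phi ^ 4" by simp
  hence "W ^ 2 * (phi ^ 4 * (1 - 16 * x)) = phi ^ 4" by (simp only: mult.left_commute)
  hence "W ^ 2 * phi_alt ^ 4 = phi ^ 4" unfolding x_def discriminant_at_theta_quot .
  hence "(W * phi_alt ^ 2) ^ 2 = (phi ^ 2) ^ 2" by (simp add: power_mult_distrib flip: power_mult)
  hence W: "W * phi_alt ^ 2 = phi ^ 2"
    by (rule fps_square_unique)
      (simp_all add: W_def inv_power_series_def inv_power_coeff_0 theta_constants fps_power_zeroth)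
  have "W * (theta_quot + 8 * fps_XD theta_quot) = (W * phi_alt ^ 2) * phi_alt ^ 2 * theta_quot"
    unfolding theta_quot_derivative by Groebner_Basis.algebra
  also have "\<dots> = (theta_quot * phi) * phi_alt ^ 2 * phi" unfolding W by Groebner_Basis.algebra
  also have "\<dots> = jacobi * phi" by (simp add: theta_quot_phi jacobi_eq)
  finally show ?thesis by (simp add: W_def x_def)
qed

text \<open>
  As before, with \<open>(1 - 16 x) ^ (- 3/4) = phi ^ 3 / phi_alt ^ 3\<close>.
\<close>

lemma jacobi_psi_expansion:
  "(inv_power_series 12 oo fps_X * theta_quot ^ 8) * (theta_quot ^ 2 * (theta_quot + 8 * fps_XD theta_quot)) = at_power jacobi 2 * psi"
proof -
  define x where "x = fps_X * theta_quot ^ 8"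
  define W where "W = inv_power_series 12 oo x"
  have x0: "fps_nth x 0 = 0" by (simp add: x_def)
  have "W ^ 4 * (1 - 16 * x) ^ 3 = 1"
    using arg_cong[OF inverse_three_quarter_power_series, of "\<lambda>f. f oo x"]
    by (simp add: W_def fps_compose_mult_distrib fps_compose_sub_distrib x0 flip: fps_compose_power[OF x0])
  hence "W ^ 4 * (phi ^ 4 * (1 - 16 * x)) ^ 3 = phi ^ 12"
    by (simp add: power_mult_distrib mult.left_commute flip: power_mult)
  hence "W ^ 4 * phi_alt ^ 12 = phi ^ 12" unfolding x_def discriminant_at_theta_quot by (simp flip: power_mult)
  hence "((W * phi_alt ^ 3) ^ 2) ^ 2 = ((phi ^ 3) ^ 2) ^ 2" by (simp add: power_mult_distrib flip: power_mult)
  hence "(W * phi_alt ^ 3) ^ 2 = (phi ^ 3) ^ 2"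
    by (rule fps_square_unique)
      (simp_all add: W_def inv_power_series_def inv_power_coeff_0 theta_constants fps_power_zeroth)
  hence W: "W * phi_alt ^ 3 = phi ^ 3"
    by (rule fps_square_unique)
      (simp_all add: W_def inv_power_series_def inv_power_coeff_0 theta_constants fps_power_zeroth)
  have "W * (theta_quot ^ 2 * (theta_quot + 8 * fps_XD theta_quot)) = (W * phi_alt ^ 3) * phi_alt * theta_quot ^ 3"
    unfolding theta_quot_derivative by Groebner_Basis.algebra
  also have "\<dots> = psi ^ 2 * psi * phi_alt" unfolding W theta_quot_phi[symmetric] by Groebner_Basis.algebra
  also have "\<dots> = at_power psi 2 * (phi * phi_alt) * psi" unfolding psi_square by (simp only: mult_ac)
  also have "\<dots> = at_power jacobi 2 * psi"
    unfolding jacobi_eq phi_alt_at_2[symmetric] by (simp add: at_power_mult at_power_power del: power2_eq_square)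
  finally show ?thesis by (simp add: W_def x_def)
qed

definition int_series :: "rat fps set" where "int_series = {f. \<forall>n. fps_nth f n \<in> \<int>}"

lemma int_series_mult: "f \<in> int_series \<Longrightarrow> g \<in> int_series \<Longrightarrow> f * g \<in> int_series"
  by (auto simp: int_series_def fps_mult_nth intro!: Ints_sum)

lemma int_series_power: "f \<in> int_series \<Longrightarrow> f ^ k \<in> int_series"
  by (induction k) (simp add: int_series_def, simp add: int_series_mult)

lemma int_series_theta: "(\<And>i. i \<in> I \<Longrightarrow> w i \<in> \<int>) \<Longrightarrow> theta I w e \<in> int_series"
  by (auto simp: int_series_def theta_def intro!: Ints_sum)

lemma int_series_inverse:
  assumes "f \<in> int_series" "fps_nth f 0 = 1"
  shows "inverse f \<in> int_series"
proof -
  have fi: "f * inverse f = 1" using assms(2) by (simp add: inverse_mult_eq_1')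
  have "fps_nth (inverse f) n \<in> \<int>" for n
  proof (induction n rule: less_induct)
    case (less n)
    have "fps_nth (f * inverse f) n = fps_nth (inverse f) n + (\<Sum>i=1..n. fps_nth f i * fps_nth (inverse f) (n - i))"
      using assms(2) by (simp add: fps_mult_nth sum.atLeast_Suc_atMost)
    hence "fps_nth (inverse f) n = fps_nth 1 n - (\<Sum>i=1..n. fps_nth f i * fps_nth (inverse f) (n - i))"
      unfolding fi by simp
    moreover have "(\<Sum>i=1..n. fps_nth f i * fps_nth (inverse f) (n - i)) \<in> \<int>"
      using assms(1) less by (intro Ints_sum Ints_mult) (auto simp: int_series_def)
    ultimately show ?case by auto
  qed
  thus ?thesis by (simp add: int_series_def)
qed

lemma theta_quot_int: "theta_quot \<in> int_series"
  unfolding theta_quot_def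
  by (intro int_series_mult int_series_inverse)
    (auto simp: psi_def phi_def theta_constants[unfolded phi_def] intro: int_series_theta)

text \<open>
  For a series \<open>t = q + \<dots>\<close> with integral coefficients, the coefficient of \<open>q ^ (p - 1)\<close> in
  \<open>t ^ (n - 1) dt/dq\<close>, which is the derivative of \<open>t ^ n / n\<close>, is divisible by \<open>p\<close> if \<open>n < p\<close> and equals 1
  if \<open>n = p\<close>.  Hence a change of variables preserves the coefficient of index \<open>p - 1\<close> of a differential
  modulo \<open>p\<close>.  Here \<open>n\<close> runs through \<open>8 k + s + 1\<close>.  The factor \<open>fact m\<close> clears the denominators of the
  coefficients of the binomial series.
\<close>

lemma coefficient_congruence:
  fixes s m p b :: nat
  assumes p: "prime p" and pm: "p = 8 * m + s + 1"
  assumes K: "fps_nth ((inv_power_series b oo fps_X * theta_quot ^ 8) * (theta_quot ^ s * (theta_quot + 8 * fps_XD theta_quot))) m = of_int K"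
  shows "[fact m * K = (\<Prod>i<m. int (16 * i + b))] (mod int p)"
proof -
  define g where "g k = theta_quot ^ (8 * k + s) * (theta_quot + 8 * fps_XD theta_quot)" for k
  \<comment> \<open>With t as above, g k stands for t ^ (8 k + s) dt and the right-hand side for the derivative of t ^ (8 k + s + 1).\<close>
  have g_eq: "of_nat (8 * k + s + 1) * g k = of_nat (8 * k + s + 1) * theta_quot ^ (8 * k + s + 1) + 8 * fps_XD (theta_quot ^ (8 * k + s + 1))" for k
  proof -
    define N P where "N = (of_nat (8 * k + s + 1) :: rat fps)" and "P = theta_quot ^ (8 * k + s)"
    have a: "fps_XD (theta_quot ^ (8 * k + s + 1)) = N * fps_XD theta_quot * P"
      unfolding N_def P_def by (subst fps_XD_power) simp
    have b: "theta_quot ^ (8 * k + s + 1) = theta_quot * P" by (simp add: P_def)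
    show ?thesis unfolding a unfolding b g_def N_def[symmetric] P_def[symmetric]
      by (simp add: algebra_simps)
  qed
  have g_int: "g k \<in> int_series" for k
  proof -
    have "theta_quot + 8 * fps_XD theta_quot \<in> int_series"
      using theta_quot_int by (simp add: int_series_def fps_XD_def numeral_fps_const)
    thus ?thesis unfolding g_def by (intro int_series_mult int_series_power theta_quot_int)
  qed
  define x where "x = fps_X * theta_quot ^ 8"
  define v where "v = theta_quot ^ s * (theta_quot + 8 * fps_XD theta_quot)"
  have x0: "fps_nth x 0 = 0" by (simp add: x_def)
  have xk: "x ^ k * v = fps_X ^ k * g k" for k
    unfolding x_def v_def g_def power_mult_distrib power_add power_mult[of theta_quot 8 k] by (simp only: mult_ac)
  have "of_int K = (\<Sum>i\<le>m. (\<Sum>k\<le>i. inv_power_coeff b k * fps_nth (x ^ k) i) * fps_nth v (m - i))"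
    unfolding K[symmetric] v_def[symmetric] x_def[symmetric]
    by (simp add: fps_mult_nth fps_compose_nth inv_power_series_def atLeast0AtMost)
  also have "\<dots> = (\<Sum>i\<le>m. (\<Sum>k\<le>m. inv_power_coeff b k * fps_nth (x ^ k) i) * fps_nth v (m - i))"
    by (intro sum.cong refl arg_cong2[where f = "(*)"] sum.mono_neutral_left)
      (auto simp: fps_power_nth_eq_0[OF x0])
  also have "\<dots> = (\<Sum>k\<le>m. inv_power_coeff b k * fps_nth (x ^ k * v) m)"
    unfolding fps_mult_nth sum_distrib_left sum_distrib_right atLeast0AtMost
    by (subst sum.swap) (simp only: mult.assoc)
  also have "\<dots> = (\<Sum>k\<le>m. inv_power_coeff b k * fps_nth (g k) (m - k))"
    unfolding xk by (intro sum.cong refl) (simp add: fps_X_power_mult_nth)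
  finally have sum: "of_int K = (\<Sum>k\<le>m. inv_power_coeff b k * fps_nth (g k) (m - k))" .
  define G where "G k = \<lfloor>fps_nth (g k) (m - k)\<rfloor>" for k
  have G: "fps_nth (g k) (m - k) = of_int (G k)" for k
    using g_int[of k] by (simp add: G_def int_series_def)
  have G_dvd: "int p dvd G k" if "k < m" for k
  proof -
    define Y where "Y = theta_quot ^ (8 * k + s + 1)"
    define H where "H = fps_nth Y (m - k)"
    have "H \<in> \<int>" using int_series_power[OF theta_quot_int, of "8 * k + s + 1"] unfolding H_def Y_def int_series_def by blast
    then obtain I where I: "H = of_int I" by (auto elim: Ints_cases)
    have "fps_nth (of_nat (8 * k + s + 1) * g k) (m - k) = of_nat (8 * k + s + 1) * H + 8 * (of_nat (m - k) * H)"
      unfolding g_eq Y_def[symmetric] unfolding H_def fps_of_nat[symmetric] numeral_fps_const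
      by (simp add: fps_XD_def fps_mult_fps_X_deriv_shift)
    hence "of_nat (8 * k + s + 1) * of_int (G k) = of_nat (8 * k + s + 1) * H + 8 * (of_nat (m - k) * H)"
      unfolding fps_of_nat[symmetric] by (simp add: G)
    also have "\<dots> = of_nat p * H" using that unfolding pm by (simp add: of_nat_diff algebra_simps)
    finally have "(of_int (int (8 * k + s + 1) * G k) :: rat) = of_int (int p * I)" unfolding I by simp
    hence "int (8 * k + s + 1) * G k = int p * I" by (simp only: of_int_eq_iff)
    hence "int p dvd int (8 * k + s + 1) * G k" by simp
    moreover have "\<not> int p dvd int (8 * k + s + 1)"
      using that pm by (simp only: int_dvd_int_iff) (intro nat_dvd_not_less; simp)
    ultimately show ?thesis using p by (simp add: prime_dvd_mult_iff)
  qed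
  define C where "C k = (\<Prod>i<k. int (16 * i + b)) * int (fact m div fact k)" for k
  have C: "fact m * inv_power_coeff b k = of_int (C k)" if "k \<le> m" for k
  proof -
    have "(of_nat (fact m div fact k) :: rat) = fact m / fact k"
    proof -
      have "fact k dvd (fact m :: nat)" using that by (rule fact_dvd)
      then obtain j where j: "fact m = fact k * (j :: nat)" by (elim dvdE)
      have "(fact m :: rat) = of_nat (fact k * j)" unfolding j[symmetric] by simp
      thus ?thesis by (simp add: j)
    qed
    thus ?thesis by (simp add: C_def inv_power_coeff_def of_nat_prod)
  qed
  have "(of_int (fact m * K) :: rat) = (\<Sum>k\<le>m. (fact m * inv_power_coeff b k) * fps_nth (g k) (m - k))"
    by (simp add: sum sum_distrib_left mult.assoc)
  also have "\<dots> = (\<Sum>k\<le>m. of_int (C k * G k))" by (intro sum.cong refl) (simp add: C G)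
  also have "\<dots> = of_int (\<Sum>k\<le>m. C k * G k)" by simp
  finally have "fact m * K = (\<Sum>k\<le>m. C k * G k)" by (simp only: of_int_eq_iff)
  also have "[\<dots> = (\<Sum>k\<le>m. if k = m then C m * G m else 0)] (mod int p)"
    using G_dvd by (intro cong_sum) (auto simp: cong_0_iff)
  also have "(\<Sum>k\<le>m. if k = m then C m * G m else 0) = C m * G m" by simp
  also have "C m * G m = (\<Prod>i<m. int (16 * i + b))"
    by (simp add: C_def G_def g_def theta_quot_0 fps_power_zeroth fps_XD_def)
  finally show ?thesis .
qed

section \<open>Representations by x^2 + 2 y^2 and central binomial coefficients\<close>

text \<open>
  Composing the two representations in both ways gives \<open>p ^ 2 = r ^ 2 + 2 t ^ 2\<close> with \<open>t = x b \<mp> y a\<close>.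
  The product of the two values of \<open>t\<close> is divisible by \<open>p\<close>, and a nonzero multiple of \<open>p\<close> is too large.
\<close>

lemma representation_unique:
  fixes x y a b :: int
  assumes p: "prime p" and 1: "int p = x ^ 2 + 2 * y ^ 2" and 2: "int p = a ^ 2 + 2 * b ^ 2"
  shows "x ^ 2 = a ^ 2 \<and> y ^ 2 = b ^ 2"
proof -
  have p0: "int p > 0" using prime_gt_0_nat[OF p] by simp
  have id1: "(x * a + 2 * y * b) ^ 2 + 2 * (x * b - y * a) ^ 2 = int p ^ 2"
    unfolding power2_eq_square[of "int p"] by (subst 1, subst 2) Groebner_Basis.algebra
  have id2: "(x * a - 2 * y * b) ^ 2 + 2 * (x * b + y * a) ^ 2 = int p ^ 2"
    unfolding power2_eq_square[of "int p"] by (subst 1, subst 2) Groebner_Basis.algebra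
  have small: "t = 0" if "int p dvd t" "r ^ 2 + 2 * t ^ 2 = int p ^ 2" for r t
  proof (rule ccontr)
    assume "t \<noteq> 0"
    have "int p \<le> \<bar>t\<bar>" using dvd_imp_le_int[OF \<open>t \<noteq> 0\<close> that(1)] by simp
    hence "int p ^ 2 \<le> \<bar>t\<bar> ^ 2" using p0 by (intro power_mono) auto
    hence "2 * int p ^ 2 \<le> int p ^ 2" using that(2) zero_le_power2[of r] by (simp only: power2_abs)
    moreover have "int p ^ 2 > 0" using p0 by simp
    ultimately show False by linarith
  qed
  have "(x * b - y * a) * (x * b + y * a) = int p * b ^ 2 - int p * y ^ 2"
    using 1 2 by Groebner_Basis.algebra
  hence "int p dvd (x * b - y * a) * (x * b + y * a)" by simp
  hence "int p dvd (x * b - y * a) \<or> int p dvd (x * b + y * a)"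
    using p by (simp add: prime_dvd_mult_iff)
  hence "x * b - y * a = 0 \<or> x * b + y * a = 0" using small id1 id2 by blast
  hence "(x * b - y * a) * (x * b + y * a) = 0" by simp
  hence eq: "x ^ 2 * b ^ 2 = y ^ 2 * a ^ 2" by (simp add: power2_eq_square algebra_simps)
  hence "int p * x ^ 2 = int p * a ^ 2" using 1 2 by Groebner_Basis.algebra
  hence "x ^ 2 = a ^ 2" using p0 by simp
  thus ?thesis using 1 2 by simp
qed

definition int_alt_sign :: "int \<Rightarrow> int" where "int_alt_sign k = (if even k then 1 else - 1)"

lemma alt_sign_int: "alt_sign k = of_int (int_alt_sign k)"
  by (simp add: alt_sign_def int_alt_sign_def)

lemma int_alt_sign_square: "int_alt_sign k ^ 2 = 1"
  by (simp add: int_alt_sign_def)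

text \<open>
  Index sets of the coefficients of the two theta products.  They parametrise the representations
  of \<open>8 m + 1\<close> and \<open>8 m + 3\<close> by \<open>x ^ 2 + 2 y ^ 2\<close>, up to the signs of odd entries.
\<close>

definition reps_1_mod_8 :: "nat \<Rightarrow> (int \<times> int) set" where
  "reps_1_mod_8 m = {(k, z). k \<ge> 0 \<and> tri k + sq z = m}"

definition reps_3_mod_8 :: "nat \<Rightarrow> (int \<times> int) set" where
  "reps_3_mod_8 m = {(k, l). k \<ge> 0 \<and> l \<ge> 0 \<and> 2 * tri k + tri l = m}"

lemma reps_1_mod_8_iff: "(k, z) \<in> reps_1_mod_8 m \<longleftrightarrow> k \<ge> 0 \<and> int (8 * m + 1) = (2 * k + 1) ^ 2 + 2 * (2 * z) ^ 2"
proof -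
  have "(2 * k + 1) ^ 2 + 2 * (2 * z) ^ 2 = 4 * (2 * int (tri k)) + 8 * int (sq z) + 1"
    unfolding of_int_tri of_int_sq by (simp add: power2_eq_square algebra_simps)
  thus ?thesis unfolding reps_1_mod_8_def by auto
qed

lemma reps_3_mod_8_iff: "(k, l) \<in> reps_3_mod_8 m \<longleftrightarrow> k \<ge> 0 \<and> l \<ge> 0 \<and> int (8 * m + 3) = (2 * l + 1) ^ 2 + 2 * (2 * k + 1) ^ 2"
proof -
  have "(2 * l + 1) ^ 2 + 2 * (2 * k + 1) ^ 2 = 8 * (2 * int (tri k)) + 4 * (2 * int (tri l)) + 3"
    unfolding of_int_tri by (simp add: power2_eq_square algebra_simps)
  thus ?thesis unfolding reps_3_mod_8_def by auto
qed

lemma jacobi_phi_nth: "fps_nth (jacobi * phi) m = of_int (\<Sum>(k, z)\<in>reps_1_mod_8 m. int_alt_sign k * (2 * k + 1))"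
proof -
  have "jacobi * phi = theta ({0..} \<times> UNIV) (\<lambda>(k, z). alt_sign k * of_int (2 * k + 1) * 1) (\<lambda>(k, z). tri k + sq z)"
    unfolding jacobi_def phi_def by (intro theta_mult fin_sq finite_fibers_mono[OF fin_tri]) auto
  moreover have "{x. x \<in> {0..} \<times> UNIV \<and> (\<lambda>(k, z). tri k + sq z) x = m} = reps_1_mod_8 m"
    by (auto simp: reps_1_mod_8_def)
  ultimately show ?thesis
    by (simp add: theta_def alt_sign_int case_prod_unfold)
qed

lemma jacobi_psi_nth: "fps_nth (at_power jacobi 2 * psi) m = of_int (\<Sum>(k, l)\<in>reps_3_mod_8 m. int_alt_sign k * (2 * k + 1))"
proof -
  have "at_power jacobi 2 = theta {0..} (\<lambda>k. alt_sign k * of_int (2 * k + 1)) (\<lambda>k. 2 * tri k)"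
    unfolding jacobi_def by (rule theta_compose_power) simp
  hence "at_power jacobi 2 * psi = theta ({0..} \<times> {0..}) (\<lambda>(k, z). alt_sign k * of_int (2 * k + 1) * 1) (\<lambda>(k, l). 2 * tri k + tri l)"
    unfolding psi_def
    by (simp only:) (intro theta_mult finite_fibers_mono[OF fin_tri] finite_fibers_mono[OF finite_fibers_tri]; simp)
  moreover have "{x. x \<in> {0..} \<times> {0..} \<and> (\<lambda>(k, l). 2 * tri k + tri l) x = m} = reps_3_mod_8 m"
    by (auto simp: reps_3_mod_8_def)
  ultimately show ?thesis
    by (simp add: theta_def alt_sign_int case_prod_unfold)
qed

lemma odd_square_mod_8: "odd (x :: int) \<Longrightarrow> x ^ 2 mod 8 = 1"
proof -
  assume "odd x"
  then obtain k where x: "x = 2 * k + 1" by (elim oddE)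
  have "x ^ 2 = 4 * (k * (k + 1)) + 1" unfolding x by (simp add: power2_eq_square algebra_simps)
  moreover have "even (k * (k + 1))" by simp
  then obtain j where "k * (k + 1) = 2 * j" by (elim evenE)
  ultimately have "x ^ 2 = 1 + 8 * j" by simp
  thus ?thesis by simp
qed

lemma representation_parity:
  fixes x y :: int
  assumes "int (8 * m + s) = x ^ 2 + 2 * y ^ 2" "s = 1 \<or> s = 3"
  shows "odd x" "even y \<longleftrightarrow> s = 1"
proof -
  have "odd (int (8 * m + s))" using assms(2) by auto
  thus x: "odd x" unfolding assms(1) by simp
  show "even y \<longleftrightarrow> s = 1"
  proof (cases "even y")
    case True
    then obtain j where "y = 2 * j" by (elim evenE)
    hence "int s - x ^ 2 = 8 * (j ^ 2 - int m)" using assms(1) by (simp add: power2_eq_square algebra_simps)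
    moreover have "x ^ 2 = 8 * (x ^ 2 div 8) + 1" using odd_square_mod_8[OF x] mult_div_mod_eq[of 8 "x ^ 2"] by linarith
    ultimately have "int s - 1 = 8 * (j ^ 2 - int m + x ^ 2 div 8)"
      by Groebner_Basis.algebra
    hence "8 dvd int s - 1" by simp
    thus ?thesis using True assms(2) by auto
  next
    case False
    have "x ^ 2 = 8 * (x ^ 2 div 8) + 1" using odd_square_mod_8[OF x] mult_div_mod_eq[of 8 "x ^ 2"] by linarith
    moreover have "y ^ 2 = 8 * (y ^ 2 div 8) + 1" using odd_square_mod_8[OF False] mult_div_mod_eq[of 8 "y ^ 2"] by linarith
    ultimately have "int s - 3 = 8 * (x ^ 2 div 8 + 2 * (y ^ 2 div 8) - int m)" using assms(1) by simp
    hence "8 dvd int s - 3" by simp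
    thus ?thesis using False assms(2) by auto
  qed
qed

lemma odd_abs_half: "odd (x :: int) \<Longrightarrow> 2 * ((\<bar>x\<bar> - 1) div 2) + 1 = \<bar>x\<bar>"
proof -
  assume "odd x"
  hence "odd \<bar>x\<bar>" by simp
  then obtain c where "\<bar>x\<bar> = 2 * c + 1" by (elim oddE)
  thus ?thesis by simp
qed

lemma reps_1_mod_8_eq:
  assumes p: "prime (8 * m + 1)" and rep: "int (8 * m + 1) = x ^ 2 + 2 * y ^ 2"
  shows "reps_1_mod_8 m = {((\<bar>x\<bar> - 1) div 2, \<bar>y\<bar> div 2), ((\<bar>x\<bar> - 1) div 2, - (\<bar>y\<bar> div 2))}"
    and "\<bar>y\<bar> div 2 \<noteq> 0"
proof -
  have xo: "odd x" and ye: "even y" using representation_parity[of m 1 x y] rep by auto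
  define k where "k = (\<bar>x\<bar> - 1) div 2"
  define z where "z = \<bar>y\<bar> div 2"
  have k: "2 * k + 1 = \<bar>x\<bar>" unfolding k_def by (rule odd_abs_half[OF xo])
  have z: "2 * z = \<bar>y\<bar>" using ye unfolding z_def by simp
  have k0: "k \<ge> 0" using k abs_ge_zero[of x] by linarith
  show "\<bar>y\<bar> div 2 \<noteq> 0"
  proof
    assume "\<bar>y\<bar> div 2 = 0"
    hence "y = 0" using z unfolding z_def by simp
    hence "int (8 * m + 1) = int (nat \<bar>x\<bar> * nat \<bar>x\<bar>)"
      using rep by (simp add: power2_eq_square)
    hence "8 * m + 1 = nat \<bar>x\<bar> * nat \<bar>x\<bar>" by (simp only: of_nat_eq_iff)
    hence "nat \<bar>x\<bar> = 1" "8 * m + 1 = nat \<bar>x\<bar> * nat \<bar>x\<bar>"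
      using p prime_product[of "nat \<bar>x\<bar>" "nat \<bar>x\<bar>"] by auto
    thus False using p by simp
  qed
  show "reps_1_mod_8 m = {((\<bar>x\<bar> - 1) div 2, \<bar>y\<bar> div 2), ((\<bar>x\<bar> - 1) div 2, - (\<bar>y\<bar> div 2))}"
    unfolding k_def[symmetric] z_def[symmetric]
  proof (intro equalityI subsetI)
    fix t assume t: "t \<in> reps_1_mod_8 m"
    obtain i j where ij: "t = (i, j)" by (cases t)
    have i0: "i \<ge> 0" and r: "int (8 * m + 1) = (2 * i + 1) ^ 2 + 2 * (2 * j) ^ 2"
      using t by (simp_all add: ij reps_1_mod_8_iff)
    have "(2 * i + 1) ^ 2 = x ^ 2 \<and> (2 * j) ^ 2 = y ^ 2" by (rule representation_unique[OF p r rep])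
    hence "\<bar>2 * i + 1\<bar> = \<bar>x\<bar>" "\<bar>2 * j\<bar> = \<bar>y\<bar>" by (simp_all only: abs_eq_iff power2_eq_iff)
    hence "i = k" "j = z \<or> j = - z" using k z i0 by linarith+
    thus "t \<in> {(k, z), (k, - z)}" by (auto simp: ij)
  next
    fix t assume "t \<in> {(k, z), (k, - z)}"
    moreover have "(k, z) \<in> reps_1_mod_8 m" "(k, - z) \<in> reps_1_mod_8 m"
    proof -
      have "2 * - z = - \<bar>y\<bar>" using z by simp
      thus "(k, z) \<in> reps_1_mod_8 m" "(k, - z) \<in> reps_1_mod_8 m"
        unfolding reps_1_mod_8_iff rep using k0 by (simp_all only: k z power2_minus power2_abs simp_thms)
    qed
    ultimately show "t \<in> reps_1_mod_8 m" by auto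
  qed
qed

lemma reps_3_mod_8_eq:
  assumes p: "prime (8 * m + 3)" and rep: "int (8 * m + 3) = x ^ 2 + 2 * y ^ 2"
  shows "reps_3_mod_8 m = {((\<bar>y\<bar> - 1) div 2, (\<bar>x\<bar> - 1) div 2)}" "2 * ((\<bar>y\<bar> - 1) div 2) + 1 = \<bar>y\<bar>"
proof -
  have xo: "odd x" and yo: "odd y" using representation_parity[of m 3 x y] rep by auto
  define k where "k = (\<bar>y\<bar> - 1) div 2"
  define l where "l = (\<bar>x\<bar> - 1) div 2"
  have k: "2 * k + 1 = \<bar>y\<bar>" unfolding k_def by (rule odd_abs_half[OF yo])
  have l: "2 * l + 1 = \<bar>x\<bar>" unfolding l_def by (rule odd_abs_half[OF xo])
  have kl0: "k \<ge> 0" "l \<ge> 0" using k l abs_ge_zero[of x] abs_ge_zero[of y] by linarith+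
  show "2 * ((\<bar>y\<bar> - 1) div 2) + 1 = \<bar>y\<bar>" using k by (simp only: k_def)
  show "reps_3_mod_8 m = {((\<bar>y\<bar> - 1) div 2, (\<bar>x\<bar> - 1) div 2)}"
    unfolding k_def[symmetric] l_def[symmetric]
  proof (intro equalityI subsetI)
    fix t assume t: "t \<in> reps_3_mod_8 m"
    obtain i j where ij: "t = (i, j)" by (cases t)
    have i0: "i \<ge> 0" "j \<ge> 0" and r: "int (8 * m + 3) = (2 * j + 1) ^ 2 + 2 * (2 * i + 1) ^ 2"
      using t by (simp_all add: ij reps_3_mod_8_iff)
    have "(2 * j + 1) ^ 2 = x ^ 2 \<and> (2 * i + 1) ^ 2 = y ^ 2" by (rule representation_unique[OF p r rep])
    hence "\<bar>2 * j + 1\<bar> = \<bar>x\<bar>" "\<bar>2 * i + 1\<bar> = \<bar>y\<bar>" by (simp_all only: abs_eq_iff power2_eq_iff)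
    hence "i = k" "j = l" using k l i0 by linarith+
    thus "t \<in> {(k, l)}" by (auto simp: ij)
  next
    fix t assume "t \<in> {(k, l)}"
    moreover have "(k, l) \<in> reps_3_mod_8 m"
      unfolding reps_3_mod_8_iff rep using kl0 by (simp only: k l power2_abs simp_thms)
    ultimately show "t \<in> reps_3_mod_8 m" by auto
  qed
qed

lemma fact_double: "int (fact (2 * m)) = fact m * fact m * int ((2 * m) choose m)"
proof -
  have "fact m * fact m * ((2 * m) choose m) = (fact (2 * m) :: nat)"
    using binomial_fact_lemma[of m "2 * m"] by simp
  hence "int (fact (2 * m)) = int (fact m * fact m * ((2 * m) choose m))" by (simp only:)
  thus ?thesis by simp
qed

lemma prod_step_16_from_8: "(\<Prod>i<m. int (16 * i + 8)) = fact m * (4 ^ m * int ((2 * m) choose m))"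
proof -
  have "fact m * (\<Prod>i<m. int (16 * i + 8)) = 4 ^ m * int (fact (2 * m))" for m
  proof (induction m)
    case (Suc m)
    define P f F q where "P = (\<Prod>i<m. int (16 * i + 8))" and "f = (fact m :: int)" and "F = int (fact (2 * m))" and "q = (4 :: int) ^ m"
    have "f * P = q * F" using Suc by (simp only: P_def f_def F_def q_def)
    hence "((int m + 1) * f) * (P * (16 * int m + 8)) = (4 * q) * ((2 * int m + 2) * ((2 * int m + 1) * F))"
      by Groebner_Basis.algebra
    moreover have "int (fact (2 * Suc m)) = (2 * int m + 2) * ((2 * int m + 1) * F)"
      by (simp add: F_def algebra_simps)
    ultimately show ?case by (simp add: P_def f_def q_def add_ac)
  qed simp
  hence "fact m * (\<Prod>i<m. int (16 * i + 8)) = fact m * (fact m * (4 ^ m * int ((2 * m) choose m)))"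
    unfolding fact_double by simp
  thus ?thesis by simp
qed

text \<open>
  Modulo \<open>8 m + 3\<close> the factor \<open>16 i + 12\<close> is \<open>- 16 (2 m - i)\<close>.
\<close>

lemma prod_step_16_from_12_cong:
  assumes p: "p = 8 * m + 3"
  shows "[(\<Prod>i<m. int (16 * i + 12)) = fact m * ((- 16) ^ m * int ((2 * m) choose m))] (mod int p)"
proof -
  have "[(\<Prod>i<m. int (16 * i + 12)) = (\<Prod>i<m. - 16 * int (2 * m - i))] (mod int p)"
  proof (rule cong_prod)
    fix i assume "i \<in> {..<m}"
    hence "int (16 * i + 12) - (- 16 * int (2 * m - i)) = int p * 4"
      by (simp add: p of_nat_diff)
    thus "[int (16 * i + 12) = - 16 * int (2 * m - i)] (mod int p)"
      by (simp add: cong_iff_dvd_diff)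
  qed
  moreover have "(\<Prod>i<m. - 16 * int (2 * m - i)) = (- 16) ^ m * (\<Prod>i<m. int (2 * m - i))"
    by (simp only: prod.distrib prod_constant card_lessThan)
  moreover have "(\<Prod>i<m. int (2 * m - i)) = fact m * int ((2 * m) choose m)"
  proof -
    have tele: "(\<Prod>i<j. int (n - i)) * fact (n - j) = (fact n :: int)" if "j \<le> n" for j n
      using that
    proof (induction j)
      case (Suc j)
      have *: "int (n - j) * fact (n - Suc j) = (fact (n - j) :: int)"
      proof -
        have e: "n - j = Suc (n - Suc j)" using Suc.prems by simp
        show ?thesis unfolding e by simp
      qed
      show ?case unfolding prod.lessThan_Suc mult.assoc * by (rule Suc.IH) (use Suc.prems in simp)
    qed simp
    have "(\<Prod>i<m. int (2 * m - i)) * fact (2 * m - m) = (fact (2 * m) :: int)"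
      by (rule tele) simp
    moreover have "2 * m - m = m" by simp
    moreover have "(fact (2 * m) :: int) = int (fact (2 * m))" by simp
    ultimately have "fact m * (\<Prod>i<m. int (2 * m - i)) = fact m * (fact m * int ((2 * m) choose m))"
      unfolding fact_double by (simp only: mult_ac)
    thus ?thesis by (subst (asm) mult_left_cancel) simp_all
  qed
  ultimately show ?thesis by (simp only: mult.left_commute)
qed

lemma coprime_fact: "prime p \<Longrightarrow> m < p \<Longrightarrow> coprime (fact m :: int) (int p)"
proof -
  assume p: "prime p" and m: "m < p"
  have "coprime p (fact m)" using p m by (intro prime_imp_coprime) (simp_all add: prime_dvd_fact_iff)
  hence "coprime (int (fact m)) (int p)" unfolding coprime_int_iff by (simp only: coprime_commute)
  thus ?thesis by simp
qed

lemma not_dvd_central_binomial: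
  assumes "prime p" "2 * m < p"
  shows "\<not> int p dvd int ((2 * m) choose m)"
proof -
  have "\<not> p dvd fact (2 * m)" using assms by (simp add: prime_dvd_fact_iff)
  moreover have "fact m * fact m * ((2 * m) choose m) = (fact (2 * m) :: nat)"
    using binomial_fact_lemma[of m "2 * m"] by simp
  ultimately have "\<not> p dvd ((2 * m) choose m)" by (metis dvd_mult)
  thus ?thesis by simp
qed

lemma reps_1_mod_8_sum_cong:
  assumes p: "prime p" "p = 8 * m + 1"
  shows "[(\<Sum>(k, z)\<in>reps_1_mod_8 m. int_alt_sign k * (2 * k + 1)) = 4 ^ m * int ((2 * m) choose m)] (mod int p)"
proof -
  have "[fact m * (\<Sum>(k, z)\<in>reps_1_mod_8 m. int_alt_sign k * (2 * k + 1)) = (\<Prod>i<m. int (16 * i + 8))] (mod int p)"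
    by (rule coefficient_congruence[where s = 0])
      (use p in \<open>simp_all add: jacobi_phi_expansion jacobi_phi_nth\<close>)
  moreover have "coprime (fact m :: int) (int p)" by (rule coprime_fact[OF p(1)]) (simp add: p(2))
  ultimately show ?thesis unfolding prod_step_16_from_8 by (simp only: cong_mult_lcancel)
qed

lemma reps_3_mod_8_sum_cong:
  assumes p: "prime p" "p = 8 * m + 3"
  shows "[(\<Sum>(k, l)\<in>reps_3_mod_8 m. int_alt_sign k * (2 * k + 1)) = (- 16) ^ m * int ((2 * m) choose m)] (mod int p)"
proof -
  have "[fact m * (\<Sum>(k, l)\<in>reps_3_mod_8 m. int_alt_sign k * (2 * k + 1)) = (\<Prod>i<m. int (16 * i + 12))] (mod int p)"
    by (rule coefficient_congruence[where s = 2])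
      (use p in \<open>simp_all add: jacobi_psi_expansion jacobi_psi_nth\<close>)
  note cong_trans[OF this prod_step_16_from_12_cong[OF p(2)]]
  moreover have "coprime (fact m :: int) (int p)" by (rule coprime_fact[OF p(1)]) (simp add: p(2))
  ultimately show ?thesis by (simp only: cong_mult_lcancel)
qed

lemma not_dvd_power_2: "prime p \<Longrightarrow> p > 2 \<Longrightarrow> \<not> int p dvd (2 ^ k)"
  using prime_dvd_power[of "int p" 2 k] zdvd_imp_le[of "int p" 2] by auto

text \<open>
  Without a representation the coefficient of the theta product would vanish, but it is a unit
  times a central binomial coefficient.
\<close>

lemma representation_exists:
  assumes p: "prime p" and p8: "p mod 8 \<in> {1, 3}"
  shows "\<exists>x y :: int. int p = x ^ 2 + 2 * y ^ 2"
proof -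
  have p2: "p > 2"
  proof -
    have "p \<noteq> 2" using p8 by auto
    thus ?thesis using prime_ge_2_nat[OF p] by linarith
  qed
  define m where "m = p div 8"
  define C where "C = int ((2 * m) choose m)"
  have C: "\<not> int p dvd C" unfolding C_def
    by (rule not_dvd_central_binomial[OF p]) (use prime_gt_0_nat[OF p] in \<open>simp add: m_def\<close>)
  have ndvd: "\<not> int p dvd (2 ^ k) * C" for k
    using C not_dvd_power_2[OF p p2] p by (simp add: prime_dvd_mult_iff)
  consider "p = 8 * m + 1" | "p = 8 * m + 3"
  proof -
    have "p mod 8 = 1 \<or> p mod 8 = 3" using p8 by simp
    moreover have "p = 8 * m + p mod 8" unfolding m_def by simp
    ultimately show ?thesis using that by metis
  qed
  thus ?thesis
  proof cases
    case 1
    have "reps_1_mod_8 m \<noteq> {}"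
    proof
      assume "reps_1_mod_8 m = {}"
      hence "int p dvd 4 ^ m * C"
        using cong_sym[OF reps_1_mod_8_sum_cong[OF p 1]] by (simp add: C_def cong_0_iff)
      thus False using ndvd[of "2 * m"] by (simp add: power_mult)
    qed
    then obtain k z where "(k, z) \<in> reps_1_mod_8 m" by auto
    thus ?thesis unfolding reps_1_mod_8_iff 1 by blast
  next
    case 2
    have "reps_3_mod_8 m \<noteq> {}"
    proof
      assume "reps_3_mod_8 m = {}"
      hence "int p dvd (- 16) ^ m * C"
        using cong_sym[OF reps_3_mod_8_sum_cong[OF p 2]] by (simp add: C_def cong_0_iff)
      also have "(- 16) ^ m * C = (- 1) ^ m * (2 ^ (4 * m) * C)"
        by (simp add: power_mult flip: power_mult_distrib)
      finally show False using ndvd[of "4 * m"] by (simp add: uminus_power_if split: if_splits)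
    qed
    then obtain k z where "(k, z) \<in> reps_3_mod_8 m" by auto
    thus ?thesis unfolding reps_3_mod_8_iff 2 by blast
  qed
qed

text \<open>
  The two representations that contribute to the coefficient differ by the sign of \<open>y\<close> and have
  the same weight \<open>\<plusminus> \<bar>x\<bar>\<close>; squaring removes the sign.
\<close>

lemma representation_central_binomial_1_mod_8:
  fixes x y :: int
  assumes p: "prime p" "p = 8 * m + 1" and rep: "int p = x ^ 2 + 2 * y ^ 2"
  shows "[4 * x ^ 2 = 16 ^ m * int ((2 * m) choose m) ^ 2] (mod int p)"
proof -
  define k where "k = (\<bar>x\<bar> - 1) div 2"
  define z where "z = \<bar>y\<bar> div 2"
  have "odd x" using representation_parity[of m 1 x y] rep p by auto
  hence k: "2 * k + 1 = \<bar>x\<bar>" unfolding k_def by (rule odd_abs_half)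
  have r: "reps_1_mod_8 m = {(k, z), (k, - z)}" and "z \<noteq> 0"
    using reps_1_mod_8_eq[of m x y] p rep unfolding k_def z_def by auto
  hence "(\<Sum>(k, z)\<in>reps_1_mod_8 m. int_alt_sign k * (2 * k + 1)) = 2 * (int_alt_sign k * \<bar>x\<bar>)"
    by (simp add: k)
  hence "[(2 * (int_alt_sign k * \<bar>x\<bar>)) ^ 2 = (4 ^ m * int ((2 * m) choose m)) ^ 2] (mod int p)"
    using cong_pow[OF reps_1_mod_8_sum_cong[OF p], of 2] by (simp only:)
  moreover have "(2 * (int_alt_sign k * \<bar>x\<bar>)) ^ 2 = 4 * x ^ 2"
    by (simp add: power_mult_distrib int_alt_sign_square)
  moreover have "(4 ^ m * int ((2 * m) choose m)) ^ 2 = 16 ^ m * int ((2 * m) choose m) ^ 2"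
    by (simp add: power_mult_distrib power_mult[symmetric] mult.commute[of m]) (simp add: power_mult)
  ultimately show ?thesis by (simp only:)
qed

lemma representation_central_binomial_3_mod_8:
  fixes x y :: int
  assumes p: "prime p" "p = 8 * m + 3" and rep: "int p = x ^ 2 + 2 * y ^ 2"
  shows "[y ^ 2 = 256 ^ m * int ((2 * m) choose m) ^ 2] (mod int p)"
proof -
  define k where "k = (\<bar>y\<bar> - 1) div 2"
  define l where "l = (\<bar>x\<bar> - 1) div 2"
  have r: "reps_3_mod_8 m = {(k, l)}" and k: "2 * k + 1 = \<bar>y\<bar>"
    using reps_3_mod_8_eq[of m x y] p rep unfolding k_def l_def by auto
  have "(\<Sum>(k, l)\<in>reps_3_mod_8 m. int_alt_sign k * (2 * k + 1)) = int_alt_sign k * \<bar>y\<bar>"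
    by (simp add: r k)
  hence "[(int_alt_sign k * \<bar>y\<bar>) ^ 2 = ((- 16) ^ m * int ((2 * m) choose m)) ^ 2] (mod int p)"
    using cong_pow[OF reps_3_mod_8_sum_cong[OF p], of 2] by (simp only:)
  moreover have "(int_alt_sign k * \<bar>y\<bar>) ^ 2 = y ^ 2"
    by (simp add: power_mult_distrib int_alt_sign_square)
  moreover have "((- 16) ^ m * int ((2 * m) choose m)) ^ 2 = 256 ^ m * int ((2 * m) choose m) ^ 2"
    by (simp add: power_mult_distrib power_mult[symmetric] mult.commute[of m]) (simp add: power_mult)
  ultimately show ?thesis by (simp only:)
qed

section \<open>Reduction of the sums to the quartic series\<close>

text \<open>
  Divided by \<open>i!\<close> these are the coefficients of the Bessel function \<open>I\<^sub>0(2 x) = (\<Sum>j. x ^ (2 j) / j! ^ 2)\<close>.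
\<close>

definition bessel_coeff :: "nat \<Rightarrow> nat" where
  "bessel_coeff i = (if even i then i choose (i div 2) else 0)"

lemma one_plus_X_power_nth: "fps_nth ((1 + fps_X :: rat fps) ^ n) k = of_nat (n choose k)"
  by (simp add: binomial_gbinomial flip: fps_binomial_of_nat)

text \<open>
  Read off the coefficient of \<open>X ^ k\<close> in \<open>(1 + X) ^ (2 k) = ((1 + X ^ 2) + 2 X) ^ k\<close>.
\<close>

lemma central_binomial_expansion:
  "(2 * k) choose k = (\<Sum>i\<le>k. (k choose i) * 2 ^ (k - i) * bessel_coeff i)"
proof -
  have e: "fps_nth ((1 + fps_X ^ 2 :: rat fps) ^ i) i = of_nat (bessel_coeff i)" for i
  proof -
    have "(1 + fps_X ^ 2 :: rat fps) ^ i = (1 + fps_X) ^ i oo fps_X ^ 2"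
      by (simp add: fps_compose_add_distrib flip: fps_compose_power)
    thus ?thesis by (simp only: fps_compose_X_power_nth[OF zero_less_numeral] one_plus_X_power_nth bessel_coeff_def) auto
  qed
  have "(1 + fps_X :: rat fps) ^ (2 * k) = ((1 + fps_X ^ 2) + 2 * fps_X) ^ k"
    unfolding power_mult by (rule arg_cong[where f = "\<lambda>x. x ^ k"]) Groebner_Basis.algebra
  also have "\<dots> = (\<Sum>i\<le>k. of_nat (k choose i) * (1 + fps_X ^ 2) ^ i * (2 * fps_X) ^ (k - i))"
    by (rule binomial_ring)
  finally have "of_nat ((2 * k) choose k) =
     fps_nth (\<Sum>i\<le>k. of_nat (k choose i) * (1 + fps_X ^ 2 :: rat fps) ^ i * (2 * fps_X) ^ (k - i)) k"
    using one_plus_X_power_nth[of "2 * k" k] by simp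
  also have "\<dots> = (\<Sum>i\<le>k. of_nat (k choose i) * 2 ^ (k - i) * of_nat (bessel_coeff i))"
    unfolding fps_sum_nth
  proof (rule sum.cong[OF refl])
    fix i assume i: "i \<in> {..k}"
    have "of_nat (k choose i) * (1 + fps_X ^ 2 :: rat fps) ^ i * (2 * fps_X) ^ (k - i) =
       fps_const (of_nat (k choose i) * 2 ^ (k - i)) * (fps_X ^ (k - i) * (1 + fps_X ^ 2) ^ i)"
      by (simp add: power_mult_distrib numeral_fps_const fps_const_power mult_ac flip: fps_of_nat fps_const_mult)
    thus "fps_nth (of_nat (k choose i) * (1 + fps_X ^ 2 :: rat fps) ^ i * (2 * fps_X) ^ (k - i)) k =
       of_nat (k choose i) * 2 ^ (k - i) * of_nat (bessel_coeff i)"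
      using i by (simp only: fps_mult_left_const_nth fps_X_power_mult_nth) (simp add: e)
  qed
  also have "\<dots> = of_nat (\<Sum>i\<le>k. (k choose i) * 2 ^ (k - i) * bessel_coeff i)" by simp
  finally show ?thesis by (simp only: of_nat_eq_iff)
qed

definition egf :: "(nat \<Rightarrow> nat) \<Rightarrow> rat fps" where
  "egf a = Abs_fps (\<lambda>n. of_nat (a n) / fact n)"

lemma egf_mult: "egf a * egf b = egf (\<lambda>n. \<Sum>i\<le>n. (n choose i) * a i * b (n - i))"
proof (rule fps_ext)
  fix n
  have "fps_nth (egf a * egf b) n = (\<Sum>i\<le>n. of_nat (a i) / fact i * (of_nat (b (n - i)) / fact (n - i)))"
    by (simp add: egf_def fps_mult_nth atLeast0AtMost)
  also have "\<dots> = (\<Sum>i\<le>n. of_nat ((n choose i) * a i * b (n - i)) / fact n)"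
    by (intro sum.cong refl) (simp add: binomial_fact)
  also have "\<dots> = fps_nth (egf (\<lambda>n. \<Sum>i\<le>n. (n choose i) * a i * b (n - i))) n"
    by (simp add: egf_def sum_divide_distrib)
  finally show "fps_nth (egf a * egf b) n = fps_nth (egf (\<lambda>n. \<Sum>i\<le>n. (n choose i) * a i * b (n - i))) n" .
qed

lemma egf_inject:
  assumes "egf a = egf b" shows "a n = b n"
proof -
  have "fps_nth (egf a) n = fps_nth (egf b) n" by (simp only: assms)
  thus ?thesis by (simp add: egf_def)
qed

lemma egf_power: "egf (\<lambda>n. c ^ n) = fps_exp (of_nat c)"
  by (rule fps_ext) (simp add: egf_def)

text \<open>
  The coefficients of the square come from Vandermonde's \<open>(\<Sum>i\<le>r. (r choose i) ^ 2) = (2 r choose r)\<close>.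
\<close>

lemma egf_bessel_square: "egf bessel_coeff ^ 2 = egf (\<lambda>i. bessel_coeff i ^ 2)"
proof -
  define J :: "rat fps" where "J = Abs_fps (\<lambda>n. 1 / fact n ^ 2)"
  have 1: "egf bessel_coeff = J oo fps_X ^ 2"
  proof (rule fps_ext)
    fix n
    show "fps_nth (egf bessel_coeff) n = fps_nth (J oo fps_X ^ 2) n"
    proof (cases "even n")
      case True
      then obtain r where n: "n = 2 * r" by blast
      show ?thesis unfolding fps_compose_X_power_nth[OF zero_less_numeral]
        by (simp add: n egf_def bessel_coeff_def J_def binomial_fact power2_eq_square)
    qed (simp add: fps_compose_X_power_nth egf_def bessel_coeff_def del: power2_eq_square)
  qed
  have 2: "fps_nth (J ^ 2) r = of_nat ((2 * r) choose r) / fact r ^ 2" for r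
  proof -
    have "fps_nth (J ^ 2) r = (\<Sum>i\<le>r. 1 / fact i ^ 2 * (1 / fact (r - i) ^ 2))"
      by (simp add: J_def power2_eq_square[of "Abs_fps _"] fps_mult_nth atLeast0AtMost)
    also have "\<dots> = (\<Sum>i\<le>r. of_nat ((r choose i) ^ 2) / fact r ^ 2)"
      by (intro sum.cong refl) (simp add: binomial_fact power_divide power_mult_distrib)
    also have "\<dots> = of_nat (\<Sum>i\<le>r. (r choose i) ^ 2) / fact r ^ 2"
      by (simp add: sum_divide_distrib)
    finally show ?thesis by (simp only: choose_square_sum)
  qed
  have "egf bessel_coeff ^ 2 = J ^ 2 oo fps_X ^ 2"
    unfolding 1 by (rule fps_compose_power) simp
  also have "\<dots> = egf (\<lambda>i. bessel_coeff i ^ 2)"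
  proof (rule fps_ext)
    fix n
    show "fps_nth (J ^ 2 oo fps_X ^ 2) n = fps_nth (egf (\<lambda>i. bessel_coeff i ^ 2)) n"
    proof (cases "even n")
      case True
      then obtain r where n: "n = 2 * r" by blast
      show ?thesis unfolding fps_compose_X_power_nth[OF zero_less_numeral] 2
        by (simp add: n egf_def bessel_coeff_def 2 binomial_fact power2_eq_square)
    qed (simp add: fps_compose_X_power_nth egf_def bessel_coeff_def del: power2_eq_square)
  qed
  finally show ?thesis .
qed

text \<open>
  The exponential generating function of \<open>S\<close> is the square of that of the central binomial
  coefficients, which is \<open>exp (2 x) I\<^sub>0(2 x)\<close>; so it is \<open>exp (4 x) I\<^sub>0(2 x) ^ 2\<close>.
\<close>

lemma S_expansion: "S n = (\<Sum>i\<le>n. (n choose i) * 4 ^ (n - i) * bessel_coeff i ^ 2)"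
proof -
  have "egf (\<lambda>k. (2 * k) choose k) = egf bessel_coeff * egf (\<lambda>n. 2 ^ n)"
    unfolding egf_mult by (subst central_binomial_expansion) (simp only: mult_ac)
  hence "egf (\<lambda>k. (2 * k) choose k) * egf (\<lambda>k. (2 * k) choose k) =
      egf bessel_coeff ^ 2 * (fps_exp 2 * fps_exp 2)"
    by (simp add: egf_power power2_eq_square mult_ac)
  also have "fps_exp 2 * fps_exp 2 = (egf (\<lambda>n. 4 ^ n) :: rat fps)"
    by (simp add: egf_power flip: fps_exp_add_mult)
  finally have "egf (\<lambda>n. \<Sum>i\<le>n. (n choose i) * ((2 * i) choose i) * ((2 * (n - i)) choose (n - i))) =
      egf (\<lambda>n. \<Sum>i\<le>n. (n choose i) * bessel_coeff i ^ 2 * 4 ^ (n - i))"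
    unfolding egf_bessel_square egf_mult .
  note egf_inject[OF this, of n]
  moreover have "2 * n - 2 * i = 2 * (n - i)" for i by simp
  ultimately show ?thesis unfolding S_def by (simp only: mult.assoc mult.commute[of _ "4 ^ _"])
qed

text \<open>
  Both sides are \<open>(- 4) ^ k\<close> times a binomial coefficient, with upper entry \<open>- 1/2\<close> and \<open>(p - 1) / 2\<close>
  respectively, and these entries are congruent.
\<close>

lemma central_binomial_cong:
  assumes p: "prime p" "p > 2" and k: "k < p"
  shows "[int ((2 * k) choose k) = (- 4) ^ k * int (((p - 1) div 2) choose k)] (mod int p)"
  using k
proof (induction k)
  case (Suc k)
  define h where "h = (p - 1) div 2"
  have "odd p" using p prime_odd_nat by blast
  hence ph: "int p = 2 * int h + 1" using p(2) unfolding h_def by (elim oddE) simp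
  define B b D d where "B = int ((2 * Suc k) choose Suc k)" and "b = int ((2 * k) choose k)"
    and "D = int (h choose Suc k)" and "d = int (h choose k)"
  have B: "int (Suc k) * B = 2 * (2 * int k + 1) * b"
  proof -
    have "int (Suc k * ((2 * Suc k) choose Suc k)) = int (2 * (2 * k + 1) * ((2 * k) choose k))"
      by (simp only: central_binomial_Suc)
    thus ?thesis unfolding B_def b_def of_nat_mult by simp
  qed
  have D: "int (Suc k) * D = (int h - int k) * d"
  proof (cases "k \<le> h")
    case True
    have "int (Suc k * (h choose Suc k)) = int ((h - k) * (h choose k))"
      by (simp only: binomial_absorption binomial_absorb_comp)
    thus ?thesis unfolding D_def d_def of_nat_mult using True by (simp add: of_nat_diff)
  qed (simp add: D_def d_def binomial_eq_0)
  have IH: "[b = (- 4) ^ k * d] (mod int p)" using Suc by (simp add: b_def d_def h_def)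
  have 1: "[int (Suc k) * B = 2 * (2 * int k + 1) * ((- 4) ^ k * d)] (mod int p)"
    unfolding B by (intro cong_scalar_left IH)
  have 2: "[2 * (2 * int k + 1) * ((- 4) ^ k * d) = int (Suc k) * ((- 4) ^ Suc k * D)] (mod int p)"
  proof -
    have "int (Suc k) * ((- 4) ^ Suc k * D) = - 4 * (- 4) ^ k * (int (Suc k) * D)" by simp
    hence "2 * (2 * int k + 1) * ((- 4) ^ k * d) - int (Suc k) * ((- 4) ^ Suc k * D) = int p * (2 * ((- 4) ^ k * d))"
      unfolding D ph by (simp add: algebra_simps)
    thus ?thesis by (simp add: cong_iff_dvd_diff)
  qed
  have "coprime (int (Suc k)) (int p)"
  proof -
    have "\<not> p dvd Suc k" using Suc.prems by (simp add: nat_dvd_not_less)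
    hence "coprime p (Suc k)" using p(1) prime_imp_coprime by blast
    thus ?thesis unfolding coprime_int_iff by (simp only: coprime_commute)
  qed
  hence "[B = (- 4) ^ Suc k * D] (mod int p)"
    using cong_trans[OF 1 2] by (simp only: cong_mult_lcancel)
  thus ?case by (simp only: B_def D_def h_def)
qed simp

lemma binomial_transform:
  fixes x :: int
  shows "(\<Sum>k\<le>h. int (h choose k) * x ^ k * (\<Sum>i\<le>k. int (k choose i) * 4 ^ (k - i) * d i)) =
    (\<Sum>i\<le>h. int (h choose i) * x ^ i * (1 + 4 * x) ^ (h - i) * d i)"
proof -
  have "(\<Sum>k\<le>h. int (h choose k) * x ^ k * (\<Sum>i\<le>k. int (k choose i) * 4 ^ (k - i) * d i)) =
     (\<Sum>k\<le>h. int (h choose k) * x ^ k * (\<Sum>i\<le>h. int (k choose i) * 4 ^ (k - i) * d i))"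
    by (intro sum.cong refl arg_cong2[where f = "(*)"] sum.mono_neutral_left) (auto simp: binomial_eq_0)
  also have "\<dots> = (\<Sum>i\<le>h. \<Sum>k\<le>h. int (h choose k) * x ^ k * (int (k choose i) * 4 ^ (k - i) * d i))"
    unfolding sum_distrib_left by (rule sum.swap)
  also have "\<dots> = (\<Sum>i\<le>h. int (h choose i) * x ^ i * (1 + 4 * x) ^ (h - i) * d i)"
  proof (rule sum.cong[OF refl])
    fix i assume i: "i \<in> {..h}"
    have "(\<Sum>k\<le>h. int (h choose k) * x ^ k * (int (k choose i) * 4 ^ (k - i) * d i)) =
        (\<Sum>k\<in>{i..h}. int (h choose k) * x ^ k * (int (k choose i) * 4 ^ (k - i) * d i))"
      by (intro sum.mono_neutral_right) (auto simp: binomial_eq_0)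
    also have "\<dots> = (\<Sum>j\<le>h - i. int (h choose i) * x ^ i * d i * (int ((h - i) choose j) * (4 * x) ^ j))"
    proof (rule sum.reindex_bij_witness[of _ "\<lambda>j. j + i" "\<lambda>k. k - i"])
      fix k assume k: "k \<in> {i..h}"
      have "int (h choose k) * int (k choose i) = int (h choose i) * int ((h - i) choose (k - i))"
        using choose_mult[of i k h] k by (simp flip: of_nat_mult)
      moreover have "x ^ k = x ^ i * x ^ (k - i)" using k by (simp flip: power_add)
      ultimately show "int (h choose i) * x ^ i * d i * (int ((h - i) choose (k - i)) * (4 * x) ^ (k - i)) =
         int (h choose k) * x ^ k * (int (k choose i) * 4 ^ (k - i) * d i)"
        by (simp add: power_mult_distrib)
    qed (use i in auto)
    also have "\<dots> = int (h choose i) * x ^ i * d i * (4 * x + 1) ^ (h - i)"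
      unfolding binomial_ring[of "4 * x" 1] by (simp add: sum_distrib_left)
    finally show "(\<Sum>k\<le>h. int (h choose k) * x ^ k * (int (k choose i) * 4 ^ (k - i) * d i)) =
       int (h choose i) * x ^ i * (1 + 4 * x) ^ (h - i) * d i"
      by (simp add: mult_ac add_ac)
  qed
  finally show ?thesis .
qed

lemma quartic_coeff_bessel: "int (quartic_coeff r) = int (bessel_coeff (2 * r)) ^ 2 * int ((2 * (2 * r)) choose (2 * r))"
  by (simp add: quartic_coeff_def bessel_coeff_def)

text \<open>
  Apart from the power in front, \<open>M\<close> enters the resulting sum only through \<open>(M - 16) ^ 2\<close>, because the odd terms of
  the Bessel coefficients vanish.  This is why the two values of \<open>M\<close> in the theorem, 800 and -768, lead
  to the same sum.
\<close>

lemma S_sum_cong: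
  fixes M w c :: int
  assumes p: "prime p" "p > 2" and w: "[M * w = 1] (mod int p)" and M: "(M - 16) ^ 2 = c ^ 2"
  defines "h \<equiv> (p - 1) div 2"
  shows "[(\<Sum>k<p. int ((2 * k) choose k) * int (S k) * w ^ k) =
    w ^ h * ((M - 16) ^ (h mod 2) * (\<Sum>r\<le>h div 2. int (quartic_coeff r) * (c ^ 2) ^ (h div 2 - r)))] (mod int p)"
proof -
  define d where "d i = int (bessel_coeff i) ^ 2" for i
  have hp: "h < p" using p unfolding h_def by linarith
  have "[(\<Sum>k<p. int ((2 * k) choose k) * int (S k) * w ^ k) =
     (\<Sum>k<p. (- 4) ^ k * int (h choose k) * int (S k) * w ^ k)] (mod int p)"
    unfolding h_def by (intro cong_sum cong_scalar_right central_binomial_cong p) simp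
  also have "(\<Sum>k<p. (- 4) ^ k * int (h choose k) * int (S k) * w ^ k) =
      (\<Sum>k\<le>h. (- 4) ^ k * int (h choose k) * int (S k) * w ^ k)"
    using hp by (intro sum.mono_neutral_right) (auto simp: binomial_eq_0)
  also have "\<dots> = (\<Sum>k\<le>h. int (h choose k) * (- 4 * w) ^ k * (\<Sum>i\<le>k. int (k choose i) * 4 ^ (k - i) * d i))"
    by (intro sum.cong refl) (simp only: S_expansion d_def power_mult_distrib of_nat_sum of_nat_mult of_nat_power of_nat_numeral mult_ac)
  also have "\<dots> = (\<Sum>i\<le>h. int (h choose i) * (- 4 * w) ^ i * (1 + 4 * (- 4 * w)) ^ (h - i) * d i)"
    by (rule binomial_transform)
  also have "[\<dots> = (\<Sum>i\<le>h. w ^ h * (d i * int ((2 * i) choose i) * (M - 16) ^ (h - i)))] (mod int p)"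
  proof (rule cong_sum)
    fix i assume "i \<in> {..h}"
    hence i: "i \<le> h" by simp
    have "int (h choose i) * (- 4 * w) ^ i * (1 + 4 * (- 4 * w)) ^ (h - i) * d i =
       ((- 4) ^ i * int (h choose i)) * (w ^ i * (1 - 16 * w) ^ (h - i) * d i)"
      by (simp only: power_mult_distrib) (simp add: mult_ac)
    also have "[\<dots> = int ((2 * i) choose i) * (w ^ i * (M * w - 16 * w) ^ (h - i) * d i)] (mod int p)"
    proof (rule cong_mult)
      show "[(- 4) ^ i * int (h choose i) = int ((2 * i) choose i)] (mod int p)"
        unfolding h_def by (rule cong_sym, rule central_binomial_cong[OF p]) (use i hp in simp)
      show "[w ^ i * (1 - 16 * w) ^ (h - i) * d i = w ^ i * (M * w - 16 * w) ^ (h - i) * d i] (mod int p)"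
        by (intro cong_scalar_right cong_scalar_left cong_pow cong_diff cong_sym[OF w] cong_refl)
    qed
    also have "int ((2 * i) choose i) * (w ^ i * (M * w - 16 * w) ^ (h - i) * d i) =
       w ^ h * (d i * int ((2 * i) choose i) * (M - 16) ^ (h - i))"
    proof -
      have "w ^ h = w ^ i * w ^ (h - i)" using i by (simp flip: power_add)
      moreover have "(M * w - 16 * w) ^ (h - i) = (M - 16) ^ (h - i) * w ^ (h - i)"
        by (simp only: left_diff_distrib[symmetric] power_mult_distrib)
      ultimately show ?thesis by (simp only: mult_ac)
    qed
    finally show "[int (h choose i) * (- 4 * w) ^ i * (1 + 4 * (- 4 * w)) ^ (h - i) * d i =
       w ^ h * (d i * int ((2 * i) choose i) * (M - 16) ^ (h - i))] (mod int p)" .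
  qed
  also have "(\<Sum>i\<le>h. w ^ h * (d i * int ((2 * i) choose i) * (M - 16) ^ (h - i))) =
     w ^ h * (\<Sum>i\<le>h. d i * int ((2 * i) choose i) * (M - 16) ^ (h - i))"
    by (rule sum_distrib_left[symmetric])
  also have "(\<Sum>i\<le>h. d i * int ((2 * i) choose i) * (M - 16) ^ (h - i)) =
     (\<Sum>i\<in>(\<lambda>r. 2 * r) ` {..h div 2}. d i * int ((2 * i) choose i) * (M - 16) ^ (h - i))"
  proof (rule sum.mono_neutral_right)
    show "\<forall>i\<in>{..h} - (\<lambda>r. 2 * r) ` {..h div 2}. d i * int ((2 * i) choose i) * (M - 16) ^ (h - i) = 0"
    proof
      fix i assume i: "i \<in> {..h} - (\<lambda>r. 2 * r) ` {..h div 2}"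
      have "odd i"
      proof
        assume "even i"
        hence "i = 2 * (i div 2)" "i div 2 \<le> h div 2" using i by (auto intro: div_le_mono)
        thus False using i by blast
      qed
      thus "d i * int ((2 * i) choose i) * (M - 16) ^ (h - i) = 0"
        by (simp add: d_def bessel_coeff_def)
    qed
  qed auto
  also have "\<dots> = (\<Sum>r\<le>h div 2. int (quartic_coeff r) * (M - 16) ^ (h - 2 * r))"
    by (subst sum.reindex) (auto simp: inj_on_def quartic_coeff_bessel d_def)
  also have "\<dots> = (M - 16) ^ (h mod 2) * (\<Sum>r\<le>h div 2. int (quartic_coeff r) * (c ^ 2) ^ (h div 2 - r))"
    unfolding sum_distrib_left
  proof (rule sum.cong[OF refl])
    fix r assume "r \<in> {..h div 2}"
    moreover have "h = 2 * (h div 2) + h mod 2" by simp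
    ultimately have "h - 2 * r = h mod 2 + 2 * (h div 2 - r)" unfolding atMost_iff by linarith
    hence "(M - 16) ^ (h - 2 * r) = (M - 16) ^ (h mod 2) * ((M - 16) ^ 2) ^ (h div 2 - r)"
      by (simp only: power_add power_mult)
    thus "int (quartic_coeff r) * (M - 16) ^ (h - 2 * r) =
       (M - 16) ^ (h mod 2) * (int (quartic_coeff r) * (c ^ 2) ^ (h div 2 - r))"
      unfolding M by (simp only: mult_ac)
  qed
  finally show ?thesis .
qed

section \<open>Congruences between fractions\<close>

lemma p_integral_fraction:
  assumes "\<not> int p dvd b"
  shows "of_int a / of_int b \<in> p_integral p"
proof -
  obtain n d where nd: "quotient_of (of_int a / of_int b) = (n, d)" by (cases "quotient_of (of_int a / of_int b)")
  have b0: "b \<noteq> 0" using assms by auto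
  have d0: "d > 0" using quotient_of_denom_pos[OF nd] .
  have cop: "coprime n d" using quotient_of_coprime[OF nd] .
  have "of_int a / of_int b = (of_int n / of_int d :: rat)" using quotient_of_div[OF nd] .
  hence "(of_int (a * d) :: rat) = of_int (n * b)" using b0 d0 by (simp add: field_simps)
  hence "a * d = n * b" by (simp only: of_int_eq_iff)
  hence "d dvd n * b" by (metis dvd_triv_right)
  hence "d dvd b" using cop by (simp add: coprime_commute coprime_dvd_mult_right_iff)
  hence "\<not> int p dvd d" using assms dvd_trans by blast
  thus ?thesis by (simp add: p_integral_def nd)
qed

lemma rat_cong_fractions:
  assumes "\<not> int p dvd D" "\<not> int p dvd E" "prime p" and "[N * E = K * D] (mod int p)"
  shows "rat_cong (of_int N / of_int D) (of_int K / of_int E) p"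
proof -
  obtain j where j: "N * E - K * D = int p * j"
    using assms(4) by (auto simp: cong_iff_dvd_diff elim: dvdE)
  have nz: "D \<noteq> 0" "E \<noteq> 0" using assms by auto
  have "\<not> int p dvd D * E" using assms by (simp add: prime_dvd_mult_iff)
  hence c: "of_int j / of_int (D * E) \<in> p_integral p" by (rule p_integral_fraction)
  have "of_int N / of_int D - of_int K / of_int E = (of_int (N * E - K * D) / of_int (D * E) :: rat)"
    using nz by (simp add: field_simps)
  also have "\<dots> = of_nat p * (of_int j / of_int (D * E))" unfolding j by simp
  finally show ?thesis unfolding rat_cong_def
    using c p_integral_fraction[OF assms(1)] p_integral_fraction[OF assms(2)] by blast
qed

lemma fermat_int: "prime p \<Longrightarrow> \<not> int p dvd a \<Longrightarrow> [a ^ (p - 1) = 1] (mod int p)"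
proof -
  assume p: "prime p" and a: "\<not> int p dvd a"
  have p0: "int p > 0" using prime_gt_0_nat[OF p] by simp
  define b where "b = nat (a mod int p)"
  have b: "int b = a mod int p" using p0 by (simp add: b_def)
  have "\<not> p dvd b"
  proof
    assume "p dvd b"
    hence "int p dvd a mod int p" unfolding b[symmetric] by simp
    thus False using a by (simp add: dvd_mod_iff)
  qed
  hence "[b ^ (p - 1) = 1] (mod p)" by (rule fermat_theorem[OF p])
  hence "[int (b ^ (p - 1)) = int 1] (mod int p)" by (simp only: cong_int_iff)
  hence "[(a mod int p) ^ (p - 1) = 1] (mod int p)" by (simp add: b)
  moreover have "[a ^ (p - 1) = (a mod int p) ^ (p - 1)] (mod int p)"
    by (rule cong_pow) (simp add: cong_def)
  ultimately show ?thesis using cong_trans by blast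
qed

lemma inverse_mod_prime:
  assumes "prime p" "\<not> int p dvd a"
  obtains w where "[a * w = 1] (mod int p)"
proof -
  have "coprime (int p) a" using assms prime_imp_coprime[of "int p" a] by simp
  hence "coprime a (int p)" by (simp only: coprime_commute)
  thus ?thesis using that cong_solve_coprime_int by blast
qed

text \<open>
  Over the common denominator \<open>M ^ (p - 1) \<equiv> 1\<close> the numerator agrees with the sum in which \<open>1 / M\<close> is
  replaced by the inverse \<open>w\<close> modulo \<open>p\<close>.
\<close>

lemma truncated_sum_fraction:
  fixes M L w t :: int and a :: "nat \<Rightarrow> int"
  assumes p: "prime p" and M: "\<not> int p dvd M" and w: "[M * w = 1] (mod int p)"
    and t: "[L * (\<Sum>k<p. a k * w ^ k) = t] (mod int p)"
  obtains N where "of_int L * (\<Sum>k = 0..p - 1. of_int (a k) / of_int M ^ k) = (of_int N / of_int (M ^ (p - 1)) :: rat)"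
    and "[N = t] (mod int p)"
proof
  define N where "N = L * (\<Sum>k<p. a k * M ^ (p - 1 - k))"
  have M0: "M \<noteq> 0" using M by auto
  have set: "{0..p - 1} = {..<p}" using prime_gt_0_nat[OF p] by auto
  have "(\<Sum>k = 0..p - 1. of_int (a k) / of_int M ^ k) = (\<Sum>k<p. of_int (a k * M ^ (p - 1 - k)) / of_int (M ^ (p - 1)) :: rat)"
    unfolding set
  proof (rule sum.cong[OF refl])
    fix k assume "k \<in> {..<p}"
    hence "p - 1 = (p - 1 - k) + k" by simp
    hence "(of_int M :: rat) ^ (p - 1) = of_int M ^ (p - 1 - k) * of_int M ^ k"
      by (metis power_add)
    thus "of_int (a k) / of_int M ^ k = (of_int (a k * M ^ (p - 1 - k)) / of_int (M ^ (p - 1)) :: rat)"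
      using M0 by simp
  qed
  thus "of_int L * (\<Sum>k = 0..p - 1. of_int (a k) / of_int M ^ k) = (of_int N / of_int (M ^ (p - 1)) :: rat)"
    unfolding N_def of_int_mult[of L] of_int_sum
    by (simp only: sum_divide_distrib[symmetric] times_divide_eq_right)
  have "[L * (\<Sum>k<p. a k * M ^ (p - 1 - k)) = L * (\<Sum>k<p. a k * w ^ k)] (mod int p)"
  proof (intro cong_scalar_left cong_sum)
    fix k assume "k \<in> {..<p}"
    hence e: "p - 1 = (p - 1 - k) + k" by simp
    have "[M ^ (p - 1 - k) * 1 ^ k = M ^ (p - 1 - k) * (M * w) ^ k] (mod int p)"
      by (intro cong_scalar_left cong_pow cong_sym[OF w])
    moreover have "M ^ (p - 1 - k) * (M * w) ^ k = M ^ (p - 1) * w ^ k"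
      by (subst (2) e) (simp only: power_add power_mult_distrib mult.assoc)
    moreover have "[M ^ (p - 1) * w ^ k = 1 * w ^ k] (mod int p)"
      by (intro cong_scalar_right fermat_int p M)
    ultimately show "[M ^ (p - 1 - k) = w ^ k] (mod int p)"
      using cong_trans by (simp only: power_one mult_1_right mult_1_left) blast
  qed
  thus "[N = t] (mod int p)" unfolding N_def using t by (rule cong_trans)
qed

section \<open>Evaluation\<close>

text \<open>
  The common value of both sums modulo \<open>p\<close>.  It is \<open>784 ^ h\<close> times the quartic sum at \<open>1 / 784 ^ 2\<close> with
  \<open>h = (p - 1) / 2\<close>, written without division so that \<open>p = 7\<close>, a divisor of 784, is included.
\<close>

definition quartic_value :: "nat \<Rightarrow> int" where
  "quartic_value p = (let h = (p - 1) div 2 in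
     784 ^ (h mod 2) * (\<Sum>r\<le>h div 2. int (quartic_coeff r) * (784 ^ 2) ^ (h div 2 - r)))"

lemma Legendre_power: "prime p \<Longrightarrow> p > 2 \<Longrightarrow> [Legendre a (int p) = a ^ ((p - 1) div 2)] (mod int p)"
  using euler_criterion[of "nat (int p)" a] by simp

text \<open>
  Apart from squares, \<open>M\<close> is \<open>q\<close>, so that the Legendre symbol cancels \<open>w ^ ((p - 1) / 2)\<close>.  The sign \<open>e\<close> of
  \<open>M - 16\<close> occurs to the power \<open>(p - 1) / 2\<close>, up to an even number, and is absorbed into the symbol: this
  turns the symbol of -3 into that of 3.
\<close>

lemma legendre_S_sum_cong:
  fixes M q c w :: int
  assumes p: "prime p" "p > 2" and w: "[M * w = 1] (mod int p)" and M: "\<not> int p dvd M"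
    and Mc: "M = q * c ^ 2" and M16: "(M - 16) = e * 784" and e: "e = 1 \<or> e = - 1"
  shows "[Legendre (e * q) (int p) * (\<Sum>k<p. int ((2 * k) choose k) * int (S k) * w ^ k) = quartic_value p] (mod int p)"
proof -
  define h where "h = (p - 1) div 2"
  define V where "V = (\<Sum>r\<le>h div 2. int (quartic_coeff r) * (784 ^ 2) ^ (h div 2 - r))"
  have "odd p" using p prime_odd_nat by blast
  hence hp: "2 * h = p - 1" unfolding h_def by (elim oddE) simp
  have "(M - 16) ^ 2 = 784 ^ 2" using M16 e by auto
  from S_sum_cong[OF p w this]
  have "[(\<Sum>k<p. int ((2 * k) choose k) * int (S k) * w ^ k) = w ^ h * ((M - 16) ^ (h mod 2) * V)] (mod int p)"
    unfolding h_def V_def .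
  hence "[Legendre (e * q) (int p) * (\<Sum>k<p. int ((2 * k) choose k) * int (S k) * w ^ k) =
      (e * q) ^ h * (w ^ h * ((M - 16) ^ (h mod 2) * V))] (mod int p)"
    using Legendre_power[OF p, of "e * q"] unfolding h_def by (intro cong_mult)
  also have "(e * q) ^ h * (w ^ h * ((M - 16) ^ (h mod 2) * V)) = (q * w) ^ h * (784 ^ (h mod 2) * V)"
  proof -
    have "e ^ h * e ^ (h mod 2) = 1"
      using e by (cases "even h") (auto simp: even_iff_mod_2_eq_zero odd_iff_mod_2_eq_one)
    moreover have "(e * q) ^ h * (w ^ h * ((M - 16) ^ (h mod 2) * V)) =
        (e ^ h * e ^ (h mod 2)) * ((q * w) ^ h * (784 ^ (h mod 2) * V))"
      unfolding M16 power_mult_distrib by (simp only: mult_ac)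
    ultimately show ?thesis by simp
  qed
  also have "[(q * w) ^ h * (784 ^ (h mod 2) * V) = 1 * (784 ^ (h mod 2) * V)] (mod int p)"
  proof (rule cong_scalar_right)
    have "\<not> int p dvd c"
    proof
      assume "int p dvd c"
      hence "int p dvd M" unfolding Mc by (simp add: power2_eq_square)
      thus False using M by simp
    qed
    hence c: "[c ^ (2 * h) = 1] (mod int p)" unfolding hp by (rule fermat_int[OF p(1)])
    have "[(q * w) ^ h * 1 = (q * w) ^ h * c ^ (2 * h)] (mod int p)"
      by (intro cong_scalar_left cong_sym[OF c])
    moreover have "(q * w) ^ h * c ^ (2 * h) = (M * w) ^ h"
      unfolding Mc power_mult power_mult_distrib by (simp only: mult_ac)
    moreover have "[(M * w) ^ h = 1 ^ h] (mod int p)" by (intro cong_pow w)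
    ultimately show "[(q * w) ^ h = 1] (mod int p)"
      using cong_trans by (simp only: power_one mult_1_right) blast
  qed
  finally show ?thesis by (simp add: quartic_value_def h_def V_def Let_def)
qed

lemma quartic_value_at_28:
  assumes p: "prime p" "p > 7" and v: "[784 * v = 1] (mod int p)"
  shows "[quartic_value p = (\<Sum>r\<le>p div 4. int (quartic_coeff r) * (v ^ 2) ^ r)] (mod int p)"
proof -
  define h where "h = (p - 1) div 2"
  have "odd p" using p prime_odd_nat by auto
  hence hp: "2 * h = p - 1" "h div 2 = p div 4" unfolding h_def by (elim oddE; simp; linarith)+
  have "\<not> int p dvd 28"
  proof
    assume "int p dvd 28"
    moreover have "784 * v = 28 * (28 * v)" by simp
    ultimately have "int p dvd 784 * v" by (metis dvd_mult2)
    hence "int p dvd 1" using v by (simp add: cong_dvd_iff)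
    thus False using p by auto
  qed
  hence "[28 ^ (2 * h) = 1] (mod int p)" unfolding hp by (rule fermat_int[OF p(1)])
  hence f: "[784 ^ h = 1] (mod int p)" by (simp add: power_mult)
  have "quartic_value p = (\<Sum>r\<le>h div 2. int (quartic_coeff r) * 784 ^ (h - 2 * r))"
    unfolding quartic_value_def Let_def h_def[symmetric] sum_distrib_left
  proof (rule sum.cong[OF refl])
    fix r assume "r \<in> {..h div 2}"
    moreover have "h = 2 * (h div 2) + h mod 2" by simp
    ultimately have "h - 2 * r = h mod 2 + 2 * (h div 2 - r)" unfolding atMost_iff by linarith
    hence "784 ^ (h - 2 * r) = (784 :: int) ^ (h mod 2) * (784 ^ 2) ^ (h div 2 - r)"
      by (simp only: power_add power_mult)
    thus "784 ^ (h mod 2) * (int (quartic_coeff r) * (784 ^ 2) ^ (h div 2 - r)) = int (quartic_coeff r) * 784 ^ (h - 2 * r)"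
      by simp
  qed
  also have "[\<dots> = (\<Sum>r\<le>h div 2. int (quartic_coeff r) * (v ^ 2) ^ r)] (mod int p)"
  proof (intro cong_sum cong_scalar_left)
    fix r assume "r \<in> {..h div 2}"
    hence r: "2 * r \<le> h" by auto
    have "[784 ^ (h - 2 * r) * 1 ^ (2 * r) = 784 ^ (h - 2 * r) * (784 * v) ^ (2 * r)] (mod int p)"
      by (intro cong_scalar_left cong_pow cong_sym[OF v])
    moreover have "784 ^ (h - 2 * r) * (784 * v) ^ (2 * r) = 784 ^ h * (v ^ 2) ^ r"
    proof -
      have "(784 :: int) ^ h = 784 ^ (h - 2 * r) * 784 ^ (2 * r)" using r by (simp flip: power_add)
      thus ?thesis by (simp only: power_mult_distrib power_mult mult.assoc)
    qed
    moreover have "[784 ^ h * (v ^ 2) ^ r = 1 * (v ^ 2) ^ r] (mod int p)"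
      by (intro cong_scalar_right f)
    ultimately show "[784 ^ (h - 2 * r) = (v ^ 2) ^ r] (mod int p)"
      using cong_trans by (simp only: power_one mult_1_right mult_1_left) blast
  qed
  finally show ?thesis unfolding hp .
qed

text \<open>
  The cubic transformation at \<open>u = 1/108\<close>: there \<open>1 - 108 u\<close>, the double zero of \<open>1 - 256 u (1 - 27 u) ^ 3\<close>,
  vanishes, and the other argument \<open>u ^ 3 (1 - 27 u) / (1 - 24 u) ^ 4\<close> is \<open>1 / 784 ^ 2\<close>.
\<close>

lemma quartic_value_eq_sum_at_256:
  assumes p: "prime p" "p > 7"
  obtains z where "[256 * z = 1] (mod int p)"
    and "[quartic_value p = (\<Sum>k\<le>p div 4. int (quartic_coeff k) * z ^ k)] (mod int p)"
proof -
  have nd: "\<not> int p dvd q" if "q \<in> {2, 3, 7}" for q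
    using that p(2) by (auto dest: zdvd_imp_le)
  have prime: "prime (int p)" using p by simp
  have nd108: "\<not> int p dvd 108" and nd784: "\<not> int p dvd 784"
  proof -
    have "(108 :: int) = 2 ^ 2 * 3 ^ 3" "(784 :: int) = 2 ^ 4 * 7 ^ 2" by simp_all
    thus "\<not> int p dvd 108" "\<not> int p dvd 784"
      using nd prime by (simp_all only: prime_dvd_mult_iff prime_dvd_power_iff) simp_all
  qed
  obtain u where u: "[108 * u = 1] (mod int p)" using inverse_mod_prime[OF p(1) nd108] .
  obtain v where v: "[784 * v = 1] (mod int p)" using inverse_mod_prime[OF p(1) nd784] .
  obtain j where j: "108 * u = 1 + int p * j"
    using u by (metis cong_iff_lin cong_sym)
  obtain l where l: "784 * v = 1 + int p * l"
    using v by (metis cong_iff_lin cong_sym)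
  define z where "z = u * (1 - 27 * u) ^ 3"
  define c where "c = 1 - 24 * u"
  have z: "[256 * z = 1] (mod int p)"
  proof -
    have "[27 * (4 - 108 * u) ^ 3 * (108 * u) = 27 * (4 - 1) ^ 3 * 1] (mod int p)"
      by (intro cong_mult cong_pow cong_diff cong_refl u)
    moreover have "27 * (4 - 108 * u) ^ 3 * (108 * u) = 27 * 27 * (256 * z)"
      unfolding z_def by Groebner_Basis.algebra
    ultimately have "[3 ^ 6 * (256 * z) = 3 ^ 6 * 1] (mod int p)" by simp
    moreover have "coprime (3 ^ 6) (int p)"
    proof -
      have "coprime (3 :: int) (int p)"
        using prime_imp_coprime[OF prime nd[of 3]] by (simp add: coprime_commute)
      thus ?thesis by (simp only: coprime_power_left_iff simp_thms)
    qed
    ultimately show ?thesis by (simp only: cong_mult_lcancel)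
  qed
  have c_dvd: "\<not> int p dvd c"
  proof
    assume "int p dvd c"
    hence "int p dvd 9 * c" by simp
    moreover have "9 * c = 7 - 2 * (int p * j)" using j unfolding c_def by Groebner_Basis.algebra
    ultimately have "int p dvd 7 - 2 * (int p * j)" by simp
    hence "int p dvd 7 - 2 * (int p * j) + 2 * (int p * j)" by (intro dvd_add) auto
    thus False using nd[of 7] by simp
  qed
  have key: "[u ^ 3 * (1 - 27 * u) = c ^ 4 * v ^ 2] (mod int p)"
  proof -
    have "[(108 * u) ^ 3 * (108 - 27 * (108 * u)) * 784 ^ 2 = 1 ^ 3 * (108 - 27 * 1) * 784 ^ 2] (mod int p)"
      by (intro cong_mult cong_pow cong_diff cong_refl u)
    moreover have "[(108 - 24 * (108 * u)) ^ 4 * (784 * v) ^ 2 = (108 - 24 * 1) ^ 4 * 1 ^ 2] (mod int p)"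
      by (intro cong_mult cong_pow cong_diff cong_refl u v)
    ultimately have "[(108 * u) ^ 3 * (108 - 27 * (108 * u)) * 784 ^ 2 = (108 - 24 * (108 * u)) ^ 4 * (784 * v) ^ 2] (mod int p)"
      using cong_trans cong_sym by (simp only: power_one) (simp, blast)
    moreover have "(108 * u) ^ 3 * (108 - 27 * (108 * u)) * 784 ^ 2 = 108 ^ 4 * 784 ^ 2 * (u ^ 3 * (1 - 27 * u))"
      by Groebner_Basis.algebra
    moreover have "(108 - 24 * (108 * u)) ^ 4 * (784 * v) ^ 2 = 108 ^ 4 * 784 ^ 2 * (c ^ 4 * v ^ 2)"
      unfolding c_def by Groebner_Basis.algebra
    ultimately have "[108 ^ 4 * 784 ^ 2 * (u ^ 3 * (1 - 27 * u)) = 108 ^ 4 * 784 ^ 2 * (c ^ 4 * v ^ 2)] (mod int p)"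
      by (simp only:)
    moreover have "coprime (108 ^ 4 * 784 ^ 2) (int p)"
    proof -
      have "coprime (108 :: int) (int p)" "coprime (784 :: int) (int p)"
        using prime_imp_coprime[OF prime nd108] prime_imp_coprime[OF prime nd784] by (simp_all only: coprime_commute)
      thus ?thesis by (simp only: coprime_mult_left_iff coprime_power_left_iff simp_thms)
    qed
    ultimately show ?thesis using cong_mult_lcancel by blast
  qed
  have "[quartic_value p = (\<Sum>k\<le>p div 4. int (quartic_coeff k) * (v ^ 2) ^ k)] (mod int p)"
    by (rule quartic_value_at_28[OF p v])
  also have "[(\<Sum>k\<le>p div 4. int (quartic_coeff k) * (v ^ 2) ^ k) =
     (\<Sum>k\<le>p div 4. int (quartic_coeff k) * (u ^ 3 * (1 - 27 * u)) ^ k * (1 - 24 * u) ^ (p - 1 - 4 * k))] (mod int p)"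
  proof (rule cong_sum)
    fix k assume "k \<in> {..p div 4}"
    hence "4 * k \<le> p" by auto
    moreover have "4 * k \<noteq> p" by (rule four_mult_neq_prime[OF p(1)])
    ultimately have k: "p - 1 = 4 * k + (p - 1 - 4 * k)" by linarith
    have "[(v ^ 2) ^ k * 1 = (v ^ 2) ^ k * c ^ (p - 1)] (mod int p)"
      by (intro cong_scalar_left cong_sym[OF fermat_int[OF p(1) c_dvd]])
    moreover have "(v ^ 2) ^ k * c ^ (p - 1) = (c ^ 4 * v ^ 2) ^ k * c ^ (p - 1 - 4 * k)"
    proof -
      have "c ^ (p - 1) = (c ^ 4) ^ k * c ^ (p - 1 - 4 * k)"
        by (subst k) (simp only: power_add power_mult)
      thus ?thesis by (simp only: power_mult_distrib mult_ac)
    qed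
    moreover have "[(c ^ 4 * v ^ 2) ^ k * c ^ (p - 1 - 4 * k) = (u ^ 3 * (1 - 27 * u)) ^ k * c ^ (p - 1 - 4 * k)] (mod int p)"
      by (intro cong_scalar_right cong_pow cong_sym[OF key])
    ultimately have "[(v ^ 2) ^ k = (u ^ 3 * (1 - 27 * u)) ^ k * c ^ (p - 1 - 4 * k)] (mod int p)"
      using cong_trans by (simp only: mult_1_right) blast
    thus "[int (quartic_coeff k) * (v ^ 2) ^ k =
       int (quartic_coeff k) * (u ^ 3 * (1 - 27 * u)) ^ k * (1 - 24 * u) ^ (p - 1 - 4 * k)] (mod int p)"
      unfolding mult.assoc c_def by (rule cong_scalar_left)
  qed
  also have "[(\<Sum>k\<le>p div 4. int (quartic_coeff k) * (u ^ 3 * (1 - 27 * u)) ^ k * (1 - 24 * u) ^ (p - 1 - 4 * k)) =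
     (\<Sum>k\<le>p div 4. int (quartic_coeff k) * z ^ k)] (mod int p)"
    unfolding z_def by (rule cong_sym, rule quartic_sum_cubic_transformation[OF p(1)])
  finally show ?thesis using that z by blast
qed

lemma quartic_value_7: "[quartic_value 7 = 0] (mod int 7)"
proof -
  have "7 dvd (784 :: int)" by simp
  hence "7 dvd (784 :: int) ^ 1 * x" for x by simp
  moreover have "(3 :: nat) mod 2 = 1" by simp
  ultimately show ?thesis unfolding quartic_value_def Let_def cong_0_iff by simp
qed

lemma coprime_power_2: "prime p \<Longrightarrow> p > 2 \<Longrightarrow> coprime (2 ^ k) (int p)"
proof -
  assume p: "prime p" "p > 2"
  have "coprime (int p) 2"
    using p by (intro prime_imp_coprime) (auto dest: zdvd_imp_le)
  thus ?thesis by (simp add: coprime_commute)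
qed

lemma div_4_conv_div_8: "(p :: nat) div 4 = 2 * (p div 8) + p mod 8 div 4"
proof -
  have p: "p mod 8 + 4 * (2 * (p div 8)) = p" using mod_mult_div_eq[of p 8] by simp
  have "(p mod 8 + 4 * (2 * (p div 8))) div 4 = 2 * (p div 8) + p mod 8 div 4"
    by (rule div_mult_self2) simp
  thus ?thesis unfolding p .
qed

lemma quartic_value_5_7_mod_8:
  assumes p: "prime p" "p > 5" and p8: "p mod 8 \<in> {5, 7}"
  shows "[quartic_value p = 0] (mod int p)"
proof (cases "p = 7")
  case True thus ?thesis using quartic_value_7 by simp
next
  case False
  have "p \<noteq> 6"
  proof
    assume "p = 6" thus False using p8 by simp
  qed
  hence p7: "p > 7" using p False by linarith
  obtain z where z: "[256 * z = 1] (mod int p)"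
    and lv: "[quartic_value p = (\<Sum>k\<le>p div 4. int (quartic_coeff k) * z ^ k)] (mod int p)"
    using quartic_value_eq_sum_at_256[OF p(1) p7] .
  have "p mod 8 = 5 \<or> p mod 8 = 7" using p8 by simp
  hence "p div 4 = 2 * (p div 8) + 1" unfolding div_4_conv_div_8[of p] by auto
  hence "odd (p div 4)" by simp
  hence "[4 ^ (p div 4) * (\<Sum>k\<le>p div 4. int (quartic_coeff k) * z ^ k) = 4 ^ (p div 4) * 0] (mod int p)"
    using quartic_sum_at_256[OF p(1) _ z] p7 by simp
  moreover have "coprime (4 ^ (p div 4)) (int p)"
    using coprime_power_2[OF p(1), of "2 * (p div 4)"] p7 by (simp add: power_mult)
  ultimately have "[(\<Sum>k\<le>p div 4. int (quartic_coeff k) * z ^ k) = 0] (mod int p)"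
    using cong_mult_lcancel by blast
  with lv show ?thesis by (rule cong_trans)
qed

text \<open>
  If \<open>p = 8 m + 1\<close>, the powers of 2 combine to \<open>2 ^ (p - 1)\<close>.  If \<open>p = 8 m + 3\<close>, there remains
  \<open>2 ^ ((p - 1) / 2)\<close>, which is -1: from \<open>x ^ 2 \<equiv> - 2 y ^ 2\<close> one sees that -2 is a square modulo \<open>p\<close>,
  and \<open>(p - 1) / 2\<close> is odd.
\<close>

lemma quartic_value_1_3_mod_8:
  fixes x y :: int
  assumes p: "prime p" "p > 5" and p8: "p mod 8 \<in> {1, 3}" and rep: "int p = x ^ 2 + 2 * y ^ 2"
  shows "[quartic_value p = 4 * x ^ 2] (mod int p)"
proof -
  have or: "p mod 8 = 1 \<or> p mod 8 = 3" using p8 by simp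
  have p7: "p > 7"
  proof -
    have "p \<noteq> 6" "p \<noteq> 7" using or by auto
    thus ?thesis using p(2) by linarith
  qed
  obtain z where z: "[256 * z = 1] (mod int p)"
    and lv: "[quartic_value p = (\<Sum>k\<le>p div 4. int (quartic_coeff k) * z ^ k)] (mod int p)"
    using quartic_value_eq_sum_at_256[OF p(1) p7] .
  define m where "m = p div 8"
  define C where "C = int ((2 * m) choose m)"
  define V where "V = quartic_value p"
  have n: "p div 4 = 2 * m" unfolding m_def div_4_conv_div_8[of p] using or by auto
  have "[16 ^ m * (\<Sum>k\<le>p div 4. int (quartic_coeff k) * z ^ k) = C ^ 2] (mod int p)"
    using quartic_sum_at_256[OF p(1) _ z] p7 unfolding n m_def[symmetric] C_def by (simp add: power_mult)
  moreover have "[16 ^ m * V = 16 ^ m * (\<Sum>k\<le>p div 4. int (quartic_coeff k) * z ^ k)] (mod int p)"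
    unfolding V_def by (rule cong_scalar_left[OF lv])
  ultimately have CV: "[16 ^ m * V = C ^ 2] (mod int p)" using cong_trans by blast
  have nd2: "\<not> int p dvd 2" using p7 by (auto dest: zdvd_imp_le)
  consider "p = 8 * m + 1" | "p = 8 * m + 3"
  proof -
    have "p = 8 * m + p mod 8" unfolding m_def by simp
    thus ?thesis using or that by metis
  qed
  thus ?thesis
  proof cases
    case 1
    have "[4 * x ^ 2 = 16 ^ m * C ^ 2] (mod int p)"
      unfolding C_def by (rule representation_central_binomial_1_mod_8[OF p(1) 1 rep])
    also have "[16 ^ m * C ^ 2 = 16 ^ m * (16 ^ m * V)] (mod int p)"
      by (intro cong_scalar_left cong_sym[OF CV])
    also have "16 ^ m * (16 ^ m * V) = 2 ^ (p - 1) * V"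
    proof -
      have "(2 :: int) ^ (8 * m) = 16 ^ m * 16 ^ m" by (simp add: power_mult flip: power_mult_distrib)
      thus ?thesis by (simp add: 1)
    qed
    also have "[2 ^ (p - 1) * V = 1 * V] (mod int p)"
      by (intro cong_scalar_right fermat_int p nd2)
    finally show ?thesis unfolding V_def by (simp add: cong_sym_eq)
  next
    case 2
    have x_eq: "x ^ 2 = - 2 * y ^ 2 + int p" using rep by simp
    have ndy: "\<not> int p dvd y"
    proof
      assume "int p dvd y"
      hence "int p dvd x ^ 2" unfolding x_eq by (simp add: power2_eq_square)
      hence "int p dvd x" using p(1) by (simp add: prime_dvd_power_iff)
      then obtain i where i: "x = int p * i" by (elim dvdE)
      obtain j where j: "y = int p * j" using \<open>int p dvd y\<close> by (elim dvdE)
      have "int p * 1 = int p * (int p * (i ^ 2 + 2 * j ^ 2))"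
        using rep unfolding i j by Groebner_Basis.algebra
      hence "1 = int p * (i ^ 2 + 2 * j ^ 2)" using p7 by simp
      hence "int p dvd 1" by (metis dvd_triv_left)
      thus False using p7 by simp
    qed
    have ndx: "\<not> int p dvd x"
    proof
      assume "int p dvd x"
      hence "int p dvd - 2 * y ^ 2 + int p" unfolding x_eq[symmetric] by (simp add: power2_eq_square)
      hence "int p dvd - 2 * y ^ 2" by (simp only: dvd_add_left_iff dvd_refl)
      hence "int p dvd 2 * y ^ 2" by simp
      thus False using nd2 ndy p(1) by (simp add: prime_dvd_mult_iff prime_dvd_power_iff)
    qed
    have e: "2 * (4 * m + 1) = p - 1" using 2 by simp
    have xy: "[x ^ 2 = - 2 * y ^ 2] (mod int p)" unfolding x_eq by (simp add: cong_iff_dvd_diff)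
    have two: "[2 ^ (4 * m + 1) = - 1] (mod int p)"
    proof -
      have "[1 = x ^ (2 * (4 * m + 1))] (mod int p)" unfolding e by (rule cong_sym, rule fermat_int[OF p(1) ndx])
      also have "[x ^ (2 * (4 * m + 1)) = (- 2 * y ^ 2) ^ (4 * m + 1)] (mod int p)"
        unfolding power_mult by (intro cong_pow xy)
      also have "(- 2 * y ^ 2) ^ (4 * m + 1) = (- 2) ^ (4 * m + 1) * y ^ (2 * (4 * m + 1))"
        by (simp only: power_mult_distrib power_mult)
      also have "[(- 2) ^ (4 * m + 1) * y ^ (2 * (4 * m + 1)) = (- 2) ^ (4 * m + 1) * 1] (mod int p)"
        unfolding e by (intro cong_scalar_left fermat_int p ndy)
      finally have "[1 = - (2 ^ (4 * m + 1))] (mod int p)" by simp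
      hence "[- 1 * 1 = - 1 * - (2 ^ (4 * m + 1))] (mod int p)" by (rule cong_scalar_left)
      thus ?thesis by (simp add: cong_sym_eq)
    qed
    have y: "[y ^ 2 = 256 ^ m * (16 ^ m * V)] (mod int p)"
    proof -
      have "[y ^ 2 = 256 ^ m * C ^ 2] (mod int p)"
        unfolding C_def by (rule representation_central_binomial_3_mod_8[OF p(1) 2 rep])
      also have "[256 ^ m * C ^ 2 = 256 ^ m * (16 ^ m * V)] (mod int p)"
        by (intro cong_scalar_left cong_sym[OF CV])
      finally show ?thesis .
    qed
    have "[4 * x ^ 2 = 4 * (- 2 * y ^ 2)] (mod int p)" by (intro cong_scalar_left xy)
    also have "4 * (- 2 * y ^ 2) = - 8 * y ^ 2" by simp
    also have "[- 8 * y ^ 2 = - 8 * (256 ^ m * (16 ^ m * V))] (mod int p)" by (intro cong_scalar_left y)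
    also have "- 8 * (256 ^ m * (16 ^ m * V)) = 2 ^ (p - 1) * (- V * 2 ^ (4 * m + 1))"
    proof -
      have "(2 :: int) ^ (p - 1) = 4 * 256 ^ m" by (simp add: 2 power_add power_mult)
      moreover have "(2 :: int) ^ (4 * m + 1) = 2 * 16 ^ m" by (simp add: power_mult)
      ultimately show ?thesis by simp
    qed
    also have "[2 ^ (p - 1) * (- V * 2 ^ (4 * m + 1)) = 1 * (- V * - 1)] (mod int p)"
      by (intro cong_mult cong_scalar_left fermat_int p nd2 two)
    finally show ?thesis unfolding V_def by (simp add: cong_sym_eq)
  qed
qed

lemma S_sum_fraction:
  fixes M q c e :: int
  assumes p: "prime p" "p > 5" and M: "\<not> int p dvd M"
    and Mc: "M = q * c ^ 2" and M16: "(M - 16) = e * 784" and e: "e = 1 \<or> e = - 1"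
  obtains N where "of_int (Legendre (e * q) (int p)) *
      (\<Sum>k = 0..p - 1. of_nat ((2 * k) choose k) * (of_nat (S k) / (of_int M :: rat) ^ k)) = of_int N / of_int (M ^ (p - 1))"
    and "[N = quartic_value p] (mod int p)"
proof -
  obtain w where w: "[M * w = 1] (mod int p)" using inverse_mod_prime[OF p(1) M] .
  have "[Legendre (e * q) (int p) * (\<Sum>k<p. int ((2 * k) choose k) * int (S k) * w ^ k) = quartic_value p] (mod int p)"
    using legendre_S_sum_cong[OF p(1) _ w M Mc M16 e] p(2) by simp
  from truncated_sum_fraction[OF p(1) M w this] obtain N where
    "of_int (Legendre (e * q) (int p)) * (\<Sum>k = 0..p - 1. of_int (int ((2 * k) choose k) * int (S k)) / (of_int M :: rat) ^ k)
      = of_int N / of_int (M ^ (p - 1))" "[N = quartic_value p] (mod int p)" by blast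
  thus ?thesis by (intro that[of N]) simp_all
qed

theorem theorem3p9:
  fixes p :: nat
  assumes "prime p" and "p > 5"
  shows "let
      A = of_int (Legendre 2 (int p)) *
        (\<Sum>k = 0..p - 1. of_nat ((2 * k) choose k) * (of_nat (S k) / (800 :: rat) ^ k));
      B = of_int (Legendre 3 (int p)) *
        (\<Sum>k = 0..p - 1. of_nat ((2 * k) choose k) * (of_nat (S k) / (- 768 :: rat) ^ k))
    in rat_cong A B p \<and>
       (p mod 8 \<in> {1, 3} \<longrightarrow>
          (\<exists>x y :: int. int p = x ^ 2 + 2 * y ^ 2) \<and>
          (\<forall>x y :: int. int p = x ^ 2 + 2 * y ^ 2 \<longrightarrow> rat_cong B (of_int (4 * x ^ 2)) p)) \<and>
       (p mod 8 \<in> {5, 7} \<longrightarrow> rat_cong B 0 p)"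
proof -
  have p2: "prime p" "p > 2" using assms by simp_all
  have nd: "\<not> int p dvd q" if "q \<in> {2, 3, 5}" for q
    using that assms(2) by (auto dest: zdvd_imp_le)
  have prime: "prime (int p)" using assms by simp
  have ndA: "\<not> int p dvd 800" and ndB: "\<not> int p dvd - 768"
  proof -
    have "(800 :: int) = 2 ^ 5 * 5 ^ 2" "(768 :: int) = 2 ^ 8 * 3" by simp_all
    thus "\<not> int p dvd 800" "\<not> int p dvd - 768"
      using nd prime by (simp_all only: dvd_minus_iff prime_dvd_mult_iff prime_dvd_power_iff) simp_all
  qed
  define A :: rat where "A = of_int (Legendre 2 (int p)) *
    (\<Sum>k = 0..p - 1. of_nat ((2 * k) choose k) * (of_nat (S k) / 800 ^ k))"
  define B :: rat where "B = of_int (Legendre 3 (int p)) *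
    (\<Sum>k = 0..p - 1. of_nat ((2 * k) choose k) * (of_nat (S k) / (- 768) ^ k))"
  \<comment> \<open>800 = 2 * 20^2 and 800 - 16 = 784; below, -768 = -3 * 16^2 and -768 - 16 = -784.\<close>
  obtain N where A: "A = of_int N / of_int (800 ^ (p - 1))" and N: "[N = quartic_value p] (mod int p)"
    using S_sum_fraction[OF assms ndA, of 2 20 1] unfolding A_def by auto
  obtain K where B: "B = of_int K / of_int ((- 768) ^ (p - 1))" and K: "[K = quartic_value p] (mod int p)"
    using S_sum_fraction[OF assms ndB, of "- 3" 16 "- 1"] unfolding B_def by auto
  have pow1: "[800 ^ (p - 1) = 1] (mod int p)" "[(- 768) ^ (p - 1) = 1] (mod int p)"
    using fermat_int[OF assms(1) ndA] fermat_int[OF assms(1) ndB] by simp_all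
  have ndp: "\<not> int p dvd 800 ^ (p - 1)" "\<not> int p dvd (- 768) ^ (p - 1)"
    using ndA ndB prime prime_dvd_power by blast+
  have AB: "rat_cong A B p"
    unfolding A B
  proof (rule rat_cong_fractions[OF ndp assms(1)])
    have "[N * (- 768) ^ (p - 1) = quartic_value p * 1] (mod int p)" by (intro cong_mult N pow1)
    moreover have "[quartic_value p * 1 = K * 800 ^ (p - 1)] (mod int p)"
      by (rule cong_sym) (intro cong_mult K pow1)
    ultimately show "[N * (- 768) ^ (p - 1) = K * 800 ^ (p - 1)] (mod int p)" by (rule cong_trans)
  qed
  have B_int: "rat_cong B (of_int t) p" if t: "[quartic_value p = t] (mod int p)" for t
  proof -
    have "rat_cong (of_int K / of_int ((- 768) ^ (p - 1))) (of_int t / of_int 1) p"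
    proof (rule rat_cong_fractions[OF ndp(2) _ assms(1)])
      show "\<not> int p dvd 1" using assms(2) by simp
      have "[K * 1 = t * 1] (mod int p)" using cong_trans[OF K t] by simp
      moreover have "[t * 1 = t * (- 768) ^ (p - 1)] (mod int p)"
        by (intro cong_scalar_left cong_sym[OF pow1(2)])
      ultimately show "[K * 1 = t * (- 768) ^ (p - 1)] (mod int p)" by (rule cong_trans)
    qed
    thus ?thesis by (simp add: B)
  qed
  have "rat_cong B (of_int (4 * x ^ 2)) p" if "p mod 8 \<in> {1, 3}" "int p = x ^ 2 + 2 * y ^ 2" for x y :: int
    by (rule B_int, rule quartic_value_1_3_mod_8[OF assms that])
  moreover have "rat_cong B 0 p" if "p mod 8 \<in> {5, 7}"
    using B_int[OF quartic_value_5_7_mod_8[OF assms that]] by simp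
  ultimately show ?thesis
    using AB representation_exists[OF assms(1)] unfolding Let_def A_def B_def by blast
qed

end
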